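(* Let $\lambda>0$, $\sigma_0,\sigma_1>0$. For each $n$ let the point set $\mathcal{V}$ be drawn from the binomial process $\mathcal{U}_{n,\lambda}$, or for each $n$ from the Poisson process $\mathcal{P}_{n,\lambda}$, with marking variables $Y_i$ that are i.i.d. $\mathcal{N}(0,\sigma_0^2)$ and independent of the locations, and let $\mathcal{E}$ be the edge set of the nearest-neighbor graph of $\mathcal{V}$. Let the hypotheses $\mathcal{H}_0,\mathcal{H}_1$ be as in the context, with correlation function $g$. Assuming the almost-sure limit exists, the error exponent $$D:=\lim_{n\to\infty}\frac1n\log\frac{p[\mathbf{Y};\mathcal{H}_0]}{p[\mathbf{Y}|\mathcal{V};\mathcal{H}_1]}\quad\text{(almost-sure limit under }\mathcal{H}_0)$$ is given by the limit of a sum of edge and node functionals of the nearest-neighbor graph: $$D=\log\frac{\sigma_1}{\sigma_0}+\lim_{n\to\infty}\frac1{2n}\Biggl[\sum_{i\in\mathcal{V}}\Bigl(\frac1{\sigma_1^2}-\frac1{\sigma_0^2}\Bigr)Y_i^2+\sum_{\substack{(i,j)\in\mathcal{E}\\ i<j}}\Bigl\{\log[1-g^2(R_{ij})]+\frac{g^2(R_{ij})}{1-g^2(R_{ij})}\frac{Y_i^2+Y_j^2}{\sigma_1^2}-\frac{2g(R_{ij})}{1-g^2(R_{ij})}\frac{Y_iY_j}{\sigma_1^2}\Bigr\}\Biggr],$$ where $R_{ij}$ is the (random) Euclidean length of the edge $(i,j)\in\mathcal{E}$.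
   Context: Point processes: $(B_n)_{n\ge1}$ is a sequence of squares, or a sequence of discs, in $\mathbb{R}^2$ of area $n/\lambda$ centered at the origin. $\mathcal{U}_{n,\lambda}$ (binomial process) consists of $n$ points i.i.d. uniform on $B_n$; $\mathcal{P}_{n,\lambda}$ is the homogeneous Poisson process of intensity $\lambda$ on $B_n$. The marked configurations for all $n$ are defined on a common probability space. Nearest-neighbor graph: $\mathrm{nn}(i):=\arg\min_{j\in\mathcal{V},j\neq i}\mathrm{dist}(i,j)$ (Euclidean distance; almost surely unique), and $(i,j)\in\mathcal{E}$ iff $i=\mathrm{nn}(j)$ or $j=\mathrm{nn}(i)$. The graph is acyclic almost surely; it has no edges if $\mathcal{V}$ has fewer than two points. The condition $i<j$ (for an arbitrary labelling of the points) means each edge is counted once. Hypotheses: given $\mathcal{V}$, $\mathbf{Y}=(Y_i)_{i\in\mathcal{V}}$. Under $\mathcal{H}_0$, $\mathbf{Y}\sim\mathcal{N}(\mathbf{0},\sigma_0^2\mathbf{I})$, independent of the locations. Under $\mathcal{H}_1$, given $\mathcal{V}$, $\mathbf{Y}\sim\mathcal{N}(\mathbf{0},\mathbf{\Sigma}_{1,\mathcal{V}})$ with $\mathbf{\Sigma}_{1,\mathcal{V}}$ positive definite, and $\mathbf{Y}$ is a Gauss-Markov random field with dependency graph the nearest-neighbor graph, meaning $Y_i$ and $Y_j$ ($i\ne j$) are conditionally independent given all other samples if and only if $(i,j)\notin\mathcal{E}$; moreover $\Sigma_{1,\mathcal{V}}(i,i)=\sigma_1^2$ for all $i$ and $\Sigma_{1,\mathcal{V}}(i,j)=\sigma_1^2g(R_{ij})$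 with $g(R_{ij})<1$ for $(i,j)\in\mathcal{E}$. $p[\mathbf{Y};\mathcal{H}_0]$ and $p[\mathbf{Y}|\mathcal{V};\mathcal{H}_1]$ denote the densities of $\mathbf{Y}$ given $\mathcal{V}$. *)

theory Defs
  imports
    "HOL-Probability.Probability"
    "Jordan_Normal_Form.Determinant"
    "Jordan_Normal_Form.Gauss_Jordan_Elimination"
begin

(* The ball of the sup-norm is rotated by an arbitrary orthogonal map, so the
   squares need not be axis-parallel. *)
definition centered_square :: "real \<Rightarrow> (real^2) set \<Rightarrow> bool" where
  "centered_square a B \<longleftrightarrow>
     (\<exists>f :: real^2 \<Rightarrow> real^2. orthogonal_transformation f \<and> B = f ` {x. infnorm x \<le> sqrt a / 2})"

definition centered_disc :: "real \<Rightarrow> (real^2) set \<Rightarrow> bool" where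
  "centered_disc a B \<longleftrightarrow> B = cball 0 (sqrt (a / pi))"


(* A random finite point set is given by its (random) number of points N and by
   the points X 0, ..., X (N - 1) in an arbitrary labelling; X i is irrelevant
   for i >= N.  The list of points in this order is a labelled configuration. *)
definition configuration :: "('w \<Rightarrow> nat) \<Rightarrow> (nat \<Rightarrow> 'w \<Rightarrow> real^2) \<Rightarrow> 'w \<Rightarrow> (real^2) list" where
  "configuration N X \<omega> = map (\<lambda>i. X i \<omega>) [0..<N \<omega>]"

definition sample :: "('w \<Rightarrow> nat) \<Rightarrow> (nat \<Rightarrow> 'w \<Rightarrow> real) \<Rightarrow> 'w \<Rightarrow> real vec" where
  "sample N Y \<omega> = Matrix.vec (N \<omega>) (\<lambda>i. Y i \<omega>)"

definition binomial_process ::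
    "'w measure \<Rightarrow> nat \<Rightarrow> (real^2) set \<Rightarrow> ('w \<Rightarrow> nat) \<Rightarrow> (nat \<Rightarrow> 'w \<Rightarrow> real^2) \<Rightarrow> bool" where
  "binomial_process M n B N X \<longleftrightarrow>
     (\<forall>\<omega>\<in>space M. N \<omega> = n) \<and>
     prob_space.indep_vars M (\<lambda>_. borel) X {..<n} \<and>
     (\<forall>i<n. distr M borel (X i) = uniform_measure lborel B)"

definition point_count ::
    "('w \<Rightarrow> nat) \<Rightarrow> (nat \<Rightarrow> 'w \<Rightarrow> real^2) \<Rightarrow> (real^2) set \<Rightarrow> 'w \<Rightarrow> nat" where
  "point_count N X A \<omega> = card {i. i < N \<omega> \<and> X i \<omega> \<in> A}"

(* The Poisson law is written out because poisson_pmf requires a positive rate,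
   whereas A may have measure zero. *)
definition poisson_process ::
    "'w measure \<Rightarrow> real \<Rightarrow> (real^2) set \<Rightarrow> ('w \<Rightarrow> nat) \<Rightarrow> (nat \<Rightarrow> 'w \<Rightarrow> real^2) \<Rightarrow> bool" where
  "poisson_process M lam B N X \<longleftrightarrow>
     N \<in> measurable M (count_space UNIV) \<and>
     (\<forall>i. X i \<in> borel_measurable M) \<and>
     (AE \<omega> in M. \<forall>i<N \<omega>. X i \<omega> \<in> B) \<and>
     (\<forall>A\<in>sets borel. A \<subseteq> B \<longrightarrow>
        (\<forall>k. Sigma_Algebra.measure M {\<omega> \<in> space M. point_count N X A \<omega> = k} =
               (lam * Sigma_Algebra.measure lborel A) ^ k / fact k
                 * exp (- (lam * Sigma_Algebra.measure lborel A)))) \<and>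
     (\<forall>(A :: nat \<Rightarrow> (real^2) set) m.
        (\<forall>j<m. A j \<in> sets borel \<and> A j \<subseteq> B) \<longrightarrow> disjoint_family_on A {..<m} \<longrightarrow>
        prob_space.indep_vars M (\<lambda>_. count_space UNIV) (\<lambda>j. point_count N X (A j)) {..<m})"

(* Given N = k, the marks of the k points are i.i.d. N(0, sigma^2) and independent
   of the locations. *)
definition iid_normal_marks ::
    "'w measure \<Rightarrow> real \<Rightarrow> ('w \<Rightarrow> nat) \<Rightarrow> (nat \<Rightarrow> 'w \<Rightarrow> real^2) \<Rightarrow> (nat \<Rightarrow> 'w \<Rightarrow> real) \<Rightarrow> bool" where
  "iid_normal_marks M \<sigma> N X Y \<longleftrightarrow>
     (\<forall>i. Y i \<in> borel_measurable M) \<and>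
     (\<forall>k. \<forall>A\<in>sets (PiM {..<k} (\<lambda>_. borel)). \<forall>C\<in>sets (PiM {..<k} (\<lambda>_. borel)).
        Sigma_Algebra.measure M
          {\<omega> \<in> space M. N \<omega> = k \<and> (\<lambda>i\<in>{..<k}. X i \<omega>) \<in> A \<and> (\<lambda>i\<in>{..<k}. Y i \<omega>) \<in> C} =
        Sigma_Algebra.measure M {\<omega> \<in> space M. N \<omega> = k \<and> (\<lambda>i\<in>{..<k}. X i \<omega>) \<in> A} *
        Sigma_Algebra.measure (PiM {..<k} (\<lambda>_. density lborel (normal_density 0 \<sigma>))) C)"


definition nn :: "(real^2) list \<Rightarrow> nat \<Rightarrow> nat" where
  "nn xs i = arg_min_on (\<lambda>j. dist (xs ! i) (xs ! j)) ({..<length xs} - {i})"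

(* The condition i \<noteq> j only matters for configurations with a single point,
   for which nn is an arbitrary value. *)
definition nn_edges :: "(real^2) list \<Rightarrow> (nat \<times> nat) set" where
  "nn_edges xs = {(i, j). i < length xs \<and> j < length xs \<and> i \<noteq> j \<and> (i = nn xs j \<or> j = nn xs i)}"


definition pos_def_mat :: "nat \<Rightarrow> real mat \<Rightarrow> bool" where
  "pos_def_mat k S \<longleftrightarrow> S \<in> carrier_mat k k \<and> transpose_mat S = S \<and>
     (\<forall>v\<in>carrier_vec k. v \<noteq> 0\<^sub>v k \<longrightarrow> scalar_prod v (mult_mat_vec S v) > 0)"

definition mvn_density :: "real mat \<Rightarrow> real vec \<Rightarrow> real" where
  "mvn_density S y =
     exp (- scalar_prod y (mult_mat_vec (the (mat_inverse S)) y) / 2)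
       / sqrt ((2 * pi) ^ dim_row S * Determinant.det S)"

definition mvn :: "nat \<Rightarrow> real mat \<Rightarrow> (nat \<Rightarrow> real) measure" where
  "mvn k S = density (PiM {..<k} (\<lambda>_. lborel)) (\<lambda>y. ennreal (mvn_density S (Matrix.vec k y)))"

definition cond_indep_vars ::
    "'a measure \<Rightarrow> 'a measure \<Rightarrow> ('a \<Rightarrow> real) \<Rightarrow> ('a \<Rightarrow> real) \<Rightarrow> bool" where
  "cond_indep_vars M F U V \<longleftrightarrow>
     (\<forall>A\<in>sets borel. \<forall>C\<in>sets borel.
        AE \<omega> in M. real_cond_exp M F (\<lambda>\<omega>. indicator A (U \<omega>) * indicator C (V \<omega>)) \<omega> =
                   real_cond_exp M F (\<lambda>\<omega>. indicator A (U \<omega>)) \<omega> *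
                   real_cond_exp M F (\<lambda>\<omega>. indicator C (V \<omega>)) \<omega>)"

definition coord_algebra :: "(nat \<Rightarrow> real) measure \<Rightarrow> nat set \<Rightarrow> (nat \<Rightarrow> real) measure" where
  "coord_algebra M I = vimage_algebra (space M) (\<lambda>y. restrict y I) (PiM I (\<lambda>_. borel))"

definition gauss_markov :: "nat \<Rightarrow> (nat \<times> nat) set \<Rightarrow> real mat \<Rightarrow> bool" where
  "gauss_markov k E S \<longleftrightarrow>
     (\<forall>i<k. \<forall>j<k. i \<noteq> j \<longrightarrow>
        (cond_indep_vars (mvn k S) (coord_algebra (mvn k S) ({..<k} - {i, j})) (\<lambda>y. y i) (\<lambda>y. y j)
           \<longleftrightarrow> (i, j) \<notin> E))"

definition H1_covariance :: "(real \<Rightarrow> real) \<Rightarrow> real \<Rightarrow> (real^2) list \<Rightarrow> real mat \<Rightarrow> bool" where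
  "H1_covariance g \<sigma>1 xs S \<longleftrightarrow>
     pos_def_mat (length xs) S \<and>
     gauss_markov (length xs) (nn_edges xs) S \<and>
     (\<forall>i<length xs. S $$ (i, i) = \<sigma>1\<^sup>2) \<and>
     (\<forall>(i, j)\<in>nn_edges xs. S $$ (i, j) = \<sigma>1\<^sup>2 * g (dist (xs ! i) (xs ! j))
                            \<and> g (dist (xs ! i) (xs ! j)) < 1)"

definition H0_covariance :: "real \<Rightarrow> (real^2) list \<Rightarrow> real mat" where
  "H0_covariance \<sigma>0 xs = smult_mat (\<sigma>0\<^sup>2) (1\<^sub>m (length xs))"

end

(* The nearest-neighbour graph of a configuration without ties is a forest: the distance to the
   nearest neighbour decreases strictly along the graph until two mutual nearest neighbours are
   reached. If y_i and y_j are conditionally independent given the rest, then the entry (i, j) of the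
   precision matrix A vanishes, since the conditional density of (s, t) is proportional to
   u(s) w(t) exp (- A_ij s t), whose cross ratio over the four quadrants differs from 1 when A_ij is
   nonzero. A covariance matrix S whose inverse is supported on a forest is diagonalised by the
   residuals y_i - g_i y_(p i) along the edges, so det S and the quadratic form of A are explicit and
   the log-likelihood ratio equals N log (s1 / s0) plus half the sum of node and edge terms, for every
   n. Finally N / n tends to 1 almost surely (Chernoff and Borel-Cantelli in the Poisson case), and
   ties almost surely do not occur. *)

theory Submission
  imports Defs
begin

text \<open>The identity behind the limit is exact and pathwise: it holds for every tie-free
  configuration and every value of the marks. Probability theory only supplies the absence of ties
  and the ratio N / n, which enters because log (s1 / s0) occurs N times while the exponent is
  normalised by n. H1 prescribes S only on the diagonal and on the edges. The remaining covariances
  are forced by the Markov property through S(i, k) = g_i S(p i, k) for k of smaller rank than i,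
  and this makes the residuals uncorrelated. The residual along an edge has variance s1^2 (1 - g^2),
  a root keeps y_i with variance s1^2. In the weighted square of a residual the term y_i^2 / s1^2
  splits off and leaves an expression symmetric in both endpoints; hence the final formula does not
  depend on the orientation of the forest. The Markov property is given through conditional
  expectations with respect to sigma-algebras, so these have to be computed under a density before
  anything is known about the precision matrix. Existence of the limit on the right is derived, not
  assumed: by the identity it follows from the existence of D.\<close>

section \<open>Covariance matrices with a forest as dependency graph\<close>

text \<open>
  A forest is given by its parent map \<open>p\<close>, with \<open>p i = i\<close> and \<open>\<gamma> i = 0\<close> at the roots, and by a rank
  that increases from parent to child. The vertex of maximal rank is a leaf; eliminating it replaces
  \<open>A\<close> by a Schur complement, which only changes the diagonal entry of its parent.
\<close>

lemma forest_recursion: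
  fixes S A :: "nat \<Rightarrow> nat \<Rightarrow> real" and rk p :: "nat \<Rightarrow> nat"
  assumes "finite V" "inj_on rk V" "s \<noteq> 0"
    and "\<And>i k. i \<in> V \<Longrightarrow> k \<in> V \<Longrightarrow> (\<Sum>j\<in>V. A i j * S j k) = (if i = k then 1 else 0)"
    and "\<And>i k. i \<in> V \<Longrightarrow> k \<in> V \<Longrightarrow> S i k = S k i"
    and "\<And>i. i \<in> V \<Longrightarrow> S i i = s"
    and "\<And>i. i \<in> V \<Longrightarrow> p i \<in> V"
    and "\<And>i. i \<in> V \<Longrightarrow> p i \<noteq> i \<Longrightarrow> rk (p i) < rk i"
    and "\<And>i. i \<in> V \<Longrightarrow> p i \<noteq> i \<Longrightarrow> S i (p i) = s * \<gamma> i"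
    and "\<And>i. i \<in> V \<Longrightarrow> p i = i \<Longrightarrow> \<gamma> i = 0"
    and "\<And>i j. i \<in> V \<Longrightarrow> j \<in> V \<Longrightarrow> i \<noteq> j \<Longrightarrow> j \<noteq> p i \<Longrightarrow> i \<noteq> p j \<Longrightarrow> A i j = 0"
    and "i \<in> V" "k \<in> V" "rk k < rk i"
  shows "S i k = \<gamma> i * S (p i) k"
  using assms
proof (induction "card V" arbitrary: V A i k)
  case 0
  then show ?case by simp
next
  case (Suc n)
  note fin = Suc.prems(1) and inj = Suc.prems(2) and s = Suc.prems(3) and inv = Suc.prems(4)
    and sym = Suc.prems(5) and diag = Suc.prems(6) and pV = Suc.prems(7) and rkp = Suc.prems(8)
    and edge = Suc.prems(9) and root = Suc.prems(10) and pat = Suc.prems(11)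
  have "Max (rk ` V) \<in> rk ` V" using fin Suc.prems(12) by (intro Max_in) auto
  then obtain l where l: "l \<in> V" "Max (rk ` V) = rk l" by auto
  have lmax: "rk j \<le> rk l" if "j \<in> V" for j
    using fin that l(2) Max_ge[of "rk ` V" "rk j"] by simp
  note l = l(1)
  have child: "p j \<noteq> l" if "j \<in> V" "j \<noteq> l" for j
    using that rkp[of j] lmax[of j] by fastforce
  \<comment> \<open>No other vertex has \<open>l\<close> as its parent, so row \<open>l\<close> of
    \<open>A\<close> is supported on \<open>l\<close> and \<open>p l\<close>, and A S = 1 has at
    most two terms in this row. Below it is read off in the columns \<open>l\<close>,
    \<open>p l\<close> and \<open>k\<close>.\<close>
  have row: "A l l * S l k + (if p l = l then 0 else A l (p l) * S (p l) k) = (if l = k then 1 else 0)"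
    if "k \<in> V" for k
  proof -
    have "(\<Sum>j\<in>V. A l j * S j k) = (\<Sum>j\<in>{l, p l}. A l j * S j k)"
    proof (rule sum.mono_neutral_right)
      show "\<forall>j\<in>V - {l, p l}. A l j * S j k = 0"
        using pat[OF l] child by fastforce
    qed (use fin l pV in auto)
    then show ?thesis using inv[OF l that] by auto
  qed
  \<comment> \<open>If the pivot vanished below a parent, column \<open>p l\<close> would force
    \<open>A l (p l) = 0\<close>, and then column \<open>l\<close> would read 0 = 1.\<close>
  have All: "A l l \<noteq> 0"
  proof
    assume a: "A l l = 0"
    show False
    proof (cases "p l = l")
      case True then show False using row[OF l] a by simp
    next
      case False
      then have "A l (p l) * s = 0" using row[OF pV[OF l]] a diag[OF pV[OF l]] by simp
      then show False using row[OF l] a s False by simp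
    qed
  qed
  \<comment> \<open>Column \<open>p l\<close> gives \<open>A l (p l) = - \<gamma> l * A l l\<close>;
    inserting this into column \<open>k\<close> and cancelling the pivot leaves the recursion at
    \<open>l\<close>.\<close>
  have step: "S l k = \<gamma> l * S (p l) k" if k: "k \<in> V" "k \<noteq> l" for k
  proof (cases "p l = l")
    case True then show ?thesis using row[OF k(1)] k All root[OF l] by auto
  next
    case False
    have "A l l * (s * \<gamma> l) + A l (p l) * s = 0"
      using row[OF pV[OF l]] False edge[OF l] diag[OF pV[OF l]] by simp
    then have "s * (A l (p l) + \<gamma> l * A l l) = 0" by (simp add: algebra_simps)
    then have "A l (p l) = - \<gamma> l * A l l" using s by (simp add: add_eq_0_iff)
    then have "A l l * (S l k - \<gamma> l * S (p l) k) = 0" using row[OF k(1)] False k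
      by (simp add: algebra_simps)
    then show ?thesis using All by simp
  qed
  show ?case
  proof (cases "i = l")
    case True
    then show ?thesis using step[of k] Suc.prems by auto
  next
    case False
    have kl: "k \<noteq> l" using Suc.prems(12,14) lmax[of i] by auto
    let ?V = "V - {l}" and ?A = "\<lambda>i j. A i j - A i l * A l j / A l l"
    show ?thesis
    proof (rule Suc.hyps(1)[of ?V ?A])
      show "n = card ?V" using Suc.hyps(2) l fin by simp
      show "inj_on rk ?V" using inj by (auto simp: inj_on_def)
      show "(\<Sum>j\<in>?V. ?A i j * S j k) = (if i = k then 1 else 0)" if ik: "i \<in> ?V" "k \<in> ?V" for i k
      proof -
        have *: "(\<Sum>j\<in>?V. A i' j * S j k) = (if i' = k then 1 else 0) - A i' l * S l k" if "i' \<in> V" for i'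
          using inv[OF that, of k] ik sum.remove[OF fin l, of "\<lambda>j. A i' j * S j k"] by simp
        \<comment> \<open>Subtracting the multiple \<open>A i l / A l l\<close> of row
          \<open>l\<close> cancels the terms with \<open>S l k\<close> that are lost when
          \<open>l\<close> is removed. So \<open>?A\<close> inverts the restriction of
          \<open>S\<close> to \<open>?V\<close>.\<close>
        have "(\<Sum>j\<in>?V. ?A i j * S j k) =
            (\<Sum>j\<in>?V. A i j * S j k) - A i l / A l l * (\<Sum>j\<in>?V. A l j * S j k)"
          by (simp add: sum_distrib_left sum_subtractf[symmetric] algebra_simps)
        also have "\<dots> = (if i = k then 1 else 0)"
          using *[of i] *[OF l] ik All by simp
        finally show ?thesis .
      qed
      \<comment> \<open>The correction is nonzero only if \<open>i\<close> and \<open>j\<close> are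
        both adjacent to \<open>l\<close>. Both are then the parent of \<open>l\<close>, which is
        impossible off the diagonal.\<close>
      show "?A i j = 0" if ij: "i \<in> ?V" "j \<in> ?V" "i \<noteq> j" "j \<noteq> p i" "i \<noteq> p j" for i j
      proof -
        have "A i j = 0" using pat ij by auto
        moreover have "A i l = 0 \<or> A l j = 0"
          using ij child[of i] child[of j] pat[of i l] pat[of l j] l by (metis Diff_iff singletonI)
        ultimately show ?thesis by auto
      qed
      show "p i \<in> ?V" if "i \<in> ?V" for i using that pV child by auto
    qed (use Suc.prems False kl fin in auto)
  qed
qed

lemma pos_def_mat_mat_inverse:
  assumes "pos_def_mat n S"
  obtains A where "mat_inverse S = Some A" "A \<in> carrier_mat n n" "S * A = 1\<^sub>m n" "A * S = 1\<^sub>m n"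
proof -
  have S: "S \<in> carrier_mat n n" using assms by (simp add: pos_def_mat_def)
  have "Determinant.det S \<noteq> 0"
  proof
    assume "Determinant.det S = 0"
    then obtain v where v: "v \<in> carrier_vec n" "v \<noteq> 0\<^sub>v n" "mult_mat_vec S v = 0\<^sub>v n"
      using det_0_iff_vec_prod_zero_field[OF S] by auto
    then have "scalar_prod v (0\<^sub>v n) > 0"
      using assms by (metis pos_def_mat_def)
    then show False using scalar_prod_right_zero[OF v(1)] by simp
  qed
  then have "S \<in> Units (ring_mat TYPE(real) n ())"
    by (rule det_non_zero_imp_unit[OF S])
  then have "mat_inverse S \<noteq> None" using mat_inverse(1)[OF S, of "()"] by blast
  then show ?thesis using mat_inverse(2)[OF S] that by blast
qed

text \<open>Positive definiteness is tested on e_i - c e_j. It yields g^2 < 1 on the edges, whereas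
  H1 states only g < 1; the logarithms and quotients of the edge terms depend on this.\<close>

lemma pos_def_mat_correlation_bound:
  assumes "pos_def_mat n S" "i < n" "j < n" "i \<noteq> j" "S $$ (i, i) = s" "S $$ (j, j) = s"
    "S $$ (i, j) = s * c"
  shows "s * (1 - c\<^sup>2) > 0"
proof -
  have S: "S \<in> carrier_mat n n" and sym: "transpose_mat S = S" using assms(1) by (auto simp: pos_def_mat_def)
  have ji: "S $$ (j, i) = s * c" using sym assms S by (metis carrier_matD index_transpose_mat(1))
  define v where "v = Matrix.vec n (\<lambda>k. (if k = i then 1 else 0) - (if k = j then c else 0))"
  have v: "v \<in> carrier_vec n" "v \<noteq> 0\<^sub>v n"
  proof -
    have "vec_index v i = 1" using assms by (simp add: v_def)
    then show "v \<noteq> 0\<^sub>v n" using assms by auto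
  qed (simp add: v_def)
  have "vec_index (mult_mat_vec S v) k = S $$ (k, i) - c * S $$ (k, j)" if "k < n" for k
    using that S assms by (simp add: v_def scalar_prod_def sum_subtractf right_diff_distrib
       sum.delta' if_distrib[of "\<lambda>x. _ * x"] cong: if_cong)
  then have "scalar_prod v (mult_mat_vec S v) = (\<Sum>k<n. ((if k = i then 1 else 0) - (if k = j then c else 0)) * (S $$ (k, i) - c * S $$ (k, j)))"
    using S by (simp add: scalar_prod_def v_def atLeast0LessThan)
  also have "\<dots> = (S $$ (i, i) - c * S $$ (i, j)) - c * (S $$ (j, i) - c * S $$ (j, j))"
    using assms by (simp add: left_diff_distrib sum_subtractf if_distrib[of "\<lambda>x. x * _"] cong: if_cong)
  also have "\<dots> = s * (1 - c\<^sup>2)" using assms ji by (simp add: algebra_simps power2_eq_square)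
  finally show ?thesis using assms(1) v by (metis pos_def_mat_def)
qed

text \<open>
  A permutation with a nonzero term in the Leibniz formula does not increase the rank of any index.
  As it preserves the sum of the ranks, it is the identity.
\<close>

lemma det_unit_forest_mat:
  fixes U :: "real mat"
  assumes "U \<in> carrier_mat n n" "\<And>i. i < n \<Longrightarrow> U $$ (i, i) = 1"
    and "\<And>i j. i < n \<Longrightarrow> j < n \<Longrightarrow> i \<noteq> j \<Longrightarrow> U $$ (i, j) \<noteq> 0 \<Longrightarrow> (rk j :: nat) < rk i"
  shows "Determinant.det U = 1"
proof -
  have zero: "(\<Prod>i = 0..<n. U $$ (i, q i)) = 0" if q: "q permutes {0..<n}" "q \<noteq> id" for q
  proof (rule ccontr)
    assume "\<not> ?thesis"
    then have nz: "U $$ (i, q i) \<noteq> 0" if "i < n" for i using that by auto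
    have qn: "q i < n" if "i < n" for i using permutes_in_image[OF q(1), of i] that by simp
    have le: "rk (q i) \<le> rk i" if "i < n" for i
      using assms(3)[OF that qn[OF that]] nz[OF that] by (cases "i = q i") auto
    obtain i where i: "i < n" "q i \<noteq> i"
      using q by (metis atLeastLessThan_iff eq_id_iff less_nat_zero_code not_less permutes_def)
    have "(\<Sum>i\<in>{0..<n}. rk (q i)) < (\<Sum>i\<in>{0..<n}. rk i)"
      by (rule sum_strict_mono_ex1) (use le i assms(3)[OF i(1) qn[OF i(1)]] nz in auto)
    moreover have "(\<Sum>i\<in>{0..<n}. rk (q i)) = (\<Sum>i\<in>{0..<n}. rk i)"
      using sum.permute[OF q(1), of rk] by (simp add: o_def)
    ultimately show False by simp
  qed
  have "Determinant.det U = (\<Sum>q\<in>{q. q permutes {0..<n}}. signof q * (\<Prod>i = 0..<n. U $$ (i, q i)))"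
    by (rule det_def'[OF assms(1)])
  also have "\<dots> = (\<Sum>q\<in>{id}. signof q * (\<Prod>i = 0..<n. U $$ (i, q i)))"
    by (rule sum.mono_neutral_right) (auto simp: zero permutes_id finite_permutations)
  also have "\<dots> = 1" using assms(2) by simp
  finally show ?thesis .
qed

text \<open>U S U^T = D, where U becomes unitriangular when the indices are ordered by rank and D is
  diagonal. Hence det S = det D and A = U^T D^(-1) U.\<close>

lemma forest_covariance:
  fixes S A :: "real mat" and rk p :: "nat \<Rightarrow> nat"
  assumes S: "S \<in> carrier_mat n n" and A: "A \<in> carrier_mat n n"
    and inv: "S * A = 1\<^sub>m n" "A * S = 1\<^sub>m n"
    and sym: "transpose_mat S = S"
    and rk: "inj_on rk {..<n}"
    and s: "s \<noteq> 0" and diag: "\<And>i. i < n \<Longrightarrow> S $$ (i, i) = s"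
    and p: "\<And>i. i < n \<Longrightarrow> p i < n" "\<And>i. i < n \<Longrightarrow> p i \<noteq> i \<Longrightarrow> rk (p i) < rk i"
    and edge: "\<And>i. i < n \<Longrightarrow> p i \<noteq> i \<Longrightarrow> S $$ (i, p i) = s * \<gamma> i"
    and root: "\<And>i. i < n \<Longrightarrow> p i = i \<Longrightarrow> \<gamma> i = 0"
    and pat: "\<And>i j. i < n \<Longrightarrow> j < n \<Longrightarrow> i \<noteq> j \<Longrightarrow> j \<noteq> p i \<Longrightarrow> i \<noteq> p j \<Longrightarrow> A $$ (i, j) = 0"
    and pos: "\<And>i. i < n \<Longrightarrow> s * (1 - (\<gamma> i)\<^sup>2) \<noteq> 0"
  shows "Determinant.det S = (\<Prod>i<n. s * (1 - (\<gamma> i)\<^sup>2))"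
    and "scalar_prod (Matrix.vec n y) (mult_mat_vec A (Matrix.vec n y)) =
           (\<Sum>i<n. (y i - \<gamma> i * y (p i))\<^sup>2 / (s * (1 - (\<gamma> i)\<^sup>2)))"
proof -
  have symS: "S $$ (i, j) = S $$ (j, i)" if "i < n" "j < n" for i j
    using sym S that by (metis carrier_matD index_transpose_mat(1))
  have rec: "S $$ (i, k) = \<gamma> i * S $$ (p i, k)" if "i < n" "k < n" "rk k < rk i" for i k
  proof (rule forest_recursion[of "{..<n}" rk s "\<lambda>i j. A $$ (i, j)" "\<lambda>i j. S $$ (i, j)" p \<gamma>])
    fix i k assume ik: "i \<in> {..<n}" "k \<in> {..<n}"
    have "(A * S) $$ (i, k) = (\<Sum>j<n. A $$ (i, j) * S $$ (j, k))"
      using ik A S by (simp add: scalar_prod_def atLeast0LessThan)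
    then show "(\<Sum>j<n. A $$ (i, j) * S $$ (j, k)) = (if i = k then 1 else 0)"
      using inv ik by simp
  qed (use assms that symS in auto)
  define d where "d i = s * (1 - (\<gamma> i)\<^sup>2)" for i
  \<comment> \<open>\<open>U y\<close> is the vector of residuals \<open>y i - \<gamma> i * y (p i)\<close>, which are uncorrelated by \<open>rec\<close>.\<close>
  define U where "U = Matrix.mat n n (\<lambda>(i, j). (if j = i then 1 else 0) - (if j = p i then \<gamma> i else 0))"
  have U: "U \<in> carrier_mat n n" by (simp add: U_def)
  define T where "T = U * S"
  have T: "T \<in> carrier_mat n n" using U S by (simp add: T_def)
  have T_eq: "T $$ (i, j) = S $$ (i, j) - \<gamma> i * S $$ (p i, j)" if "i < n" "j < n" for i j
    using that S p(1)[of i] by (simp add: T_def U_def scalar_prod_def left_diff_distrib sum_subtractf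
        if_distrib[of "\<lambda>x. x * _"] cong: if_cong)
  have UT: "(T * transpose_mat U) $$ (i, j) = T $$ (i, j) - \<gamma> j * T $$ (i, p j)" if "i < n" "j < n" for i j
    using that T p(1)[of j] by (simp add: U_def scalar_prod_def right_diff_distrib sum_subtractf
        if_distrib[of "\<lambda>x. _ * x"] cong: if_cong)
  have T0: "T $$ (i, k) = 0" if "i < n" "k < n" "rk k < rk i" for i k
    using rec that T_eq by simp
  \<comment> \<open>Both \<open>j\<close> and \<open>p j\<close> have smaller rank than
    \<open>i\<close>, so \<open>T\<close> vanishes at both columns; at a root the factor
    \<open>\<gamma> j\<close> is zero. The other triangle follows from the symmetry of U S
    U^T.\<close>
  have lower: "(T * transpose_mat U) $$ (i, j) = 0" if "i < n" "j < n" "rk j < rk i" for i j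
  proof -
    have "\<gamma> j * T $$ (i, p j) = 0"
      using T0[of i "p j"] p[of j] root[of j] that by (cases "p j = j") auto
    then show ?thesis using UT T0 that by simp
  qed
  have symUT: "transpose_mat (T * transpose_mat U) = T * transpose_mat U"
  proof -
    have "transpose_mat (T * transpose_mat U) = U * transpose_mat T"
      using transpose_mult[OF T] U by (metis transpose_transpose transpose_carrier_mat)
    also have "\<dots> = U * (S * transpose_mat U)"
      using transpose_mult[OF U S] sym by (simp add: T_def)
    also have "\<dots> = T * transpose_mat U" unfolding T_def
      by (rule assoc_mult_mat[symmetric, OF U S]) (use U in simp)
    finally show ?thesis .
  qed
  have UTc: "T * transpose_mat U \<in> carrier_mat n n" using T U by simp
  have off: "(T * transpose_mat U) $$ (i, j) = 0" if "i < n" "j < n" "i \<noteq> j" for i j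
  proof (cases "rk j < rk i")
    case False
    then have "rk i < rk j" using rk that by (metis inj_onD lessThan_iff linorder_neqE_nat)
    then show ?thesis using lower[of j i] symUT that UTc by (metis carrier_matD index_transpose_mat(1))
  qed (use lower that in auto)
  \<comment> \<open>Since \<open>T $$ (i, p i) = 0\<close>, only one of the two corrections
    survives, and the variance of the residual is
    \<open>s - \<gamma> i * (s * \<gamma> i)\<close>.\<close>
  have on: "(T * transpose_mat U) $$ (i, i) = d i" if i: "i < n" for i
  proof (cases "p i = i")
    case True then show ?thesis using UT[OF i i] T_eq[OF i i] root[OF i] diag[OF i] by (simp add: d_def)
  next
    case False
    have "T $$ (i, p i) = 0" using T0 p False i by auto
    then show ?thesis using UT[OF i i] T_eq[OF i i] edge[OF i False] diag[OF i] symS[OF i p(1)[OF i]]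
      by (simp add: d_def algebra_simps power2_eq_square)
  qed
  have diagonal: "T * transpose_mat U = Matrix.mat n n (\<lambda>(i, j). if i = j then d i else 0)"
    by (rule eq_matI) (use UTc off on in auto)
  have detU: "Determinant.det U = 1"
  proof (rule det_unit_forest_mat[OF U, of rk])
    show "U $$ (i, i) = 1" if "i < n" for i using that root[OF that] by (auto simp: U_def)
    show "rk j < rk i" if "i < n" "j < n" "i \<noteq> j" "U $$ (i, j) \<noteq> 0" for i j
      using that p(2)[of i] by (auto simp: U_def split: if_splits)
  qed
  have "Determinant.det (T * transpose_mat U) = Determinant.det S"
    using det_mult[OF T transpose_carrier_mat[THEN iffD2, OF U]] det_mult[OF U S] det_transpose[OF U] detU
    by (simp add: T_def)
  moreover have "Determinant.det (Matrix.mat n n (\<lambda>(i, j). if i = j then d i else 0)) = (\<Prod>i<n. d i)"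
    by (subst det_upper_triangular[of _ n])
       (auto simp: upper_triangular_def diag_mat_def prod.list_conv_set_nth atLeast0LessThan intro!: prod.cong)
  ultimately show "Determinant.det S = (\<Prod>i<n. s * (1 - (\<gamma> i)\<^sup>2))"
    using diagonal by (simp add: d_def)
  define E where "E = Matrix.mat n n (\<lambda>(i, j). if i = j then 1 / d i else 0)"
  have E: "E \<in> carrier_mat n n" by (simp add: E_def)
  have DE: "T * transpose_mat U * E = 1\<^sub>m n"
    unfolding diagonal by (rule eq_matI) (use pos in \<open>auto simp: E_def d_def scalar_prod_def
       if_distrib[of "\<lambda>x. x * _"] cong: if_cong\<close>)
  have Ut: "transpose_mat U \<in> carrier_mat n n" using U by simp
  \<comment> \<open>One-sided inverses of square matrices are two-sided. Moving U to the right end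
    of U S U^T E = 1 therefore gives S (U^T E U) = 1, which identifies \<open>A\<close>.\<close>
  have "U * (S * (transpose_mat U * E)) = 1\<^sub>m n"
    using DE assoc_mult_mat[OF T Ut E] assoc_mult_mat[OF U S mult_carrier_mat[OF Ut E]] by (simp add: T_def)
  then have "S * (transpose_mat U * E) * U = 1\<^sub>m n"
    by (rule mat_mult_left_right_inverse[OF U mult_carrier_mat[OF S mult_carrier_mat[OF Ut E]]])
  then have SB: "S * (transpose_mat U * E * U) = 1\<^sub>m n"
    using assoc_mult_mat[OF S mult_carrier_mat[OF Ut E] U] by simp
  have Aeq: "A = transpose_mat U * E * U"
  proof -
    have B: "transpose_mat U * E * U \<in> carrier_mat n n" using U E Ut by simp
    have "A = A * (S * (transpose_mat U * E * U))" using SB A by simp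
    also have "\<dots> = transpose_mat U * E * U"
      using assoc_mult_mat[OF A S B] inv(2) left_mult_one_mat[OF B] by simp
    finally show ?thesis .
  qed
  let ?y = "Matrix.vec n y"
  have yc: "?y \<in> carrier_vec n" by simp
  define w where "w = mult_mat_vec U ?y"
  have w: "w \<in> carrier_vec n" using U by (simp add: w_def)
  have wi: "vec_index w i = y i - \<gamma> i * y (p i)" if "i < n" for i
    using that p(1)[OF that] by (simp add: w_def U_def scalar_prod_def left_diff_distrib sum_subtractf
        if_distrib[of "\<lambda>x. x * _"] cong: if_cong)
  have "mult_mat_vec A ?y = mult_mat_vec (transpose_mat U) (mult_mat_vec E w)"
    using assoc_mult_mat_vec[OF mult_carrier_mat[OF Ut E] U yc] assoc_mult_mat_vec[OF Ut E w]
    by (simp add: Aeq w_def)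
  also have "scalar_prod ?y \<dots> = scalar_prod w (mult_mat_vec E w)"
  proof -
    have Ew: "mult_mat_vec E w \<in> carrier_vec n" using E w by simp
    then show ?thesis using transpose_vec_mult_scalar[OF U yc Ew] comm_scalar_prod[OF yc]
      comm_scalar_prod[OF w Ew] U by (simp add: w_def)
  qed
  also have "\<dots> = (\<Sum>i<n. (y i - \<gamma> i * y (p i))\<^sup>2 / d i)"
  proof -
    have "vec_index (mult_mat_vec E w) i = vec_index w i / d i" if "i < n" for i
      using that w by (simp add: E_def scalar_prod_def if_distrib[of "\<lambda>x. x * _"] cong: if_cong)
    then show ?thesis using E w wi by (simp add: scalar_prod_def atLeast0LessThan power2_eq_square)
  qed
  finally show "scalar_prod ?y (mult_mat_vec A ?y) =
           (\<Sum>i<n. (y i - \<gamma> i * y (p i))\<^sup>2 / (s * (1 - (\<gamma> i)\<^sup>2)))" by (simp add: d_def)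
qed

section \<open>The nearest-neighbour forest\<close>

text \<open>
  With ties the nearest-neighbour graph can contain cycles, e.g. for an equilateral triangle.
\<close>

definition tie_free :: "(real^2) list \<Rightarrow> bool" where
  "tie_free xs \<longleftrightarrow> (\<forall>i<length xs. \<forall>j<length xs. \<forall>l<length xs.
     i \<noteq> j \<longrightarrow> i \<noteq> l \<longrightarrow> j \<noteq> l \<longrightarrow> dist (xs ! i) (xs ! j) \<noteq> dist (xs ! i) (xs ! l))"

lemma nn_forest:
  assumes "tie_free xs"
  obtains p rk :: "nat \<Rightarrow> nat" where "inj_on rk {..<length xs}"
    "\<And>i. i < length xs \<Longrightarrow> p i < length xs"
    "\<And>i. i < length xs \<Longrightarrow> p i \<noteq> i \<Longrightarrow> rk (p i) < rk i"
    "\<And>i j. (i, j) \<in> nn_edges xs \<longleftrightarrow> i < length xs \<and> j < length xs \<and> i \<noteq> j \<and> (j = p i \<or> i = p j)"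
proof (cases "length xs \<le> 1")
  case True
  \<comment> \<open>With at most one point, \<open>nn\<close> minimises over the empty set and is
    unspecified. There are no edges, so every vertex is a root.\<close>
  show ?thesis
  proof (rule that[of id id])
    show "(i, j) \<in> nn_edges xs \<longleftrightarrow> i < length xs \<and> j < length xs \<and> i \<noteq> j \<and> (j = id i \<or> i = id j)" for i j
      using True by (auto simp: nn_edges_def)
  qed auto
next
  case False
  define n where "n = length xs"
  have nn: "nn xs i < n" "nn xs i \<noteq> i" "\<And>j. j < n \<Longrightarrow> j \<noteq> i \<Longrightarrow> dist (xs ! i) (xs ! nn xs i) \<le> dist (xs ! i) (xs ! j)"
    if "i < n" for i
  proof -
    have "(if i = 0 then 1 else 0) \<in> {..<n} - {i}" using False by (auto simp: n_def)
    then have ne: "{..<n} - {i} \<noteq> {}" by blast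
    have "nn xs i \<in> {..<n} - {i}"
      unfolding nn_def n_def[symmetric] by (rule arg_min_if_finite(1)[OF _ ne]) simp
    then show "nn xs i < n" "nn xs i \<noteq> i" by auto
    show "dist (xs ! i) (xs ! nn xs i) \<le> dist (xs ! i) (xs ! j)" if "j < n" "j \<noteq> i" for j
      using arg_min_least[of "{..<n} - {i}" j "\<lambda>j. dist (xs ! i) (xs ! j)"] that ne
      by (auto simp: nn_def n_def)
  qed
  \<comment> \<open>Without ties, \<open>r\<close> strictly decreases along \<open>nn\<close> until a pair of mutual nearest neighbours is
    reached; comparing indices selects the root of that pair.\<close>
  define r where "r i = dist (xs ! i) (xs ! nn xs i)" for i
  define lt where "lt i j \<longleftrightarrow> r i < r j \<or> (r i = r j \<and> i < j)" for i j
  have lt_trans: "lt i k" if "lt i j" "lt j k" for i j k using that by (auto simp: lt_def)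
  have lt_total: "lt i j \<or> lt j i" if "i \<noteq> j" for i j using that by (auto simp: lt_def)
  have lt_irrefl: "\<not> lt i i" for i by (auto simp: lt_def)
  \<comment> \<open>Counting predecessors turns the total order \<open>lt\<close> into an injective
    rank with natural values, as \<open>forest_recursion\<close> requires.\<close>
  define rk where "rk i = card {j. j < n \<and> lt j i}" for i
  have rk: "rk i < rk j" if "lt i j" "i < n" for i j
    unfolding rk_def
  proof (rule psubset_card_mono)
    have "i \<in> {k. k < n \<and> lt k j}" "i \<notin> {k. k < n \<and> lt k i}" using that lt_irrefl by auto
    moreover have "{k. k < n \<and> lt k i} \<subseteq> {k. k < n \<and> lt k j}"
      by (rule Collect_mono) (use that(1) lt_trans[of _ i j] in auto)
    ultimately show "{k. k < n \<and> lt k i} \<subset> {k. k < n \<and> lt k j}" by blast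
  qed simp
  define p where "p i = (if lt (nn xs i) i then nn xs i else i)" for i
  \<comment> \<open>If \<open>p i\<close> is not the nearest neighbour \<open>j\<close>, then
    \<open>lt i j\<close>, so \<open>r i \<le> r j \<le> dist (xs ! j) (xs ! i) = r i\<close>. Thus
    \<open>i\<close> and \<open>nn xs j\<close> are equally near to \<open>j\<close>, and coincide
    in the absence of ties: the edge is recovered from the other end.\<close>
  have flip: "p j = i" if "i < n" "j = nn xs i" "p i \<noteq> j" for i j
  proof -
    have j: "j < n" "j \<noteq> i" using nn that by auto
    have "\<not> lt j i" using that by (auto simp: p_def)
    then have l: "lt i j" using lt_total j by blast
    have "r j \<le> dist (xs ! j) (xs ! i)" using nn(3)[OF j(1), of i] that j by (simp add: r_def)
    moreover have "dist (xs ! j) (xs ! i) = r i" using that by (simp add: r_def dist_commute)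
    moreover have "r i \<le> r j" using l by (auto simp: lt_def)
    ultimately have "dist (xs ! j) (xs ! nn xs j) = dist (xs ! j) (xs ! i)" by (simp add: r_def)
    moreover have "dist (xs ! j) (xs ! nn xs j) \<noteq> dist (xs ! j) (xs ! i)" if "nn xs j \<noteq> i"
      using assms[unfolded tie_free_def n_def[symmetric], rule_format, of j "nn xs j" i]
        nn(1,2)[OF j(1)] j \<open>i < n\<close> that by metis
    ultimately have "nn xs j = i" by blast
    then show ?thesis using l by (simp add: p_def)
  qed
  show ?thesis
  proof (rule that[of rk p])
    show "inj_on rk {..<length xs}"
    proof (rule inj_onI, rule ccontr)
      fix i j assume "i \<in> {..<length xs}" "j \<in> {..<length xs}" "rk i = rk j" "i \<noteq> j"
      then show False using lt_total[of i j] rk[of i j] rk[of j i] by (auto simp: n_def)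
    qed
    show "p i < length xs" if "i < length xs" for i using that nn by (auto simp: p_def n_def)
    show "rk (p i) < rk i" if "i < length xs" "p i \<noteq> i" for i
      using that rk[of "nn xs i" i] nn(1)[of i] by (auto simp: p_def n_def split: if_splits)
    show "(i, j) \<in> nn_edges xs \<longleftrightarrow> i < length xs \<and> j < length xs \<and> i \<noteq> j \<and> (j = p i \<or> i = p j)" for i j
    proof
      assume "(i, j) \<in> nn_edges xs"
      then show "i < length xs \<and> j < length xs \<and> i \<noteq> j \<and> (j = p i \<or> i = p j)"
        using flip[of i j] flip[of j i] unfolding nn_edges_def n_def mem_Collect_eq prod.case by metis
    next
      assume "i < length xs \<and> j < length xs \<and> i \<noteq> j \<and> (j = p i \<or> i = p j)"
      then show "(i, j) \<in> nn_edges xs"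
        by (auto simp: nn_edges_def p_def split: if_splits)
    qed
  qed
qed

section \<open>Conditional independence of two coordinates\<close>

lemma nn_integral_set_less:
  assumes [measurable]: "f \<in> borel_measurable M" "g \<in> borel_measurable M" "A \<in> sets M"
    and A: "emeasure M A \<noteq> 0" and lt: "\<And>x. x \<in> A \<Longrightarrow> f x < g x"
    and fin: "(\<integral>\<^sup>+x. indicator A x * f x \<partial>M) < \<infinity>"
  shows "(\<integral>\<^sup>+x. indicator A x * f x \<partial>M) < (\<integral>\<^sup>+x. indicator A x * g x \<partial>M)"
proof (rule nn_integral_less)
  show "\<not> (AE x in M. indicator A x * g x \<le> indicator A x * f x)"
  proof
    assume "AE x in M. indicator A x * g x \<le> indicator A x * f x"
    then have "AE x in M. x \<notin> A"
      by eventually_elim (use lt in \<open>force simp: indicator_def not_le\<close>)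
    then have "A \<in> null_sets M" by (simp add: AE_iff_null_sets)
    then show False using A by auto
  qed
qed (use fin lt in \<open>auto simp: indicator_def less_imp_le\<close>)

lemma not_AE_False:
  assumes "emeasure M (space M) \<noteq> 0"
  shows "\<not> (AE x in M. False)"
proof
  assume "AE x in M. False"
  then obtain N where "{x \<in> space M. \<not> False} \<subseteq> N" "emeasure M N = 0" "N \<in> sets M"
    by (rule AE_E)
  then have "emeasure M (space M) \<le> 0" by (metis (full_types) Collect_mem_eq emeasure_mono)
  then show False using assms by simp
qed

text \<open>What is needed of a Gaussian density to compute the conditional law of two coordinates
  given the others. Finiteness of the section integral is required for every \<open>z\<close>
  instead of almost every one, so that \<open>psi W z / psi UNIV z\<close> is a genuine quotient at
  every point of \<open>PK\<close>.\<close>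

locale two_coordinate_density =
  fixes K :: "nat set" and i j :: nat and f :: "(nat \<Rightarrow> real) \<Rightarrow> real"
  assumes finite_K: "finite K" and notin: "i \<notin> K" "j \<notin> K" "i \<noteq> j"
    and measurable_density [measurable]:
      "f \<in> borel_measurable (PiM (insert i (insert j K)) (\<lambda>_. lborel))"
    and pos: "f y > 0"
    and total_finite: "(\<integral>\<^sup>+y. ennreal (f y) \<partial>PiM (insert i (insert j K)) (\<lambda>_. lborel)) < \<infinity>"
    and marginal_finite: "(\<integral>\<^sup>+t. \<integral>\<^sup>+s. ennreal (f (z(j := t, i := s))) \<partial>lborel \<partial>lborel) < \<infinity>"
begin

abbreviation "PK \<equiv> PiM K (\<lambda>_. lborel :: real measure)"
abbreviation "PI \<equiv> PiM (insert i (insert j K)) (\<lambda>_. lborel :: real measure)"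
abbreviation "MD \<equiv> density PI (\<lambda>y. ennreal (f y))"
abbreviation "FK \<equiv> coord_algebra MD K"

text \<open>The unnormalised conditional probability that the pair of coordinates lies in
  \<open>W\<close>, given that the others equal \<open>z\<close>. The pair is ordered as (coordinate
  \<open>i\<close>, coordinate \<open>j\<close>), with the \<open>j\<close>-integral
  outside.\<close>

definition psi :: "(real \<times> real) set \<Rightarrow> (nat \<Rightarrow> real) \<Rightarrow> ennreal" where
  "psi W z = (\<integral>\<^sup>+t. \<integral>\<^sup>+s. indicator W (s, t) * ennreal (f (z(j := t, i := s))) \<partial>lborel \<partial>lborel)"

lemma measurable_upd [measurable]:
  "(\<lambda>((z, t), s). z(j := t, i := s)) \<in> measurable ((PK \<Otimes>\<^sub>M lborel) \<Otimes>\<^sub>M lborel) PI"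
  unfolding split_beta
  by (rule measurable_fun_upd[where J="insert j K"], simp, rule measurable_fun_upd[where J=K]) auto

lemma section_measurable [measurable]:
  assumes "z \<in> space PK"
  shows "(\<lambda>(t, s). f (z(j := t, i := s))) \<in> borel_measurable (lborel \<Otimes>\<^sub>M lborel)"
proof -
  have "(\<lambda>(t, s). ((z, t), s)) \<in> measurable (lborel \<Otimes>\<^sub>M lborel) ((PK \<Otimes>\<^sub>M lborel) \<Otimes>\<^sub>M lborel)"
    using assms by measurable
  from measurable_compose[OF this measurable_compose[OF measurable_upd measurable_density]]
  show ?thesis by (simp add: split_beta')
qed

lemma measurable_psi [measurable]:
  assumes [measurable]: "W \<in> sets (borel \<Otimes>\<^sub>M borel)"
  shows "psi W \<in> borel_measurable PK"
proof -
  have [measurable]: "(\<lambda>((z, t), s). f (z(j := t, i := s))) \<in> borel_measurable ((PK \<Otimes>\<^sub>M lborel) \<Otimes>\<^sub>M lborel)"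
    using measurable_compose[OF measurable_upd measurable_density] by (simp add: split_beta')
  have [measurable]: "W \<in> sets (lborel \<Otimes>\<^sub>M lborel)"
    using assms by (simp cong: sets_pair_measure_cong)
  show ?thesis unfolding psi_def by measurable
qed

text \<open>Fubini: integrating out \<open>i\<close> and then \<open>j\<close> shows that
  \<open>psi W\<close> is the density, on the coordinates in \<open>K\<close>, of the law restricted
  to the event that the pair lies in \<open>W\<close>.\<close>

lemma nn_integral_MD:
  assumes [measurable]: "h \<in> borel_measurable PK" "W \<in> sets (borel \<Otimes>\<^sub>M borel)"
  shows "(\<integral>\<^sup>+y. h (restrict y K) * indicator W (y i, y j) \<partial>MD) = (\<integral>\<^sup>+z. h z * psi W z \<partial>PK)"
proof -
  interpret product_sigma_finite "\<lambda>_. lborel :: real measure" ..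
  have [measurable]: "(\<lambda>((z, t), s). f (z(j := t, i := s))) \<in> borel_measurable ((PK \<Otimes>\<^sub>M lborel) \<Otimes>\<^sub>M lborel)"
    using measurable_compose[OF measurable_upd measurable_density] by (simp add: split_beta')
  have Wm [measurable]: "W \<in> sets (lborel \<Otimes>\<^sub>M lborel)"
    using assms by (simp cong: sets_pair_measure_cong)
  have [measurable]: "(\<lambda>y. restrict y K) \<in> measurable PI PK"
    by (rule measurable_restrict_subset) auto
  have ijm [measurable]: "(\<lambda>y. (y i, y j)) \<in> measurable PI (lborel \<Otimes>\<^sub>M lborel)" by measurable
  have [measurable]: "(\<lambda>y. indicator W (y i, y j) :: ennreal) \<in> borel_measurable PI"
    using measurable_compose[OF ijm borel_measurable_indicator[OF Wm]] by simp
  define H where "H y = ennreal (f y) * (h (restrict y K) * indicator W (y i, y j))" for y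
  have H [measurable]: "H \<in> borel_measurable PI" unfolding H_def by measurable
  have H': "(\<lambda>x. \<integral>\<^sup>+s. H (x(i := s)) \<partial>lborel) \<in> borel_measurable (PiM (insert j K) (\<lambda>_. lborel :: real measure))"
  proof -
    have "(\<lambda>(x, s). x(i := s)) \<in> measurable (PiM (insert j K) (\<lambda>_. lborel) \<Otimes>\<^sub>M lborel) PI"
      unfolding split_beta by (rule measurable_fun_upd[where J="insert j K"]) auto
    then have [measurable]: "(\<lambda>(x, s). H (x(i := s))) \<in> borel_measurable (PiM (insert j K) (\<lambda>_. lborel) \<Otimes>\<^sub>M lborel)"
      using measurable_compose[OF _ H] by (simp add: split_beta')
    show ?thesis by measurable
  qed
  have "(\<integral>\<^sup>+y. h (restrict y K) * indicator W (y i, y j) \<partial>MD) = (\<integral>\<^sup>+y. H y \<partial>PI)"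
    unfolding H_def by (subst nn_integral_density) auto
  also have "\<dots> = (\<integral>\<^sup>+x. \<integral>\<^sup>+s. H (x(i := s)) \<partial>lborel \<partial>PiM (insert j K) (\<lambda>_. lborel))"
    using finite_K notin H by (intro product_nn_integral_insert) auto
  also have "\<dots> = (\<integral>\<^sup>+z. \<integral>\<^sup>+t. \<integral>\<^sup>+s. H (z(j := t, i := s)) \<partial>lborel \<partial>lborel \<partial>PK)"
    using finite_K notin H' by (intro product_nn_integral_insert) auto
  also have "\<dots> = (\<integral>\<^sup>+z. h z * psi W z \<partial>PK)"
  proof (rule nn_integral_cong)
    fix z assume z: "z \<in> space PK"
    have r: "restrict (z(j := t, i := s)) K = z" for t s
      using z notin by (auto simp: space_PiM PiE_def extensional_def restrict_def fun_eq_iff)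
    note section_measurable[OF z, measurable]
    have "(\<integral>\<^sup>+t. \<integral>\<^sup>+s. H (z(j := t, i := s)) \<partial>lborel \<partial>lborel) =
      (\<integral>\<^sup>+t. \<integral>\<^sup>+s. h z * (indicator W (s, t) * ennreal (f (z(j := t, i := s)))) \<partial>lborel \<partial>lborel)"
      unfolding H_def r using notin by (simp add: mult_ac)
    also have "\<dots> = h z * psi W z" unfolding psi_def
      by (subst nn_integral_cmult, measurable, subst nn_integral_cmult, measurable)
    finally show "(\<integral>\<^sup>+t. \<integral>\<^sup>+s. H (z(j := t, i := s)) \<partial>lborel \<partial>lborel) = h z * psi W z" .
  qed
  finally show ?thesis .
qed

lemma psi_finite: "psi W z < \<infinity>"
proof -
  have "psi W z \<le> (\<integral>\<^sup>+t. \<integral>\<^sup>+s. ennreal (f (z(j := t, i := s))) \<partial>lborel \<partial>lborel)"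
    unfolding psi_def by (intro nn_integral_mono) (auto simp: indicator_def)
  then show ?thesis using marginal_finite[of z] by (rule order.strict_trans1)
qed

lemma psi_add:
  assumes "z \<in> space PK" "W \<in> sets (borel \<Otimes>\<^sub>M borel)" "W' \<in> sets (borel \<Otimes>\<^sub>M borel)" "W \<inter> W' = {}"
  shows "psi (W \<union> W') z = psi W z + psi W' z"
proof -
  note section_measurable[OF assms(1), measurable]
  have [measurable]: "W \<in> sets (lborel \<Otimes>\<^sub>M lborel)" "W' \<in> sets (lborel \<Otimes>\<^sub>M lborel)"
    using assms(2,3) by (simp_all cong: sets_pair_measure_cong)
  have "psi (W \<union> W') z = (\<integral>\<^sup>+t. \<integral>\<^sup>+s. indicator W (s, t) * ennreal (f (z(j := t, i := s)))
      + indicator W' (s, t) * ennreal (f (z(j := t, i := s))) \<partial>lborel \<partial>lborel)"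
    unfolding psi_def using assms(4) by (intro nn_integral_cong) (auto simp: indicator_def)
  also have "\<dots> = psi W z + psi W' z"
    unfolding psi_def by (subst nn_integral_add[symmetric], measurable, subst nn_integral_add, measurable)
  finally show ?thesis .
qed

lemma psi_UNIV_pos:
  assumes "z \<in> space PK"
  shows "psi UNIV z > 0"
proof -
  note section_measurable[OF assms, measurable]
  have "psi UNIV z \<noteq> 0"
  proof
    assume "psi UNIV z = 0"
    then have "AE t in lborel. (\<integral>\<^sup>+s. indicator UNIV (s, t) * ennreal (f (z(j := t, i := s))) \<partial>lborel) = 0"
      unfolding psi_def by (subst (asm) nn_integral_0_iff_AE) measurable
    then have "AE t in lborel :: real measure. False"
    proof eventually_elim
      case (elim t)
      then have "AE s in lborel. indicator UNIV (s, t) * ennreal (f (z(j := t, i := s))) = 0"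
        by (subst (asm) nn_integral_0_iff_AE) measurable
      then have "AE s in lborel :: real measure. False"
        by eventually_elim (use pos in \<open>simp add: ennreal_eq_0_iff not_le[symmetric]\<close>)
      then show False by (simp add: not_AE_False)
    qed
    then show False by (simp add: not_AE_False)
  qed
  then show ?thesis by (simp add: zero_less_iff_neq_zero)
qed

lemma restrict_measurable: "(\<lambda>y. restrict y K) \<in> measurable MD (PiM K (\<lambda>_. borel))"
proof -
  have "(\<lambda>y. restrict y K) \<in> measurable PI PK"
    by (rule measurable_restrict_subset) auto
  moreover have "sets PK = sets (PiM K (\<lambda>_. borel))" by (rule sets_PiM_cong) auto
  ultimately show ?thesis by (simp cong: measurable_cong_sets)
qed

lemma sets_FK: "sets FK = {(\<lambda>y. restrict y K) -` B \<inter> space MD |B. B \<in> sets PK}"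
proof -
  have *: "sets PK = sets (PiM K (\<lambda>_. borel))" by (rule sets_PiM_cong) auto
  show ?thesis unfolding coord_algebra_def *
    by (rule sets_vimage_algebra2) (use measurable_space[OF restrict_measurable] in auto)
qed

lemma finite_measure_subalgebra_FK: "finite_measure_subalgebra MD FK"
proof -
  have "finite_measure MD"
    by (rule finite_measureI) (use total_finite in \<open>simp add: emeasure_density nn_integral_set_ennreal less_top\<close>)
  moreover have "subalgebra MD FK"
    unfolding subalgebra_def
  proof
    show "space FK = space MD" by (simp add: coord_algebra_def)
    have "sets PK = sets (PiM K (\<lambda>_. borel))" by (rule sets_PiM_cong) auto
    then show "sets FK \<subseteq> sets MD"
      unfolding sets_FK using measurable_sets[OF restrict_measurable] by auto
  qed
  ultimately show ?thesis
    by (simp add: finite_measure_subalgebra_def finite_measure_subalgebra_axioms_def)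
qed

text \<open>Bayes' formula. Events of \<open>FK\<close> are preimages of sets \<open>B\<close> under
  restriction to \<open>K\<close>, and over such an event both candidates integrate to the integral
  of \<open>psi W\<close> over \<open>B\<close>: \<open>nn_integral_MD\<close> is applied once with
  \<open>W\<close> and once with \<open>UNIV\<close>.\<close>

lemma nn_cond_exp_MD:
  assumes W: "W \<in> sets (borel \<Otimes>\<^sub>M borel)"
  shows "AE y in MD. nn_cond_exp MD FK (\<lambda>y. indicator W (y i, y j)) y =
           psi W (restrict y K) / psi UNIV (restrict y K)"
proof -
  interpret finite_measure_subalgebra MD FK by (rule finite_measure_subalgebra_FK)
  have Wm [measurable]: "W \<in> sets (lborel \<Otimes>\<^sub>M lborel)"
    using assms by (simp cong: sets_pair_measure_cong)
  have U: "UNIV \<in> sets (borel \<Otimes>\<^sub>M borel :: (real \<times> real) measure)" 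
    using sets.top[of "borel \<Otimes>\<^sub>M borel :: (real \<times> real) measure"] by (simp add: space_pair_measure)
  note measurable_psi[OF W, measurable] measurable_psi[OF U, measurable]
  have ijm [measurable]: "(\<lambda>y. (y i, y j)) \<in> measurable PI (lborel \<Otimes>\<^sub>M lborel)" by measurable
  have PKb: "sets PK = sets (PiM K (\<lambda>_. borel))" by (rule sets_PiM_cong) auto
  have rF: "(\<lambda>y. restrict y K) \<in> measurable FK PK"
    unfolding coord_algebra_def measurable_cong_sets[OF refl PKb]
    by (rule measurable_vimage_algebra1) (use measurable_space[OF restrict_measurable] in auto)
  have "AE y in MD. psi W (restrict y K) / psi UNIV (restrict y K) = nn_cond_exp MD FK (\<lambda>y. indicator W (y i, y j)) y"
  proof (rule nn_cond_exp_charact)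
    show "(\<lambda>y. indicator W (y i, y j) :: ennreal) \<in> borel_measurable MD"
      using measurable_compose[OF ijm borel_measurable_indicator[OF Wm]] by simp
    show "(\<lambda>y. psi W (restrict y K) / psi UNIV (restrict y K)) \<in> borel_measurable FK"
      using measurable_compose[OF rF, of "\<lambda>z. psi W z / psi UNIV z"] by measurable
    fix A assume "A \<in> sets FK"
    then obtain B where B [measurable]: "B \<in> sets PK" and A: "A = (\<lambda>y. restrict y K) -` B \<inter> space MD"
      by (auto simp: sets_FK)
    have "(\<integral>\<^sup>+y\<in>A. indicator W (y i, y j) \<partial>MD) =
        (\<integral>\<^sup>+y. indicator B (restrict y K) * indicator W (y i, y j) \<partial>MD)"
      by (intro nn_integral_cong) (auto simp: A indicator_def)
    also have "\<dots> = (\<integral>\<^sup>+z. indicator B z * psi W z \<partial>PK)"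
      by (rule nn_integral_MD[OF _ W]) measurable
    also have "\<dots> = (\<integral>\<^sup>+z. indicator B z * (psi W z / psi UNIV z) * psi UNIV z \<partial>PK)"
    proof (rule nn_integral_cong)
      fix z assume "z \<in> space PK"
      then have "psi W z / psi UNIV z * psi UNIV z = psi W z"
        using psi_UNIV_pos[of z] psi_finite[of UNIV z]
        by (simp add: ennreal_divide_times)
      then show "indicator B z * psi W z = indicator B z * (psi W z / psi UNIV z) * psi UNIV z"
        by (simp add: mult.assoc)
    qed
    also have "\<dots> = (\<integral>\<^sup>+y. indicator B (restrict y K) * (psi W (restrict y K) / psi UNIV (restrict y K)) * indicator UNIV (y i, y j) \<partial>MD)"
      by (rule nn_integral_MD[OF _ U, symmetric]) measurable
    also have "\<dots> = (\<integral>\<^sup>+y\<in>A. psi W (restrict y K) / psi UNIV (restrict y K) \<partial>MD)"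
      by (intro nn_integral_cong) (auto simp: A indicator_def)
    finally show "(\<integral>\<^sup>+y\<in>A. indicator W (y i, y j) \<partial>MD) = (\<integral>\<^sup>+y\<in>A. psi W (restrict y K) / psi UNIV (restrict y K) \<partial>MD)" .
  qed
  then show ?thesis by eventually_elim simp
qed

lemma real_cond_exp_MD:
  assumes W: "W \<in> sets (borel \<Otimes>\<^sub>M borel)"
  shows "AE y in MD. real_cond_exp MD FK (\<lambda>y. indicator W (y i, y j)) y =
           enn2real (psi W (restrict y K)) / enn2real (psi UNIV (restrict y K))"
proof -
  have 1: "(\<lambda>y. ennreal (indicator W (y i, y j))) = (\<lambda>y. indicator W (y i, y j))"
    by (auto simp: indicator_def)
  \<comment> \<open>\<open>real_cond_exp\<close> is the difference of the conditional expectations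
    of the positive and the negative part. The latter is the indicator of the empty event, for which
    \<open>psi\<close> vanishes.\<close>
  have 2: "(\<lambda>y. ennreal (- indicator W (y i, y j))) = (\<lambda>y. indicator {} (y i, y j))"
    by (auto simp: indicator_def fun_eq_iff ennreal_neg)
  have 3: "psi {} = (\<lambda>_. 0)" by (simp add: psi_def fun_eq_iff)
  have "AE y in MD. nn_cond_exp MD FK (\<lambda>y. indicator {} (y i, y j)) y = 0"
    using nn_cond_exp_MD[of "{}"] by (simp add: 3)
  then show ?thesis
    using nn_cond_exp_MD[OF W] unfolding real_cond_exp_def 1 2
  proof (eventually_elim)
    case (elim y)
    have *: "enn2real (a / b) = enn2real a / enn2real b" if "a < \<top>" "b < \<top>" "b > 0" for a b
      using that by (cases a; cases b) (auto simp: divide_ennreal ennreal_zero_less_divide)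
    show ?case
    proof (cases "y \<in> space MD")
      case True
      then have "restrict y K \<in> space PK" using measurable_space[OF restrict_measurable] by (simp add: space_PiM)
      then show ?thesis using elim psi_finite psi_UNIV_pos by (simp add: *)
    qed (use elim * psi_finite psi_UNIV_pos in \<open>auto simp: space_PiM\<close>)
  qed
qed

text \<open>\<open>MD\<close> is not the null measure, because \<open>f\<close> is positive and the
  product Lebesgue measure is nonzero. This extracts a single \<open>z\<close> from an almost sure
  identity.\<close>

lemma AE_MD_ex:
  assumes "AE y in MD. P y"
  shows "\<exists>y\<in>space MD. P y"
proof (rule ccontr)
  assume "\<not> ?thesis"
  have "AE y in MD. False" using assms
    by (rule AE_mp) (use \<open>\<not> (\<exists>y\<in>space MD. P y)\<close> in \<open>blast intro: AE_I2\<close>)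
  then have "AE y in PI. False" using pos by (subst (asm) AE_density) auto
  moreover interpret product_sigma_finite "\<lambda>_. lborel :: real measure" ..
  have "emeasure PI (Pi\<^sub>E (insert i (insert j K)) (\<lambda>_. UNIV)) = (\<Prod>i\<in>insert i (insert j K). emeasure (lborel :: real measure) UNIV)"
    using finite_K by (intro emeasure_PiM) auto
  then have "emeasure PI (space PI) \<noteq> 0"
    using finite_K by (simp add: space_PiM)
  ultimately show False by (simp add: not_AE_False)
qed

text \<open>
  The conditional law of the two coordinates is a multiple of \<^term>\<open>\<lambda>W. psi W z\<close>. Only one pair of
  events is used: the Gaussian density below violates the conclusion for every \<open>z\<close>.
\<close>

lemma cond_indep_cross_ratio:
  assumes ci: "cond_indep_vars MD FK (\<lambda>y. y i) (\<lambda>y. y j)"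
    and A: "A \<in> sets borel" and C: "C \<in> sets borel"
  obtains z where "z \<in> space PK" "psi (A \<times> C) z * psi ((- A) \<times> (- C)) z = psi (A \<times> (- C)) z * psi ((- A) \<times> C) z"
proof -
  have [measurable]: "A \<in> sets borel" "C \<in> sets borel" by fact+
  have P: "X \<times> Y \<in> sets (borel \<Otimes>\<^sub>M borel)" if "X \<in> sets borel" "Y \<in> sets borel" for X Y :: "real set"
    using that by auto
  have e1: "(\<lambda>y. indicator (A \<times> C) (y i, y j)) = (\<lambda>y. indicator A (y i) * indicator C (y j) :: real)"
    "(\<lambda>y. indicator (A \<times> UNIV) (y i, y j)) = (\<lambda>y. indicator A (y i) :: real)"
    "(\<lambda>y. indicator (UNIV \<times> C) (y i, y j)) = (\<lambda>y. indicator C (y j) :: real)" 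
    by (auto simp: indicator_def fun_eq_iff)
  have UB: "UNIV \<in> sets (borel :: real measure)" by simp
  let ?q = "\<lambda>W y. enn2real (psi W (restrict y K))"
  \<comment> \<open>Conditional independence written with explicit conditional laws; the marginal
    events are rectangles with one side \<open>UNIV\<close>.\<close>
  have "AE y in MD. ?q (A \<times> C) y / ?q UNIV y = ?q (A \<times> UNIV) y / ?q UNIV y * (?q (UNIV \<times> C) y / ?q UNIV y)"
    using ci[unfolded cond_indep_vars_def, rule_format, OF A C]
      real_cond_exp_MD[OF P[OF A C], unfolded e1]
      real_cond_exp_MD[OF P[OF A UB], unfolded e1]
      real_cond_exp_MD[OF P[OF UB C], unfolded e1]
    by eventually_elim simp
  from AE_MD_ex[OF this] obtain y where y: "y \<in> space MD"
    "?q (A \<times> C) y / ?q UNIV y = ?q (A \<times> UNIV) y / ?q UNIV y * (?q (UNIV \<times> C) y / ?q UNIV y)" by blast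
  define z where "z = restrict y K"
  have z: "z \<in> space PK" using y measurable_space[OF restrict_measurable, of y] by (simp add: space_PiM z_def)
  define q where "q W = enn2real (psi W z)" for W
  have psi_q: "psi W z = ennreal (q W)" for W using psi_finite[of W z] by (simp add: q_def less_top)
  have q_nn: "q W \<ge> 0" for W by (simp add: q_def)
  have add: "q W'' = q W + q W'" if "W'' = W \<union> W'" "W \<inter> W' = {}"
    "W \<in> sets (borel \<Otimes>\<^sub>M borel)" "W' \<in> sets (borel \<Otimes>\<^sub>M borel)" for W W' W''
    using psi_add[OF z that(3,4,2)] unfolding that(1) by (simp add: psi_q q_nn flip: ennreal_plus)
  have nA: "- A \<in> sets borel" and nC: "- C \<in> sets borel" using A C by auto
  have s1: "q (A \<times> UNIV) = q (A \<times> C) + q (A \<times> (- C))"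
    by (rule add) (auto intro!: P A C nC)
  have s2: "q (UNIV \<times> C) = q (A \<times> C) + q ((- A) \<times> C)"
    by (rule add) (auto intro!: P A C nA)
  have s3: "q ((- A) \<times> UNIV) = q ((- A) \<times> C) + q ((- A) \<times> (- C))"
    by (rule add) (auto intro!: P C nA nC)
  have s4: "q UNIV = q (A \<times> UNIV) + q ((- A) \<times> UNIV)"
    by (rule add) (auto intro!: P A nA)
  have U: "q UNIV > 0" using psi_UNIV_pos[OF z] by (simp add: psi_q)
  \<comment> \<open>After splitting every mass into the four blocks, the product formula for one
    pair of events is the vanishing of the determinant of the 2 by 2 table of blocks.\<close>
  have "q (A \<times> C) * q UNIV = q (A \<times> UNIV) * q (UNIV \<times> C)"
    using y(2) U by (simp add: q_def z_def field_simps)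
  then have "q (A \<times> C) * q ((- A) \<times> (- C)) = q (A \<times> (- C)) * q ((- A) \<times> C)"
    by (simp add: s1 s2 s3 s4 algebra_simps)
  then show ?thesis using that[OF z] by (simp add: psi_q q_nn flip: ennreal_mult)
qed

end

text \<open>
  On each quadrant \<open>s * t\<close> has constant sign, so \<open>exp (- b * s * t)\<close> can be compared with \<open>1\<close> there,
  and without this factor both sides of the cross ratio agree.
\<close>

lemma tilted_product_cross_ratio:
  fixes u w :: "real \<Rightarrow> real" and b :: real
  assumes [measurable]: "u \<in> borel_measurable borel" "w \<in> borel_measurable borel"
    and pos: "\<And>s. u s > 0" "\<And>t. w t > 0" and b: "b \<noteq> 0"
  defines "v \<equiv> \<lambda>W. \<integral>\<^sup>+t. \<integral>\<^sup>+s. indicator W (s, t) * ennreal (u s * w t * exp (- b * s * t)) \<partial>lborel \<partial>lborel"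
  assumes fin: "v UNIV < \<infinity>"
  shows "v ({..0} \<times> {..0}) * v ((- {..0}) \<times> (- {..0})) \<noteq> v ({..0} \<times> (- {..0})) * v ((- {..0}) \<times> {..0})"
proof -
  define F where "F p = ennreal (u (fst p) * w (snd p) * exp (- b * fst p * snd p))" for p :: "real \<times> real"
  define G where "G p = ennreal (u (fst p) * w (snd p))" for p :: "real \<times> real"
  have [measurable]: "F \<in> borel_measurable (lborel \<Otimes>\<^sub>M lborel)" "G \<in> borel_measurable (lborel \<Otimes>\<^sub>M lborel)"
    unfolding F_def G_def by measurable
  have v: "v W = (\<integral>\<^sup>+p. indicator W p * F p \<partial>(lborel \<Otimes>\<^sub>M lborel))" if "W \<in> sets (lborel \<Otimes>\<^sub>M lborel)" for W
    unfolding v_def using that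
    by (subst lborel_pair.nn_integral_snd[symmetric]) (simp_all add: F_def)
  \<comment> \<open>\<open>U\<close> and \<open>Q\<close> are the two factors of the product measure
    without the mixed exponential. They may a priori be infinite, since finiteness is assumed only
    for the tilted integral.\<close>
  define U where "U A = (\<integral>\<^sup>+s. indicator A s * ennreal (u s) \<partial>lborel)" for A
  define Q where "Q C = (\<integral>\<^sup>+t. indicator C t * ennreal (w t) \<partial>lborel)" for C
  have UQ: "(\<integral>\<^sup>+p. indicator (A \<times> C) p * G p \<partial>(lborel \<Otimes>\<^sub>M lborel)) = U A * Q C"
    if [measurable]: "A \<in> sets borel" "C \<in> sets borel" for A C
  proof -
    have "(\<integral>\<^sup>+p. indicator (A \<times> C) p * G p \<partial>(lborel \<Otimes>\<^sub>M lborel)) =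
        (\<integral>\<^sup>+t. \<integral>\<^sup>+s. (indicator C t * ennreal (w t)) * (indicator A s * ennreal (u s)) \<partial>lborel \<partial>lborel)"
      using pos by (subst lborel_pair.nn_integral_snd[symmetric])
        (auto simp: G_def indicator_times ennreal_mult' less_imp_le mult_ac intro!: nn_integral_cong)
    also have "\<dots> = U A * Q C"
      unfolding U_def Q_def
      by (subst nn_integral_cmult, measurable, subst nn_integral_multc, measurable) (simp add: mult.commute)
    finally show ?thesis .
  qed
  have vfin: "v W < \<infinity>" for W
  proof -
    have "v W \<le> v UNIV" unfolding v_def by (intro nn_integral_mono) (auto simp: indicator_def)
    then show ?thesis using fin by (rule order.strict_trans1)
  qed
  have S: "A \<times> C \<in> sets (lborel \<Otimes>\<^sub>M lborel)" if "A \<in> sets borel" "C \<in> sets borel" for A C :: "real set"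
    using that by simp
  have null: "emeasure (lborel \<Otimes>\<^sub>M lborel) (A \<times> C) \<noteq> 0"
    if "A \<in> sets borel" "C \<in> sets borel" "emeasure lborel A \<noteq> 0" "emeasure lborel C \<noteq> 0" for A C :: "real set"
    using that by (simp add: lborel.emeasure_pair_measure_Times)
  have FG: "F p \<le> G p \<longleftrightarrow> b * fst p * snd p \<ge> 0" "G p \<le> F p \<longleftrightarrow> b * fst p * snd p \<le> 0" for p
    using pos(1)[of "fst p"] pos(2)[of "snd p"] by (simp_all add: F_def G_def ennreal_le_iff)
  have le: "v (A \<times> C) \<le> U A * Q C" if "A \<in> sets borel" "C \<in> sets borel"
    "\<And>s t. s \<in> A \<Longrightarrow> t \<in> C \<Longrightarrow> b * s * t \<ge> 0" for A C
    unfolding UQ[OF that(1,2), symmetric] v[OF S[OF that(1,2)]]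
    by (intro nn_integral_mono) (use that(3) in \<open>auto simp: indicator_def FG\<close>)
  have ge: "U A * Q C \<le> v (A \<times> C)" if "A \<in> sets borel" "C \<in> sets borel"
    "\<And>s t. s \<in> A \<Longrightarrow> t \<in> C \<Longrightarrow> b * s * t \<le> 0" for A C
    unfolding UQ[OF that(1,2), symmetric] v[OF S[OF that(1,2)]]
    by (intro nn_integral_mono) (use that(3) in \<open>auto simp: indicator_def FG\<close>)
  have less: "v (A \<times> C) < U A * Q C" if "A \<in> sets borel" "C \<in> sets borel"
    "emeasure lborel A \<noteq> 0" "emeasure lborel C \<noteq> 0" "\<And>s t. s \<in> A \<Longrightarrow> t \<in> C \<Longrightarrow> b * s * t > 0" for A C
    unfolding UQ[OF that(1,2), symmetric] v[OF S[OF that(1,2)]]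
  proof (rule nn_integral_set_less)
    show "F p < G p" if "p \<in> A \<times> C" for p
      using \<open>\<And>s t. s \<in> A \<Longrightarrow> t \<in> C \<Longrightarrow> b * s * t > 0\<close>[of "fst p" "snd p"] that FG[of p] by (auto simp: not_le[symmetric])
  qed (use that S null vfin[of "A \<times> C", unfolded v[OF S[OF that(1,2)]]] in \<open>auto simp del: mem_Times_iff\<close>)
  have greater: "U A * Q C < v (A \<times> C)" if "A \<in> sets borel" "C \<in> sets borel" "U A * Q C < \<infinity>"
    "emeasure lborel A \<noteq> 0" "emeasure lborel C \<noteq> 0" "\<And>s t. s \<in> A \<Longrightarrow> t \<in> C \<Longrightarrow> b * s * t < 0" for A C
    using that(3) unfolding UQ[OF that(1,2), symmetric] v[OF S[OF that(1,2)]]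
  proof (rule nn_integral_set_less[rotated -1])
    show "G p < F p" if "p \<in> A \<times> C" for p
      using \<open>\<And>s t. s \<in> A \<Longrightarrow> t \<in> C \<Longrightarrow> b * s * t < 0\<close>[of "fst p" "snd p"] that FG[of p] by (auto simp: not_le[symmetric])
  qed (use that S null in \<open>auto simp del: mem_Times_iff\<close>)
  define N where "N = {..0::real}"
  define P where "P = {0::real<..}"
  have P: "- {..0::real} = P" by (auto simp: P_def)
  have m [measurable, simp]: "N \<in> sets borel" "P \<in> sets borel" by (auto simp: N_def P_def)
  have big: "emeasure lborel A \<noteq> 0" if "{a..a+1} \<subseteq> A" "A \<in> sets borel" for a :: real and A
    using emeasure_mono[of "{a..a+1}" A lborel] that by auto
  have n: "emeasure lborel N \<noteq> 0" "emeasure lborel P \<noteq> 0"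
    by (rule big[of "-1"]; simp add: N_def) (rule big[of 1]; auto simp: P_def)
  have nz: "(\<integral>\<^sup>+s. indicator A s * ennreal (h s) \<partial>lborel) \<noteq> 0"
    if "A \<in> sets borel" "emeasure lborel A \<noteq> 0" "\<And>s. h s > 0" "h \<in> borel_measurable borel" for A and h :: "real \<Rightarrow> real"
    using nn_integral_set_less[of "\<lambda>_. 0" lborel h A] that by auto
  have UQ0: "U N \<noteq> 0" "U P \<noteq> 0" "Q N \<noteq> 0" "Q P \<noteq> 0"
    unfolding U_def Q_def by (rule nz; use n pos in simp)+
  show ?thesis unfolding P unfolding N_def[symmetric]
  proof (cases "b > 0")
    case True
    have 1: "v (N \<times> N) \<le> U N * Q N" "U N * Q P \<le> v (N \<times> P)" "U P * Q N \<le> v (P \<times> N)"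
      using True by (auto intro!: le ge simp: N_def P_def mult_nonneg_nonpos mult_nonpos_nonneg mult_nonpos_nonpos 
         mult.assoc zero_le_mult_iff mult_le_0_iff)
    \<comment> \<open>One strict inequality among the four suffices. The open quadrant provides it:
      on the closed one the exponent vanishes along the axes.\<close>
    have 2: "v (P \<times> P) < U P * Q P"
      using True by (intro less n m) (auto simp: P_def)
    \<comment> \<open>On the quadrants where the tilt is at least 1, the tilted integral bounds the
      product. Since no factor vanishes, finiteness of the two products makes all four factors
      finite, and strictness survives multiplication.\<close>
    have "U N * Q P < \<infinity>" "U P * Q N < \<infinity>" using 1(2,3) vfin by (auto intro: order.strict_trans1)
    then have f: "U N < \<infinity>" "Q P < \<infinity>" "U P < \<infinity>" "Q N < \<infinity>"
      using UQ0 by (auto simp: ennreal_mult_less_top)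
    have "v (N \<times> N) * v (P \<times> P) \<le> (U N * Q N) * v (P \<times> P)" by (intro mult_right_mono 1) simp
    also have "\<dots> < (U N * Q N) * (U P * Q P)"
      using 2 f UQ0 by (intro ennreal_mult_strict_left_mono) (auto simp: ennreal_mult_less_top zero_less_iff_neq_zero)
    also have "\<dots> = (U N * Q P) * (U P * Q N)" by (simp add: mult_ac)
    also have "\<dots> \<le> v (N \<times> P) * v (P \<times> N)" by (intro mult_mono 1) auto
    finally show "v (N \<times> N) * v (P \<times> P) \<noteq> v (N \<times> P) * v (P \<times> N)" by simp
  next
    case False
    then have b: "b < 0" using b by simp
    have 1: "U N * Q N \<le> v (N \<times> N)" "v (N \<times> P) \<le> U N * Q P" "v (P \<times> N) \<le> U P * Q N" "U P * Q P \<le> v (P \<times> P)"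
      using b by (auto intro!: le ge simp: N_def P_def mult.assoc zero_le_mult_iff mult_le_0_iff)
    have "U N * Q N < \<infinity>" "U P * Q P < \<infinity>" using 1(1,4) vfin by (auto intro: order.strict_trans1)
    then have f: "U N < \<infinity>" "Q P < \<infinity>" "U P < \<infinity>" "Q N < \<infinity>"
      using UQ0 by (auto simp: ennreal_mult_less_top)
    have 2: "U P * Q P < v (P \<times> P)"
      using b f by (intro greater n m) (auto simp: P_def mult_neg_pos ennreal_mult_less_top)
    have "v (N \<times> P) * v (P \<times> N) \<le> (U N * Q P) * (U P * Q N)" by (intro mult_mono 1) auto
    also have "\<dots> = (U N * Q N) * (U P * Q P)" by (simp add: mult_ac)
    also have "\<dots> < (U N * Q N) * v (P \<times> P)"
      using 2 f UQ0 by (intro ennreal_mult_strict_left_mono) (auto simp: ennreal_mult_less_top zero_less_iff_neq_zero)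
    also have "\<dots> \<le> v (N \<times> N) * v (P \<times> P)" by (intro mult_right_mono 1) simp
    finally show "v (N \<times> N) * v (P \<times> P) \<noteq> v (N \<times> P) * v (P \<times> N)" by simp
  qed
qed

section \<open>Gaussian densities\<close>

lemma scalar_prod_self_pos:
  fixes v :: "real vec"
  assumes "v \<in> carrier_vec n" "v \<noteq> 0\<^sub>v n"
  shows "scalar_prod v v > 0"
proof -
  obtain l where "l < n" "vec_index v l \<noteq> 0"
    using assms by (metis carrier_vecD eq_vecI index_zero_vec(1) index_zero_vec(2))
  then show ?thesis using assms(1) unfolding scalar_prod_def
    by (intro sum_pos2[of _ l]) (auto simp: zero_less_mult_iff)
qed

text \<open>
  The determinant does not vanish on the segment from the identity matrix to \<open>S\<close>.
\<close>

lemma pos_def_mat_det_pos: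
  assumes "pos_def_mat n S"
  shows "Determinant.det S > 0"
proof (rule ccontr)
  assume neg: "\<not> ?thesis"
  have S: "S \<in> carrier_mat n n" using assms by (simp add: pos_def_mat_def)
  define R where "R t = (1 - t) \<cdot>\<^sub>m 1\<^sub>m n + t \<cdot>\<^sub>m S" for t :: real
  have Rc: "R t \<in> carrier_mat n n" for t using S by (simp add: R_def)
  have nz: "Determinant.det (R t) \<noteq> 0" if t: "0 \<le> t" "t \<le> 1" for t
  proof
    assume "Determinant.det (R t) = 0"
    then obtain v where v: "v \<in> carrier_vec n" "v \<noteq> 0\<^sub>v n" "mult_mat_vec (R t) v = 0\<^sub>v n"
      using det_0_iff_vec_prod_zero_field[OF Rc] by auto
    have smult: "mult_mat_vec (c \<cdot>\<^sub>m B) v = c \<cdot>\<^sub>v mult_mat_vec B v" if "B \<in> carrier_mat n n" for c :: real and B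
      using that v(1) by (intro eq_vecI) (auto simp: scalar_prod_def sum_distrib_left mult.assoc)
    have "mult_mat_vec (R t) v = (1 - t) \<cdot>\<^sub>v v + t \<cdot>\<^sub>v mult_mat_vec S v"
      unfolding R_def using S v(1)
      by (subst add_mult_distrib_mat_vec[of _ n n]) (auto simp: smult)
    then have "0 = scalar_prod v ((1 - t) \<cdot>\<^sub>v v + t \<cdot>\<^sub>v mult_mat_vec S v)"
      using v(3) scalar_prod_right_zero[OF v(1)] by simp
    also have "\<dots> = (1 - t) * scalar_prod v v + t * scalar_prod v (mult_mat_vec S v)"
      using S v(1) by (subst scalar_prod_add_distrib[of _ n]) auto
    finally have *: "(1 - t) * scalar_prod v v + t * scalar_prod v (mult_mat_vec S v) = 0" by simp
    have 1: "scalar_prod v (mult_mat_vec S v) > 0" using assms v by (simp add: pos_def_mat_def)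
    have 2: "scalar_prod v v > 0" by (rule scalar_prod_self_pos[OF v(1,2)])
    show False
    proof (cases "t = 0")
      case False
      then have "t * scalar_prod v (mult_mat_vec S v) > 0" "(1 - t) * scalar_prod v v \<ge> 0" using t 1 2 by auto
      then show False using * by simp
    qed (use * 2 in auto)
  qed
  have "Determinant.det (R t) = (\<Sum>q\<in>{q. q permutes {0..<n}}. signof q *
      (\<Prod>l = 0..<n. (1 - t) * (1\<^sub>m n $$ (l, q l)) + t * (S $$ (l, q l))))" for t
    unfolding det_def'[OF Rc]
  proof (intro sum.cong refl arg_cong2[where f="(*)"] prod.cong)
    fix q l assume "q \<in> {q. q permutes {0..<n}}" "l \<in> {0..<n}"
    then have "l < n" "q l < n" using permutes_in_image[of q "{0..<n}" l] by auto
    then show "R t $$ (l, q l) = (1 - t) * (1\<^sub>m n $$ (l, q l)) + t * (S $$ (l, q l))"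
      using S by (simp add: R_def)
  qed
  then have "continuous_on {0..1} (\<lambda>t. Determinant.det (R t))"
    by (simp only:) (intro continuous_intros)
  moreover have "R 0 = 1\<^sub>m n" "R 1 = S" using S by (auto simp: R_def intro!: eq_matI)
  ultimately have "\<exists>t. 0 \<le> t \<and> t \<le> 1 \<and> Determinant.det (R t) = 0"
    using neg by (intro IVT2') auto
  then show False using nz by auto
qed

text \<open>Cauchy-Schwarz for the form of \<open>S\<close>, applied to A y and e_m. It bounds the
  exponent of the Gaussian by one coordinate at a time, which gives integrability without
  diagonalising \<open>S\<close>.\<close>

lemma quadratic_form_ge_square:
  assumes "pos_def_mat n S" "A \<in> carrier_mat n n" "S * A = 1\<^sub>m n" "y \<in> carrier_vec n" "m < n"
  shows "S $$ (m, m) > 0" "(vec_index y m)\<^sup>2 / S $$ (m, m) \<le> scalar_prod y (mult_mat_vec A y)"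
proof -
  have S: "S \<in> carrier_mat n n" and sym: "transpose_mat S = S"
    and pd: "\<And>v. v \<in> carrier_vec n \<Longrightarrow> v \<noteq> 0\<^sub>v n \<Longrightarrow> scalar_prod v (mult_mat_vec S v) > 0"
    using assms(1) by (auto simp: pos_def_mat_def)
  note A = assms(2) and y = assms(4) and m = assms(5)
  have psd: "scalar_prod v (mult_mat_vec S v) \<ge> 0" if "v \<in> carrier_vec n" for v
    using pd[OF that] S by (cases "v = 0\<^sub>v n") (auto simp: scalar_prod_def)
  let ?e = "unit_vec n m"
  have e: "?e \<in> carrier_vec n" by simp
  have Se: "mult_mat_vec S ?e = col S m" "col S m \<in> carrier_vec n" using S m by (auto intro!: eq_vecI)
  have Smm: "scalar_prod (col S m) ?e = S $$ (m, m)" using S m by simp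
  show pos: "S $$ (m, m) > 0"
  proof -
    have "scalar_prod ?e (mult_mat_vec S ?e) > 0" using pd[OF e] m by (metis index_unit_vec(1) index_zero_vec(1) zero_neq_one)
    then show ?thesis using Smm Se comm_scalar_prod[OF e Se(2)] by simp
  qed
  \<comment> \<open>The minimiser of the form of \<open>S\<close> at A y - t e_m, which equals y^T A
    y - 2 t y_m + t^2 S_mm.\<close>
  define t where "t = vec_index y m / S $$ (m, m)"
  define v where "v = mult_mat_vec A y - t \<cdot>\<^sub>v ?e"
  have Ay: "mult_mat_vec A y \<in> carrier_vec n" using A y by simp
  have v: "v \<in> carrier_vec n" using Ay by (simp add: v_def)
  have Sv: "mult_mat_vec S v = y - t \<cdot>\<^sub>v col S m"
  proof -
    have "mult_mat_vec S (mult_mat_vec A y) = y"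
      using assoc_mult_mat_vec[OF S A y] assms(3) y by simp
    then show ?thesis unfolding v_def
      using mult_minus_distrib_mat_vec[OF S Ay, of "t \<cdot>\<^sub>v ?e"] mult_mat_vec[OF S e] Se by simp
  qed
  have ye: "scalar_prod y ?e = vec_index y m" using y m by simp
  have "scalar_prod v (col S m) = scalar_prod (mult_mat_vec S v) ?e"
    using transpose_vec_mult_scalar[OF S e v] sym Se by simp
  also have "\<dots> = vec_index y m - t * S $$ (m, m)"
    unfolding Sv using y Se e Smm ye by (subst minus_scalar_prod_distrib[of _ n]) auto
  finally have 1: "scalar_prod v (col S m) = vec_index y m - t * S $$ (m, m)" .
  have 2: "scalar_prod v y = scalar_prod y (mult_mat_vec A y) - t * vec_index y m"
    unfolding v_def using Ay y e ye comm_scalar_prod[OF e y] comm_scalar_prod[OF Ay y]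
    by (subst minus_scalar_prod_distrib[of _ n]) auto
  have "0 \<le> scalar_prod v (mult_mat_vec S v)" by (rule psd[OF v])
  also have "\<dots> = scalar_prod v y - t * scalar_prod v (col S m)"
    unfolding Sv using v y Se by (subst scalar_prod_minus_distrib[of _ n]) auto
  also have "\<dots> = scalar_prod y (mult_mat_vec A y) - (vec_index y m)\<^sup>2 / S $$ (m, m)"
    unfolding 1 2 using pos by (simp add: t_def field_simps power2_eq_square)
  finally show "(vec_index y m)\<^sup>2 / S $$ (m, m) \<le> scalar_prod y (mult_mat_vec A y)" by simp
qed

lemma nn_integral_exp_square_finite:
  assumes "a > 0"
  shows "(\<integral>\<^sup>+x. ennreal (exp (- (x\<^sup>2) / a)) \<partial>lborel) < \<infinity>"
proof -
  define \<sigma> where "\<sigma> = sqrt (a / 2)"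
  have \<sigma>: "\<sigma> > 0" "2 * \<sigma>\<^sup>2 = a" using assms by (auto simp: \<sigma>_def)
  have "(\<integral>\<^sup>+x. ennreal (exp (- (x\<^sup>2) / a)) \<partial>lborel) = (\<integral>\<^sup>+x. ennreal (sqrt (2 * pi * \<sigma>\<^sup>2)) * ennreal (normal_density 0 \<sigma> x) \<partial>lborel)"
    using \<sigma> by (intro nn_integral_cong) (simp add: normal_density_def ennreal_mult'[symmetric])
  also have "\<dots> = ennreal (sqrt (2 * pi * \<sigma>\<^sup>2)) * (\<integral>\<^sup>+x. ennreal (normal_density 0 \<sigma> x) \<partial>lborel)"
    by (rule nn_integral_cmult) simp
  also have "(\<integral>\<^sup>+x. ennreal (normal_density 0 \<sigma> x) \<partial>lborel) = 1"
    using prob_space.emeasure_space_1[OF prob_space_normal_density[OF \<sigma>(1), of 0]]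
    by (simp add: emeasure_density)
  finally show ?thesis by simp
qed

lemma quadratic_form_sum:
  fixes A :: "real mat"
  assumes "A \<in> carrier_mat k k"
  shows "scalar_prod (Matrix.vec k y) (mult_mat_vec A (Matrix.vec k y)) =
    (\<Sum>a<k. \<Sum>b<k. A $$ (a, b) * y a * y b)"
  using assms by (simp add: scalar_prod_def atLeast0LessThan sum_distrib_left mult_ac)

text \<open>For fixed \<open>z\<close> the exponent splits into a function of \<open>s\<close>, a
  function of \<open>t\<close> and a mixed term; the part that depends on \<open>z\<close> alone is
  attached to \<open>t\<close>.\<close>

lemma quadratic_form_two_coordinates:
  fixes A :: "real mat"
  assumes A: "A \<in> carrier_mat k k" and ij: "i < k" "j < k" "i \<noteq> j"
  obtains \<alpha> \<beta> \<gamma> where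
    "\<And>s t. scalar_prod (Matrix.vec k (z(j := t, i := s))) (mult_mat_vec A (Matrix.vec k (z(j := t, i := s)))) =
      (A $$ (i, i) * s\<^sup>2 + \<alpha> * s) + (A $$ (j, j) * t\<^sup>2 + \<beta> * t + \<gamma>) + (A $$ (i, j) + A $$ (j, i)) * s * t"
proof -
  define K where "K = {..<k} - {i, j}"
  have I: "{..<k} = insert i (insert j K)" and K: "i \<notin> K" "j \<notin> K" "finite K"
    using ij by (auto simp: K_def)
  define \<alpha> where "\<alpha> = (\<Sum>b\<in>K. A $$ (i, b) * z b) + (\<Sum>a\<in>K. A $$ (a, i) * z a)"
  define \<beta> where "\<beta> = (\<Sum>b\<in>K. A $$ (j, b) * z b) + (\<Sum>a\<in>K. A $$ (a, j) * z a)"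
  define \<gamma> where "\<gamma> = (\<Sum>a\<in>K. \<Sum>b\<in>K. A $$ (a, b) * z a * z b)"
  have "(\<Sum>a<k. \<Sum>b<k. A $$ (a, b) * (z(j := t, i := s)) a * (z(j := t, i := s)) b) =
      (A $$ (i, i) * s\<^sup>2 + \<alpha> * s) + (A $$ (j, j) * t\<^sup>2 + \<beta> * t + \<gamma>) + (A $$ (i, j) + A $$ (j, i)) * s * t" for s t
  proof -
    define y where "y = z(j := t, i := s)"
    have y: "y i = s" "y j = t" "\<And>b. b \<in> K \<Longrightarrow> y b = z b" using K ij by (auto simp: y_def)
    have row: "(\<Sum>b<k. A $$ (a, b) * y a * y b) =
        y a * (A $$ (a, i) * s + A $$ (a, j) * t + (\<Sum>b\<in>K. A $$ (a, b) * z b))" for a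
      unfolding I using K ij y by (simp add: sum_distrib_left algebra_simps cong: sum.cong)
    have "(\<Sum>a<k. \<Sum>b<k. A $$ (a, b) * y a * y b) =
        s * (A $$ (i, i) * s + A $$ (i, j) * t + (\<Sum>b\<in>K. A $$ (i, b) * z b)) +
        t * (A $$ (j, i) * s + A $$ (j, j) * t + (\<Sum>b\<in>K. A $$ (j, b) * z b)) +
        (\<Sum>a\<in>K. z a * (A $$ (a, i) * s + A $$ (a, j) * t + (\<Sum>b\<in>K. A $$ (a, b) * z b)))"
      unfolding row unfolding I using K ij y by (simp cong: sum.cong)
    also have "(\<Sum>a\<in>K. z a * (A $$ (a, i) * s + A $$ (a, j) * t + (\<Sum>b\<in>K. A $$ (a, b) * z b))) =
        (\<Sum>a\<in>K. A $$ (a, i) * z a) * s + (\<Sum>a\<in>K. A $$ (a, j) * z a) * t + \<gamma>"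
      by (simp add: \<gamma>_def distrib_left sum.distrib sum_distrib_left sum_distrib_right mult_ac)
    finally show ?thesis unfolding y_def[symmetric] by (simp add: \<alpha>_def \<beta>_def algebra_simps power2_eq_square)
  qed
  then show ?thesis using that[of \<alpha> \<beta> \<gamma>] by (simp only: quadratic_form_sum[OF A])
qed

lemma inverse_mat_sym:
  fixes S :: "real mat"
  assumes "S \<in> carrier_mat n n" "A \<in> carrier_mat n n" "S * A = 1\<^sub>m n" "A * S = 1\<^sub>m n" "transpose_mat S = S"
  shows "transpose_mat A = A"
proof -
  have At: "transpose_mat A \<in> carrier_mat n n" using assms by simp
  have "S * transpose_mat A = 1\<^sub>m n"
    using transpose_mult[OF assms(2,1)] assms(4,5) by simp
  then have "A = A * (S * transpose_mat A)" using assms by simp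
  also have "\<dots> = transpose_mat A"
    using assoc_mult_mat[OF assms(2,1) At] assms(4) left_mult_one_mat[OF At] by simp
  finally show ?thesis by simp
qed

lemma mvn_density_eq:
  assumes "S \<in> carrier_mat k k" "mat_inverse S = Some A"
  shows "mvn_density S y = exp (- scalar_prod y (mult_mat_vec A y) / 2) / sqrt ((2 * pi) ^ k * Determinant.det S)"
  using assms by (simp add: mvn_density_def)

text \<open>The density is dominated by a product of one-dimensional Gaussians, whose integrals
  factorise; this settles the total and the section integrals at once.\<close>

lemma mvn_two_coordinate_density:
  assumes pd: "pos_def_mat k S" and ij: "i < k" "j < k" "i \<noteq> j"
  shows "two_coordinate_density ({..<k} - {i, j}) i j (\<lambda>y. mvn_density S (Matrix.vec k y))"
proof
  let ?K = "{..<k} - {i, j}" and ?f = "\<lambda>y. mvn_density S (Matrix.vec k y)"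
  have I: "insert i (insert j ?K) = {..<k}" using ij by auto
  show "finite ?K" "i \<notin> ?K" "j \<notin> ?K" "i \<noteq> j" using ij by auto
  have S: "S \<in> carrier_mat k k" using pd by (simp add: pos_def_mat_def)
  obtain A where A: "mat_inverse S = Some A" "A \<in> carrier_mat k k" "S * A = 1\<^sub>m k" "A * S = 1\<^sub>m k"
    using pos_def_mat_mat_inverse[OF pd] by blast
  define q where "q y = scalar_prod (Matrix.vec k y) (mult_mat_vec A (Matrix.vec k y))" for y
  define c where "c = sqrt ((2 * pi) ^ k * Determinant.det S)"
  have c: "c > 0" using pos_def_mat_det_pos[OF pd] by (simp add: c_def)
  have f: "?f y = exp (- q y / 2) / c" for y
    by (simp add: mvn_density_eq[OF S A(1)] q_def c_def)
  show "?f y > 0" for y using c by (simp add: f)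
  have "q \<in> borel_measurable (PiM {..<k} (\<lambda>_. lborel))"
    unfolding q_def quadratic_form_sum[OF A(2)] by measurable
  then show "?f \<in> borel_measurable (PiM (insert i (insert j ?K)) (\<lambda>_. lborel))"
    unfolding I f by measurable
  have sq: "S $$ (m, m) > 0" "(y m)\<^sup>2 / S $$ (m, m) \<le> q y" if "m < k" for m y
    using quadratic_form_ge_square[OF pd A(2,3) _ that, of "Matrix.vec k y"] that by (auto simp: q_def)
  \<comment> \<open>The scale \<open>2 * real k\<close> averages the \<open>k\<close> coordinatewise
    bounds: each exponent is at most \<open>q y / (2 * real k)\<close>, and together they are at
    most \<open>q y / 2\<close>.\<close>
  define e where "e m x = exp (- (x\<^sup>2) / (2 * real k * S $$ (m, m)))" for m x
  have e_fin: "(\<integral>\<^sup>+x. ennreal (e m x) \<partial>lborel) < \<infinity>" if "m < k" for m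
    unfolding e_def by (rule nn_integral_exp_square_finite) (use that sq in auto)
  have e_meas [measurable]: "e m \<in> borel_measurable borel" for m unfolding e_def by measurable
  have f_le: "?f y \<le> (1 / c) * (\<Prod>m<k. e m (y m))" for y
  proof -
    have "(\<Sum>m<k. (y m)\<^sup>2 / (2 * real k * S $$ (m, m))) \<le> (\<Sum>m<k. q y / (2 * real k))"
      by (intro sum_mono) (use sq in \<open>auto simp: field_simps\<close>)
    also have "\<dots> = q y / 2" using ij by simp
    finally have "exp (- q y / 2) \<le> (\<Prod>m<k. e m (y m))"
      by (simp add: e_def exp_sum[symmetric] sum_negf)
    then show ?thesis using c by (simp add: f field_simps)
  qed
  interpret product_sigma_finite "\<lambda>_. lborel :: real measure" ..
  have "(\<integral>\<^sup>+y. ennreal (?f y) \<partial>PiM {..<k} (\<lambda>_. lborel)) \<le>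
      (\<integral>\<^sup>+y. ennreal (1 / c) * (\<Prod>m<k. ennreal (e m (y m))) \<partial>PiM {..<k} (\<lambda>_. lborel))"
    using f_le c by (intro nn_integral_mono)
      (auto simp: prod_ennreal e_def ennreal_mult'[symmetric] intro!: ennreal_leI)
  also have "\<dots> = ennreal (1 / c) * (\<Prod>m<k. \<integral>\<^sup>+x. ennreal (e m x) \<partial>lborel)"
    by (subst nn_integral_cmult, measurable, subst product_nn_integral_prod) auto
  also have "\<dots> < \<infinity>"
  proof -
    have "(\<Prod>m<k. \<integral>\<^sup>+x. ennreal (e m x) \<partial>lborel) \<noteq> \<top>"
      using e_fin by (subst ennreal_prod_eq_top) (auto dest!: e_fin)
    then show ?thesis by (simp add: ennreal_mult_less_top less_top)
  qed
  finally show "(\<integral>\<^sup>+y. ennreal (?f y) \<partial>PiM (insert i (insert j ?K)) (\<lambda>_. lborel)) < \<infinity>"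
    unfolding I .
  fix z :: "nat \<Rightarrow> real"
  have "ennreal (?f (z(j := t, i := s))) \<le> ennreal (1 / c) * ennreal (e j t) * ennreal (e i s)" for s t
  proof -
    have "(\<Prod>m<k. e m ((z(j := t, i := s)) m)) \<le> (\<Prod>m\<in>{i, j}. e m ((z(j := t, i := s)) m))"
    proof (subst prod.subset_diff[of "{i, j}" "{..<k}"])
      let ?y = "z(j := t, i := s)"
      have "(\<Prod>m\<in>{..<k} - {i, j}. e m (?y m)) \<le> 1"
        by (rule prod_le_1) (use sq in \<open>auto simp: e_def less_imp_le\<close>)
      then show "(\<Prod>m\<in>{..<k} - {i, j}. e m (?y m)) * (\<Prod>m\<in>{i, j}. e m (?y m)) \<le> (\<Prod>m\<in>{i, j}. e m (?y m))"
        by (intro mult_left_le_one_le prod_nonneg) (auto simp: e_def intro!: prod_nonneg)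
    qed (use ij in auto)
    also have "\<dots> = e i s * e j t" using ij by simp
    finally have "?f (z(j := t, i := s)) \<le> (1 / c) * e j t * e i s"
      using f_le[of "z(j := t, i := s)"] c by (simp add: field_simps)
    then show ?thesis using c by (simp add: e_def ennreal_mult'[symmetric] ennreal_leI)
  qed
  then have "(\<integral>\<^sup>+t. \<integral>\<^sup>+s. ennreal (?f (z(j := t, i := s))) \<partial>lborel \<partial>lborel) \<le>
      (\<integral>\<^sup>+t. \<integral>\<^sup>+s. ennreal (1 / c) * ennreal (e j t) * ennreal (e i s) \<partial>lborel \<partial>lborel)"
    by (intro nn_integral_mono)
  also have "\<dots> = ennreal (1 / c) * (\<integral>\<^sup>+t. ennreal (e j t) \<partial>lborel) * (\<integral>\<^sup>+s. ennreal (e i s) \<partial>lborel)"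
    by (subst nn_integral_cmult, measurable, subst nn_integral_multc, measurable, subst nn_integral_cmult, measurable)
  also have "\<dots> < \<infinity>" using e_fin ij by (auto simp: ennreal_mult_less_top)
  finally show "(\<integral>\<^sup>+t. \<integral>\<^sup>+s. ennreal (?f (z(j := t, i := s))) \<partial>lborel \<partial>lborel) < \<infinity>" .
qed

lemma mvn_cond_indep_imp_precision_zero:
  assumes pd: "pos_def_mat k S" and ij: "i < k" "j < k" "i \<noteq> j"
    and A: "mat_inverse S = Some A"
    and ci: "cond_indep_vars (mvn k S) (coord_algebra (mvn k S) ({..<k} - {i, j})) (\<lambda>y. y i) (\<lambda>y. y j)"
  shows "A $$ (i, j) = 0"
proof (rule ccontr)
  assume nz: "A $$ (i, j) \<noteq> 0"
  have S: "S \<in> carrier_mat k k" "transpose_mat S = S" using pd by (simp_all add: pos_def_mat_def)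
  have A': "A \<in> carrier_mat k k" "S * A = 1\<^sub>m k" "A * S = 1\<^sub>m k"
    using mat_inverse(2)[OF S(1) A] by auto
  have sym: "A $$ (j, i) = A $$ (i, j)"
    using inverse_mat_sym[OF S(1) A'(1,2,3) S(2)] ij A'(1) by (metis carrier_matD index_transpose_mat(1))
  interpret two_coordinate_density "{..<k} - {i, j}" i j "\<lambda>y. mvn_density S (Matrix.vec k y)"
    by (rule mvn_two_coordinate_density[OF pd ij])
  have I: "insert i (insert j ({..<k} - {i, j})) = {..<k}" using ij by auto
  have "mvn k S = MD" by (simp add: mvn_def I)
  with ci obtain z where z: "psi ({..0} \<times> {..0}) z * psi ((- {..0}) \<times> (- {..0})) z =
      psi ({..0} \<times> (- {..0})) z * psi ((- {..0}) \<times> {..0}) z"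
    by (auto elim!: cond_indep_cross_ratio[of "{..0}" "{..0}"])
  obtain \<alpha> \<beta> \<gamma> where q: "\<And>s t. scalar_prod (Matrix.vec k (z(j := t, i := s))) (mult_mat_vec A (Matrix.vec k (z(j := t, i := s)))) =
      (A $$ (i, i) * s\<^sup>2 + \<alpha> * s) + (A $$ (j, j) * t\<^sup>2 + \<beta> * t + \<gamma>) + (A $$ (i, j) + A $$ (j, i)) * s * t"
    using quadratic_form_two_coordinates[OF A'(1) ij] by blast
  define c where "c = sqrt ((2 * pi) ^ k * Determinant.det S)"
  have c: "c > 0" using pos_def_mat_det_pos[OF pd] by (simp add: c_def)
  define u where "u s = exp (- (A $$ (i, i) * s\<^sup>2 + \<alpha> * s) / 2)" for s
  define w where "w t = exp (- (A $$ (j, j) * t\<^sup>2 + \<beta> * t + \<gamma>) / 2) / c" for t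
  \<comment> \<open>By symmetry the mixed coefficient is twice \<open>A $$ (i, j)\<close>, and the
    factor 1/2 in the exponent reduces it to \<open>A $$ (i, j)\<close>, the parameter
    \<open>b\<close> of the cross-ratio lemma.\<close>
  have f: "mvn_density S (Matrix.vec k (z(j := t, i := s))) = u s * w t * exp (- A $$ (i, j) * s * t)" for s t
  proof -
    have "exp (- ((A $$ (i, i) * s\<^sup>2 + \<alpha> * s) + (A $$ (j, j) * t\<^sup>2 + \<beta> * t + \<gamma>) + (A $$ (i, j) + A $$ (j, i)) * s * t) / 2) =
      exp (- (A $$ (i, i) * s\<^sup>2 + \<alpha> * s) / 2) * exp (- (A $$ (j, j) * t\<^sup>2 + \<beta> * t + \<gamma>) / 2) * exp (- A $$ (i, j) * s * t)"
      unfolding exp_add[symmetric] sym by (rule arg_cong[where f=exp]) (simp add: field_simps)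
    then show ?thesis
      unfolding mvn_density_eq[OF S(1) A] q u_def w_def c_def[symmetric] by simp
  qed
  have "psi W z = (\<integral>\<^sup>+t. \<integral>\<^sup>+s. indicator W (s, t) * ennreal (u s * w t * exp (- A $$ (i, j) * s * t)) \<partial>lborel \<partial>lborel)" for W
    by (simp add: psi_def f)
  moreover have "u \<in> borel_measurable borel" "w \<in> borel_measurable borel" "\<And>s. u s > 0" "\<And>t. w t > 0"
    using c unfolding u_def w_def by (auto simp: divide_pos_pos)
  ultimately show False
    using tilted_product_cross_ratio[of u w "A $$ (i, j)"] z nz psi_finite[of UNIV z] by simp
qed

section \<open>The log-likelihood ratio\<close>

lemma ln_mvn_density:
  assumes "pos_def_mat n S" "mat_inverse S = Some A"
  shows "ln (mvn_density S y) = - scalar_prod y (mult_mat_vec A y) / 2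
           - ln ((2 * pi) ^ n) / 2 - ln (Determinant.det S) / 2" "mvn_density S y > 0"
proof -
  have "S \<in> carrier_mat n n" using assms by (simp add: pos_def_mat_def)
  note eq = mvn_density_eq[OF this assms(2), of y]
  have d: "Determinant.det S > 0" by (rule pos_def_mat_det_pos[OF assms(1)])
  then show "mvn_density S y > 0" unfolding eq by simp
  have p: "(2 * pi) ^ n > 0" by simp
  show "ln (mvn_density S y) = - scalar_prod y (mult_mat_vec A y) / 2
           - ln ((2 * pi) ^ n) / 2 - ln (Determinant.det S) / 2"
    unfolding eq using d p by (subst ln_div) (simp_all add: ln_sqrt ln_mult add_divide_distrib)
qed

lemma ln_mvn_density_H0:
  assumes "\<sigma>0 > 0"
  shows "ln (mvn_density (H0_covariance \<sigma>0 xs) (Matrix.vec (length xs) y)) =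
      - (\<Sum>i<length xs. (y i)\<^sup>2 / \<sigma>0\<^sup>2) / 2 - ln ((2 * pi) ^ length xs) / 2 - real (length xs) * ln \<sigma>0"
    "mvn_density (H0_covariance \<sigma>0 xs) (Matrix.vec (length xs) y) > 0"
proof -
  define n where "n = length xs"
  let ?S = "H0_covariance \<sigma>0 xs"
  have S: "?S \<in> carrier_mat n n" "?S = \<sigma>0\<^sup>2 \<cdot>\<^sub>m 1\<^sub>m n" by (simp_all add: H0_covariance_def n_def)
  have S_ij: "?S $$ (i, j) = (if i = j then \<sigma>0\<^sup>2 else 0)" if "i < n" "j < n" for i j
    using that by (simp add: S(2))
  have pd: "pos_def_mat n ?S"
    unfolding pos_def_mat_def
  proof (intro conjI ballI impI)
    show "transpose_mat ?S = ?S" by (rule eq_matI) (use S S_ij in auto)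
    fix v :: "real vec" assume v: "v \<in> carrier_vec n" "v \<noteq> 0\<^sub>v n"
    have "mult_mat_vec ?S v = \<sigma>0\<^sup>2 \<cdot>\<^sub>v v"
      by (rule eq_vecI) (use S v in \<open>auto simp: scalar_prod_def if_distrib[of "\<lambda>x. _ * x"] if_distrib[of "\<lambda>x. x * _"] cong: if_cong\<close>)
    then show "scalar_prod v (mult_mat_vec ?S v) > 0"
      using scalar_prod_self_pos[OF v] v assms by simp
  qed (rule S(1))
  obtain A where A: "mat_inverse ?S = Some A" "A \<in> carrier_mat n n" "?S * A = 1\<^sub>m n" "A * ?S = 1\<^sub>m n"
    using pos_def_mat_mat_inverse[OF pd] by blast
  have A0: "A $$ (i, j) = 0" if "i < n" "j < n" "i \<noteq> j" for i j
  proof -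
    have "?S * A = \<sigma>0\<^sup>2 \<cdot>\<^sub>m A" unfolding S(2) using A(2) by (subst mult_smult_assoc_mat[of _ n n]) auto
    then have "\<sigma>0\<^sup>2 * A $$ (i, j) = 0" using that A by (metis index_one_mat(1) index_smult_mat(1) carrier_matD)
    then show ?thesis using assms by simp
  qed
  have sym: "transpose_mat ?S = ?S" using pd by (simp add: pos_def_mat_def)
  \<comment> \<open>A multiple of the identity is the case of a forest without edges: every vertex
    is a root.\<close>
  have det: "Determinant.det ?S = (\<Prod>i<n. \<sigma>0\<^sup>2 * (1 - 0\<^sup>2))"
    and quad: "scalar_prod (Matrix.vec n y) (mult_mat_vec A (Matrix.vec n y)) = (\<Sum>i<n. (y i - 0 * y (id i))\<^sup>2 / (\<sigma>0\<^sup>2 * (1 - 0\<^sup>2)))"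
    by (rule forest_covariance[OF S(1) A(2,3,4) sym, where rk = id and s = "\<sigma>0\<^sup>2" and p = id and \<gamma> = "\<lambda>_. 0"];
        use S_ij A0 assms in auto)+
  show "ln (mvn_density ?S (Matrix.vec (length xs) y)) =
      - (\<Sum>i<length xs. (y i)\<^sup>2 / \<sigma>0\<^sup>2) / 2 - ln ((2 * pi) ^ length xs) / 2 - real (length xs) * ln \<sigma>0"
    unfolding n_def[symmetric] ln_mvn_density(1)[OF pd A(1)] det quad
    using assms by (simp add: ln_realpow)
  show "mvn_density ?S (Matrix.vec (length xs) y) > 0"
    by (rule ln_mvn_density(2)[OF pd A(1)])
qed

text \<open>Each edge is charged to its child. The map from children to edges is injective, since
  two vertices cannot be each other's parent: the rank would drop twice around a 2-cycle.\<close>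

lemma sum_forest_edges:
  fixes F :: "nat \<Rightarrow> nat \<Rightarrow> real" and rk :: "nat \<Rightarrow> nat"
  assumes p: "\<And>i. i < n \<Longrightarrow> p i < n" "\<And>i. i < n \<Longrightarrow> p i \<noteq> i \<Longrightarrow> rk (p i) < rk i"
    and E: "\<And>i j. (i, j) \<in> E \<longleftrightarrow> i < n \<and> j < n \<and> i \<noteq> j \<and> (j = p i \<or> i = p j)"
    and F: "\<And>i j. F i j = F j i"
  shows "(\<Sum>(i, j)\<in>{(i, j)\<in>E. i < j}. F i j) = (\<Sum>i<n. if p i = i then 0 else F i (p i))"
proof -
  let ?h = "\<lambda>i. (min i (p i), max i (p i))"
  have inj: "inj_on ?h {i. i < n \<and> p i \<noteq> i}"
  proof (rule inj_onI)
    fix i j assume i: "i \<in> {i. i < n \<and> p i \<noteq> i}" and j: "j \<in> {i. i < n \<and> p i \<noteq> i}" and eq: "?h i = ?h j"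
    show "i = j"
    proof (rule ccontr)
      assume "i \<noteq> j"
      with eq have "p i = j" "p j = i" by (auto simp: min_def max_def split: if_splits)
      then show False using p(2)[of i] p(2)[of j] i j by auto
    qed
  qed
  have image: "{(i, j)\<in>E. i < j} = ?h ` {i. i < n \<and> p i \<noteq> i}"
  proof (intro equalityI subsetI)
    fix e assume "e \<in> {(i, j)\<in>E. i < j}"
    then obtain i j where ij: "e = (i, j)" "i < j" "(i, j) \<in> E" by blast
    note e = ij(1,2) ij(3)[unfolded E, THEN conjunct1] ij(3)[unfolded E, THEN conjunct2, THEN conjunct1]
      ij(3)[unfolded E, THEN conjunct2, THEN conjunct2, THEN conjunct2]
    from e(5) show "e \<in> ?h ` {i. i < n \<and> p i \<noteq> i}"
    proof
      assume "j = p i"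
      then show ?thesis using e(1-3) by (intro image_eqI[of _ _ i]) simp_all
    next
      assume "i = p j"
      then show ?thesis using e(1,2,4) by (intro image_eqI[of _ _ j]) simp_all
    qed
  next
    fix e assume "e \<in> ?h ` {i. i < n \<and> p i \<noteq> i}"
    then obtain i where i: "e = ?h i" "i < n" "p i \<noteq> i" by blast
    show "e \<in> {(i, j)\<in>E. i < j}"
    proof (cases "i < p i")
      case True
      then have "e = (i, p i)" using i(1) by simp
      moreover have "(i, p i) \<in> E" using i(2,3) p(1)[OF i(2)] E[of i "p i"] by metis
      ultimately show ?thesis using True by simp
    next
      case False
      then have "e = (p i, i)" "p i < i" using i by auto
      moreover have "(p i, i) \<in> E" using i(2,3) p(1)[OF i(2)] E[of "p i" i] by metis
      ultimately show ?thesis by simp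
    qed
  qed
  have "(\<Sum>(i, j)\<in>{(i, j)\<in>E. i < j}. F i j) = (\<Sum>i\<in>{i. i < n \<and> p i \<noteq> i}. case ?h i of (i, j) \<Rightarrow> F i j)"
    unfolding image by (rule sum.reindex[OF inj, unfolded o_def])
  also have "\<dots> = (\<Sum>i\<in>{i. i < n \<and> p i \<noteq> i}. F i (p i))"
    by (rule sum.cong) (auto simp: min_def max_def F)
  also have "\<dots> = (\<Sum>i<n. if p i = i then 0 else F i (p i))"
    by (rule sum.mono_neutral_cong_left) auto
  finally show ?thesis .
qed

text \<open>Separates the node term of the child \<open>a\<close> from a remainder symmetric in
  \<open>a\<close> and \<open>b\<close>, which is the edge term without its logarithm.\<close>

lemma weighted_residual:
  fixes a b h s :: real
  assumes "1 - h\<^sup>2 \<noteq> 0" "s \<noteq> 0"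
  shows "(a - h * b)\<^sup>2 / (s * (1 - h\<^sup>2)) =
    a\<^sup>2 / s + (h\<^sup>2 / (1 - h\<^sup>2) * ((a\<^sup>2 + b\<^sup>2) / s) - 2 * h / (1 - h\<^sup>2) * (a * b / s))"
proof -
  have "(a - h * b)\<^sup>2 = a\<^sup>2 * (1 - h\<^sup>2) + (h\<^sup>2 * (a\<^sup>2 + b\<^sup>2) - 2 * h * (a * b))"
    by (simp add: power2_eq_square algebra_simps)
  then have "(a - h * b)\<^sup>2 / (s * (1 - h\<^sup>2)) = a\<^sup>2 * (1 - h\<^sup>2) / (s * (1 - h\<^sup>2))
      + (h\<^sup>2 * (a\<^sup>2 + b\<^sup>2) / (s * (1 - h\<^sup>2)) - 2 * h * (a * b) / (s * (1 - h\<^sup>2)))"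
    by (simp only: add_divide_distrib diff_divide_distrib)
  then show ?thesis using assms by (simp add: mult.commute)
qed

lemma log_likelihood_ratio:
  assumes tie: "tie_free xs" and H1: "H1_covariance g \<sigma>1 xs S" and \<sigma>: "\<sigma>0 > 0" "\<sigma>1 > 0"
  shows "ln (mvn_density (H0_covariance \<sigma>0 xs) (Matrix.vec (length xs) y) / mvn_density S (Matrix.vec (length xs) y)) =
    real (length xs) * ln (\<sigma>1 / \<sigma>0) +
    1 / 2 * ((\<Sum>i<length xs. (1 / \<sigma>1\<^sup>2 - 1 / \<sigma>0\<^sup>2) * (y i)\<^sup>2) +
      (\<Sum>(i, j)\<in>{(i, j)\<in>nn_edges xs. i < j}.
         let R = dist (xs ! i) (xs ! j) in
             ln (1 - (g R)\<^sup>2)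
             + (g R)\<^sup>2 / (1 - (g R)\<^sup>2) * (((y i)\<^sup>2 + (y j)\<^sup>2) / \<sigma>1\<^sup>2)
             - 2 * g R / (1 - (g R)\<^sup>2) * (y i * y j / \<sigma>1\<^sup>2)))"
proof -
  define n where "n = length xs"
  have pd: "pos_def_mat n S" and gm: "gauss_markov n (nn_edges xs) S"
    and diag: "\<And>i. i < n \<Longrightarrow> S $$ (i, i) = \<sigma>1\<^sup>2"
    and edge: "\<And>i j. (i, j) \<in> nn_edges xs \<Longrightarrow> S $$ (i, j) = \<sigma>1\<^sup>2 * g (dist (xs ! i) (xs ! j))"
    using H1 unfolding H1_covariance_def n_def by blast+
  have S: "S \<in> carrier_mat n n" "transpose_mat S = S" using pd by (simp_all add: pos_def_mat_def)
  obtain A where A: "mat_inverse S = Some A" "A \<in> carrier_mat n n" "S * A = 1\<^sub>m n" "A * S = 1\<^sub>m n"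
    using pos_def_mat_mat_inverse[OF pd] by blast
  obtain p rk :: "nat \<Rightarrow> nat" where rk: "inj_on rk {..<n}"
    and p: "\<And>i. i < n \<Longrightarrow> p i < n" "\<And>i. i < n \<Longrightarrow> p i \<noteq> i \<Longrightarrow> rk (p i) < rk i"
    and E: "\<And>i j. (i, j) \<in> nn_edges xs \<longleftrightarrow> i < n \<and> j < n \<and> i \<noteq> j \<and> (j = p i \<or> i = p j)"
    by (rule nn_forest[OF tie, folded n_def]) (rule that)
  have pat: "A $$ (i, j) = 0" if "i < n" "j < n" "i \<noteq> j" "j \<noteq> p i" "i \<noteq> p j" for i j
  proof -
    have "(i, j) \<notin> nn_edges xs" using that E[of i j] by blast
    then show ?thesis
      using gm[unfolded gauss_markov_def, rule_format, OF that(1-3)]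
        mvn_cond_indep_imp_precision_zero[OF pd that(1-3) A(1)] by blast
  qed
  \<comment> \<open>The value 0 makes the residual of a root the sample itself, with variance
    \<open>\<sigma>1\<^sup>2\<close>.\<close>
  define \<gamma> where "\<gamma> i = (if p i = i then 0 else g (dist (xs ! i) (xs ! p i)))" for i
  have S_p: "S $$ (i, p i) = \<sigma>1\<^sup>2 * \<gamma> i" if "i < n" "p i \<noteq> i" for i
  proof -
    have "(i, p i) \<in> nn_edges xs" using that p(1)[of i] E[of i "p i"] by metis
    then show ?thesis using edge that by (simp add: \<gamma>_def)
  qed
  have pos: "\<sigma>1\<^sup>2 * (1 - (\<gamma> i)\<^sup>2) > 0" if "i < n" for i
  proof (cases "p i = i")
    case False
    then show ?thesis
      using pos_def_mat_correlation_bound[OF pd that p(1)[OF that] _ diag[OF that] diag[OF p(1)[OF that]] S_p[OF that]]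
      by simp
  qed (use \<sigma> in \<open>simp add: \<gamma>_def\<close>)
  then have pos': "1 - (\<gamma> i)\<^sup>2 > 0" if "i < n" for i using that \<sigma> by (auto simp: zero_less_mult_iff)
  have det: "Determinant.det S = (\<Prod>i<n. \<sigma>1\<^sup>2 * (1 - (\<gamma> i)\<^sup>2))"
    and quad: "scalar_prod (Matrix.vec n y) (mult_mat_vec A (Matrix.vec n y)) =
      (\<Sum>i<n. (y i - \<gamma> i * y (p i))\<^sup>2 / (\<sigma>1\<^sup>2 * (1 - (\<gamma> i)\<^sup>2)))"
  proof -
    have root: "\<gamma> i = 0" if "p i = i" for i using that by (simp add: \<gamma>_def)
    have nz: "\<sigma>1\<^sup>2 \<noteq> 0" "\<And>i. i < n \<Longrightarrow> \<sigma>1\<^sup>2 * (1 - (\<gamma> i)\<^sup>2) \<noteq> 0" proof -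
      show "\<sigma>1\<^sup>2 \<noteq> 0" using \<sigma> by simp
      show "\<sigma>1\<^sup>2 * (1 - (\<gamma> i)\<^sup>2) \<noteq> 0" if "i < n" for i using pos[OF that] by (rule less_imp_neq[THEN not_sym])
    qed
    note * = forest_covariance[OF S(1) A(2,3,4) S(2) rk nz(1), of p \<gamma>, OF diag p(1) p(2) S_p root pat nz(2)]
    show "Determinant.det S = (\<Prod>i<n. \<sigma>1\<^sup>2 * (1 - (\<gamma> i)\<^sup>2))" by (rule *(1))
    show "scalar_prod (Matrix.vec n y) (mult_mat_vec A (Matrix.vec n y)) =
      (\<Sum>i<n. (y i - \<gamma> i * y (p i))\<^sup>2 / (\<sigma>1\<^sup>2 * (1 - (\<gamma> i)\<^sup>2)))" by (rule *(2))
  qed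
  define F where "F i j = (let R = dist (xs ! i) (xs ! j) in
             ln (1 - (g R)\<^sup>2)
             + (g R)\<^sup>2 / (1 - (g R)\<^sup>2) * (((y i)\<^sup>2 + (y j)\<^sup>2) / \<sigma>1\<^sup>2)
             - 2 * g R / (1 - (g R)\<^sup>2) * (y i * y j / \<sigma>1\<^sup>2))" for i j
  have edges: "(\<Sum>(i, j)\<in>{(i, j)\<in>nn_edges xs. i < j}. F i j) = (\<Sum>i<n. if p i = i then 0 else F i (p i))"
  proof (rule sum_forest_edges)
    show "F i j = F j i" for i j
      unfolding F_def dist_commute[of "xs ! i"] add.commute[of "(y i)\<^sup>2"] mult.commute[of "y i"] by (rule refl)
  qed (fact p E)+
  \<comment> \<open>The quadratic form and the log-determinant are combined vertex by vertex: every
    vertex contributes its node term, and every non-root also the term of the edge to its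
    parent.\<close>
  have summand: "(y i - \<gamma> i * y (p i))\<^sup>2 / (\<sigma>1\<^sup>2 * (1 - (\<gamma> i)\<^sup>2)) + ln (1 - (\<gamma> i)\<^sup>2) =
      (y i)\<^sup>2 / \<sigma>1\<^sup>2 + (if p i = i then 0 else F i (p i))" if "i < n" for i
  proof (cases "p i = i")
    case False
    define h where "h = g (dist (xs ! i) (xs ! p i))"
    have h: "1 - h\<^sup>2 \<noteq> 0" using pos'[OF that] False by (simp add: \<gamma>_def h_def)
    have "(y i - h * y (p i))\<^sup>2 / (\<sigma>1\<^sup>2 * (1 - h\<^sup>2)) = (y i)\<^sup>2 / \<sigma>1\<^sup>2
       + (h\<^sup>2 / (1 - h\<^sup>2) * (((y i)\<^sup>2 + (y (p i))\<^sup>2) / \<sigma>1\<^sup>2) - 2 * h / (1 - h\<^sup>2) * (y i * y (p i) / \<sigma>1\<^sup>2))"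
      by (rule weighted_residual) (use h \<sigma> in auto)
    then show ?thesis using False by (simp add: F_def \<gamma>_def h_def Let_def)
  qed (use \<sigma> in \<open>simp add: \<gamma>_def\<close>)
  have "ln (Determinant.det S) = (\<Sum>i<n. ln (\<sigma>1\<^sup>2 * (1 - (\<gamma> i)\<^sup>2)))"
    unfolding det by (rule ln_prod[OF finite_lessThan]) (use pos in \<open>metis lessThan_iff less_irrefl\<close>)
  also have "\<dots> = (\<Sum>i<n. 2 * ln \<sigma>1 + ln (1 - (\<gamma> i)\<^sup>2))"
  proof (rule sum.cong[OF refl])
    fix i assume "i \<in> {..<n}"
    then have "1 - (\<gamma> i)\<^sup>2 \<noteq> 0" "\<sigma>1\<^sup>2 \<noteq> 0" using pos'[of i] \<sigma> by fastforce+
    then show "ln (\<sigma>1\<^sup>2 * (1 - (\<gamma> i)\<^sup>2)) = 2 * ln \<sigma>1 + ln (1 - (\<gamma> i)\<^sup>2)"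
      using \<sigma> by (subst ln_mult) (simp_all add: ln_realpow)
  qed
  finally have "scalar_prod (Matrix.vec n y) (mult_mat_vec A (Matrix.vec n y)) + ln (Determinant.det S) =
      (\<Sum>i<n. 2 * ln \<sigma>1 + ((y i - \<gamma> i * y (p i))\<^sup>2 / (\<sigma>1\<^sup>2 * (1 - (\<gamma> i)\<^sup>2)) + ln (1 - (\<gamma> i)\<^sup>2)))"
    unfolding quad by (simp add: sum.distrib)
  also have "\<dots> = (\<Sum>i<n. 2 * ln \<sigma>1 + ((y i)\<^sup>2 / \<sigma>1\<^sup>2 + (if p i = i then 0 else F i (p i))))"
    by (rule sum.cong) (simp_all only: summand lessThan_iff)
  also have "\<dots> = 2 * real n * ln \<sigma>1 + (\<Sum>i<n. (y i)\<^sup>2 / \<sigma>1\<^sup>2) + (\<Sum>(i, j)\<in>{(i, j)\<in>nn_edges xs. i < j}. F i j)"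
    unfolding edges by (simp add: sum.distrib)
  finally have key: "scalar_prod (Matrix.vec n y) (mult_mat_vec A (Matrix.vec n y)) + ln (Determinant.det S) =
     2 * real n * ln \<sigma>1 + (\<Sum>i<n. (y i)\<^sup>2 / \<sigma>1\<^sup>2) + (\<Sum>(i, j)\<in>{(i, j)\<in>nn_edges xs. i < j}. F i j)" .
  have nodes: "(\<Sum>i<n. (1 / \<sigma>1\<^sup>2 - 1 / \<sigma>0\<^sup>2) * (y i)\<^sup>2) = (\<Sum>i<n. (y i)\<^sup>2 / \<sigma>1\<^sup>2) - (\<Sum>i<n. (y i)\<^sup>2 / \<sigma>0\<^sup>2)"
    by (simp add: sum_subtractf[symmetric] left_diff_distrib)
  have "ln (mvn_density (H0_covariance \<sigma>0 xs) (Matrix.vec n y) / mvn_density S (Matrix.vec n y)) =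
      ln (mvn_density (H0_covariance \<sigma>0 xs) (Matrix.vec n y)) - ln (mvn_density S (Matrix.vec n y))"
    using ln_mvn_density_H0(2)[OF \<sigma>(1), of xs y] ln_mvn_density(2)[OF pd A(1), of "Matrix.vec n y"]
    by (simp add: ln_div n_def)
  \<comment> \<open>The powers of 2 pi cancel. Half of the term
    \<open>2 * real n * ln \<sigma>1\<close> from the determinant combines with
    \<open>real n * ln \<sigma>0\<close> to the logarithm of the quotient.\<close>
  also have "\<dots> = real n * ln (\<sigma>1 / \<sigma>0) + 1 / 2 * ((\<Sum>i<n. (1 / \<sigma>1\<^sup>2 - 1 / \<sigma>0\<^sup>2) * (y i)\<^sup>2) +
      (\<Sum>(i, j)\<in>{(i, j)\<in>nn_edges xs. i < j}. F i j))"
    using key \<sigma> unfolding nodes ln_mvn_density(1)[OF pd A(1)] ln_mvn_density_H0(1)[OF \<sigma>(1), of xs y, folded n_def]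
    by (simp add: ln_div algebra_simps)
  finally show ?thesis unfolding n_def F_def .
qed

section \<open>Poisson numbers of points\<close>

lemma (in prob_space) poisson_exponential_moment:
  assumes N: "N \<in> measurable M (count_space UNIV)" and a: "a > 0"
    and law: "\<And>k. prob {\<omega> \<in> space M. N \<omega> = k} = a ^ k / fact k * exp (- a)"
  shows "(\<integral>\<^sup>+\<omega>. ennreal (exp (t * real (N \<omega>))) \<partial>M) = ennreal (exp (a * (exp t - 1)))"
proof -
  have distr: "distr M (count_space UNIV) N = measure_pmf (poisson_pmf a)"
  proof (rule measure_eqI_countable[where A=UNIV])
    fix k :: nat
    have "emeasure (distr M (count_space UNIV) N) {k} = emeasure M (N -` {k} \<inter> space M)"
      using N by (rule emeasure_distr) simp
    also have "N -` {k} \<inter> space M = {\<omega> \<in> space M. N \<omega> = k}" by auto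
    finally show "emeasure (distr M (count_space UNIV) N) {k} = emeasure (measure_pmf (poisson_pmf a)) {k}"
      using law[of k] a by (simp add: emeasure_eq_measure emeasure_pmf_single)
  qed auto
  have summand: "ennreal (pmf (poisson_pmf a) k) * ennreal (exp (t * real k)) =
      ennreal (exp (- a) * ((a * exp t) ^ k /\<^sub>R fact k))" for k
    using a by (simp add: ennreal_mult'[symmetric] power_mult_distrib exp_of_nat_mult[symmetric] field_simps)
  have sums: "(\<lambda>k. exp (- a) * ((a * exp t) ^ k /\<^sub>R fact k)) sums (exp (- a) * exp (a * exp t))"
    by (intro sums_mult exp_converges)
  have "(\<integral>\<^sup>+\<omega>. ennreal (exp (t * real (N \<omega>))) \<partial>M) =
      (\<integral>\<^sup>+k. ennreal (exp (t * real k)) \<partial>distr M (count_space UNIV) N)"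
    using N by (subst nn_integral_distr) auto
  also have "\<dots> = (\<Sum>k. ennreal (exp (- a) * ((a * exp t) ^ k /\<^sub>R fact k)))"
    unfolding distr nn_integral_measure_pmf nn_integral_count_space_nat summand ..
  also have "\<dots> = ennreal (exp (- a) * exp (a * exp t))"
    using sums a by (subst suminf_ennreal2) (auto simp: sums_iff)
  finally show ?thesis by (simp add: exp_add[symmetric] algebra_simps)
qed

text \<open>The sign of \<open>t\<close> is free, and \<open>t\<close> is kept on both sides of the
  inequality inside the event, so that one statement covers both tails.\<close>

lemma (in prob_space) poisson_Chernoff:
  assumes N: "N \<in> measurable M (count_space UNIV)" and a: "a > 0"
    and law: "\<And>k. prob {\<omega> \<in> space M. N \<omega> = k} = a ^ k / fact k * exp (- a)"
  shows "prob {\<omega> \<in> space M. t * real (N \<omega>) \<ge> t * b} \<le> exp (a * (exp t - 1) - t * b)"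
proof -
  have [measurable]: "(\<lambda>\<omega>. real (N \<omega>)) \<in> borel_measurable M"
    using measurable_compose[OF N, of real borel] by simp
  have "{\<omega> \<in> space M. t * real (N \<omega>) \<ge> t * b} =
      {\<omega> \<in> space M. 1 \<le> ennreal (exp (- t * b)) * ennreal (exp (t * real (N \<omega>)))}"
    by (auto simp: ennreal_mult'[symmetric] exp_add[symmetric] simp flip: ennreal_1)
  also have "emeasure M \<dots> \<le> ennreal (exp (- t * b)) * (\<integral>\<^sup>+\<omega>. ennreal (exp (t * real (N \<omega>))) * indicator (space M) \<omega> \<partial>M)"
    by (rule nn_integral_Markov_inequality) auto
  also have "(\<integral>\<^sup>+\<omega>. ennreal (exp (t * real (N \<omega>))) * indicator (space M) \<omega> \<partial>M) = ennreal (exp (a * (exp t - 1)))"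
    unfolding poisson_exponential_moment[OF assms, symmetric] by (rule nn_integral_cong) simp
  also have "ennreal (exp (- t * b)) * \<dots> = ennreal (exp (a * (exp t - 1) - t * b))"
    by (simp add: ennreal_mult'[symmetric] exp_add[symmetric])
  finally show ?thesis by (simp add: emeasure_eq_measure)
qed

lemma (in prob_space) poisson_deviation:
  assumes N: "N \<in> measurable M (count_space UNIV)" and a: "a > 0"
    and law: "\<And>k. prob {\<omega> \<in> space M. N \<omega> = k} = a ^ k / fact k * exp (- a)"
    and e: "0 < e" "e \<le> 1"
  shows "prob {\<omega> \<in> space M. \<bar>real (N \<omega>) - a\<bar> \<ge> e * a} \<le> 2 * exp (- (e\<^sup>2 / 4) * a)"
proof -
  have [measurable]: "(\<lambda>\<omega>. real (N \<omega>)) \<in> borel_measurable M"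
    using measurable_compose[OF N, of real borel] by simp
  \<comment> \<open>After \<open>exp\<close> is bounded by its second-order estimate, both exponents
    become at most \<open>a * (s\<^sup>2 - s * e)\<close>, which is minimal at
    \<open>s = e / 2\<close> with value \<open>- (e\<^sup>2 / 4) * a\<close>.\<close>
  define s where "s = e / 2"
  have s: "0 < s" "s \<le> 1" "e = 2 * s" using e by (auto simp: s_def)
  have "exp s \<le> 1 + s + s\<^sup>2" using s exp_bound[of s] by simp
  then have "a * (exp s - 1) \<le> a * (s + s\<^sup>2)" using a by (intro mult_left_mono) auto
  then have 1: "a * (exp s - 1) - s * ((1 + e) * a) \<le> - (e\<^sup>2 / 4) * a"
    by (simp add: s power2_eq_square algebra_simps)
  \<comment> \<open>Here exp (- s) \<le> 1 / (1 + s), and (1 - s + s^2) (1 + s) = 1 + s^3 \<ge>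
    1.\<close>
  have "exp (- s) \<le> 1 - s + s\<^sup>2"
  proof -
    have "exp (- s) * (1 + s) \<le> 1" using mult_left_mono[OF exp_ge_add_one_self[of s], of "exp (- s)"]
      by (simp add: exp_minus_inverse exp_add[symmetric])
    also have "1 \<le> (1 - s + s\<^sup>2) * (1 + s)" using s by (simp add: algebra_simps power2_eq_square)
    finally show ?thesis using s by simp
  qed
  then have "a * (exp (- s) - 1) \<le> a * (- s + s\<^sup>2)" using a by (intro mult_left_mono) auto
  then have 2: "a * (exp (- s) - 1) - (- s) * ((1 - e) * a) \<le> - (e\<^sup>2 / 4) * a"
    by (simp add: s power2_eq_square algebra_simps)
  have "{\<omega> \<in> space M. \<bar>real (N \<omega>) - a\<bar> \<ge> e * a} \<subseteq>
      {\<omega> \<in> space M. s * real (N \<omega>) \<ge> s * ((1 + e) * a)} \<union> {\<omega> \<in> space M. (- s) * real (N \<omega>) \<ge> (- s) * ((1 - e) * a)}"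
  proof
    fix \<omega> assume "\<omega> \<in> {\<omega> \<in> space M. \<bar>real (N \<omega>) - a\<bar> \<ge> e * a}"
    then have "\<omega> \<in> space M" "real (N \<omega>) \<ge> (1 + e) * a \<or> real (N \<omega>) \<le> (1 - e) * a"
      by (auto simp: abs_if left_diff_distrib distrib_right split: if_splits)
    then show "\<omega> \<in> {\<omega> \<in> space M. s * real (N \<omega>) \<ge> s * ((1 + e) * a)} \<union>
        {\<omega> \<in> space M. (- s) * real (N \<omega>) \<ge> (- s) * ((1 - e) * a)}"
      using s(1) by auto
  qed
  then have "prob {\<omega> \<in> space M. \<bar>real (N \<omega>) - a\<bar> \<ge> e * a} \<le>
      prob ({\<omega> \<in> space M. s * real (N \<omega>) \<ge> s * ((1 + e) * a)} \<union> {\<omega> \<in> space M. (- s) * real (N \<omega>) \<ge> (- s) * ((1 - e) * a)})"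
    by (intro finite_measure_mono) auto
  also have "\<dots> \<le> prob {\<omega> \<in> space M. s * real (N \<omega>) \<ge> s * ((1 + e) * a)} + prob {\<omega> \<in> space M. (- s) * real (N \<omega>) \<ge> (- s) * ((1 - e) * a)}"
    by (rule measure_Un_le) auto
  also have "\<dots> \<le> exp (- (e\<^sup>2 / 4) * a) + exp (- (e\<^sup>2 / 4) * a)"
    using 1 2 poisson_Chernoff[OF N a law, of s "(1 + e) * a"] poisson_Chernoff[OF N a law, of "- s" "(1 - e) * a"]
    by (intro add_mono) (meson exp_le_cancel_iff order_trans)+
  finally show ?thesis by simp
qed

text \<open>The joint law over different \<open>n\<close> is unspecified, so the convergent half of
  Borel-Cantelli is the right tool: the deviation probabilities are summable for every tolerance
  \<open>1 / real (Suc m)\<close>.\<close>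

lemma (in prob_space) poisson_AE_ratio_tendsto:
  assumes N: "\<And>n. n \<ge> 1 \<Longrightarrow> N n \<in> measurable M (count_space UNIV)"
    and law: "\<And>n k. n \<ge> 1 \<Longrightarrow> prob {\<omega> \<in> space M. N n \<omega> = k} = real n ^ k / fact k * exp (- real n)"
  shows "AE \<omega> in M. (\<lambda>n. real (N n \<omega>) / real n) \<longlonglongrightarrow> 1"
proof -
  \<comment> \<open>The shift to \<open>Suc n\<close> keeps to the indices at least 1, for which a
    law is given.\<close>
  define A where "A m n = {\<omega> \<in> space M. \<bar>real (N (Suc n) \<omega>) - real (Suc n)\<bar> \<ge> (1 / real (Suc m)) * real (Suc n)}" for m n
  have [measurable]: "(\<lambda>\<omega>. real (N (Suc n) \<omega>)) \<in> borel_measurable M" for n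
    using measurable_compose[OF N[of "Suc n"], of real borel] by simp
  have "AE \<omega> in M. \<forall>\<^sub>F n in sequentially. \<omega> \<in> space M - A m n" for m
  proof (rule borel_cantelli_AE1)
    show "A m n \<in> sets M" for n unfolding A_def by measurable
    show "emeasure M (A m n) < \<infinity>" for n by (simp add: emeasure_eq_measure)
    define r where "r = exp (- ((1 / real (Suc m))\<^sup>2 / 4))"
    have r: "0 < r" "r < 1" by (simp_all add: r_def)
    have "summable (\<lambda>n. 2 * r ^ Suc n)" using r by (intro summable_mult) (simp add: summable_geometric)
    moreover have "norm (prob (A m n)) \<le> 2 * r ^ Suc n" for n
    proof -
      have "prob (A m n) \<le> 2 * exp (- ((1 / real (Suc m))\<^sup>2 / 4) * real (Suc n))"
        unfolding A_def by (rule poisson_deviation) (use N law in auto)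
      also have "\<dots> = 2 * r ^ Suc n" unfolding r_def exp_of_nat_mult[symmetric] by (simp add: mult.commute)
      finally show ?thesis by simp
    qed
    ultimately show "summable (\<lambda>n. prob (A m n))" by (rule summable_comparison_test'[of _ 0])
  qed
  then have "AE \<omega> in M. \<forall>m. \<forall>\<^sub>F n in sequentially. \<omega> \<in> space M - A m n" by (simp add: AE_all_countable)
  then show ?thesis
  proof eventually_elim
    case (elim \<omega>)
    have "(\<lambda>n. real (N (Suc n) \<omega>) / real (Suc n)) \<longlonglongrightarrow> 1"
    proof (rule tendstoI)
      fix e :: real assume "e > 0"
      then obtain m where m: "1 / real (Suc m) < e" using nat_approx_posE by blast
      from elim[rule_format, of m]
      show "\<forall>\<^sub>F n in sequentially. dist (real (N (Suc n) \<omega>) / real (Suc n)) 1 < e"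
      proof eventually_elim
        case (elim n)
        then have "\<bar>real (N (Suc n) \<omega>) - real (Suc n)\<bar> < (1 / real (Suc m)) * real (Suc n)" by (auto simp: A_def)
        then have "\<bar>real (N (Suc n) \<omega>) - real (Suc n)\<bar> / real (Suc n) < 1 / real (Suc m)"
          by (subst pos_divide_less_eq) auto
        moreover have "dist (real (N (Suc n) \<omega>) / real (Suc n)) 1 = \<bar>real (N (Suc n) \<omega>) - real (Suc n)\<bar> / real (Suc n)"
        proof -
          have "real (N (Suc n) \<omega>) / real (Suc n) - 1 = (real (N (Suc n) \<omega>) - real (Suc n)) / real (Suc n)"
            by (simp add: diff_divide_distrib)
          then show ?thesis by (simp only: dist_real_def abs_divide abs_of_nat)
        qed
        ultimately show ?case using m by simp
      qed
    qed
    then show ?case by (rule LIMSEQ_imp_Suc)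
  qed
qed

section \<open>Areas of the squares and discs\<close>

lemma centered_square_area:
  assumes "centered_square a B" "a \<ge> 0"
  shows "compact B" "Sigma_Algebra.measure lborel B = a"
proof -
  obtain f :: "real^2 \<Rightarrow> real^2" where f: "orthogonal_transformation f" and B: "B = f ` {x. infnorm x \<le> sqrt a / 2}"
    using assms(1) unfolding centered_square_def by blast
  define r where "r = sqrt a / 2"
  have r: "r \<ge> 0" "(2 * r)\<^sup>2 = a" using assms(2) by (auto simp: r_def)
  have Q: "{x :: real^2. infnorm x \<le> r} = cbox (\<chi> i. - r) (\<chi> i. r)"
    by (auto simp: infnorm_2 mem_box_cart forall_2)
  have cf: "continuous_on UNIV f" using f by (simp add: linear_continuous_on orthogonal_transformation_linear linear_linear)
  show "compact B" unfolding B r_def[symmetric] Q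
    by (intro compact_continuous_image continuous_on_subset[OF cf]) auto
  \<comment> \<open>Invariance under orthogonal maps is applied to the completed Lebesgue measure,
    which agrees with \<open>lborel\<close> on the compact set \<open>B\<close>.\<close>
  then have "Sigma_Algebra.measure lborel B = Sigma_Algebra.measure lebesgue B"
    by (simp add: measure_completion compact_imp_closed borel_closed)
  also have "\<dots> = Sigma_Algebra.measure lebesgue (cbox (\<chi> i. - r) (\<chi> i. r) :: (real^2) set)"
    unfolding B r_def[symmetric] Q by (rule measure_orthogonal_image[OF f]) simp
  also have "\<dots> = (2 * r)\<^sup>2"
    using r(1) by (simp add: content_cbox_cart interval_ne_empty_cart power2_eq_square UNIV_2)
  finally show "Sigma_Algebra.measure lborel B = a" using r by simp
qed

lemma centered_disc_area:
  assumes "centered_disc a B" "a \<ge> 0"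
  shows "compact B" "Sigma_Algebra.measure lborel B = a"
proof -
  have B: "B = cball 0 (sqrt (a / pi))" using assms(1) by (simp add: centered_disc_def)
  then show "compact B" by simp
  show "Sigma_Algebra.measure lborel B = a"
    unfolding B using assms(2) by (simp add: content_cball unit_ball_vol_2)
qed

section \<open>Absence of ties\<close>

abbreviation "lborel3 \<equiv> lborel \<Otimes>\<^sub>M (lborel \<Otimes>\<^sub>M lborel) :: ((real^2) \<times> (real^2) \<times> (real^2)) measure"

definition near_ties :: "(real^2) set \<Rightarrow> real \<Rightarrow> ((real^2) \<times> (real^2) \<times> (real^2)) set" where
  "near_ties B \<epsilon> = {(x, y, z). x \<in> B \<and> y \<in> B \<and> z \<in> B \<and> \<bar>dist x y - dist x z\<bar> \<le> \<epsilon>}"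

lemma sets_near_ties [measurable]:
  assumes [measurable]: "B \<in> sets borel"
  shows "near_ties B \<epsilon> \<in> sets lborel3"
proof -
  have "near_ties B \<epsilon> = {w \<in> space lborel3. fst w \<in> B \<and> fst (snd w) \<in> B \<and> snd (snd w) \<in> B \<and>
      \<bar>dist (fst w) (fst (snd w)) - dist (fst w) (snd (snd w))\<bar> \<le> \<epsilon>}"
    by (auto simp: near_ties_def space_pair_measure)
  also have "\<dots> \<in> sets lborel3" by measurable
  finally show ?thesis .
qed

lemma emeasure_lborel3_Times:
  assumes "a \<in> sets borel" "b \<in> sets borel" "c \<in> sets borel"
  shows "emeasure lborel3 (a \<times> b \<times> c) = emeasure lborel a * (emeasure lborel b * emeasure lborel c)"
proof -
  have sf: "sigma_finite_measure (lborel \<Otimes>\<^sub>M lborel :: ((real^2) \<times> (real^2)) measure)"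
    unfolding lborel_prod ..
  show ?thesis
    using assms by (simp add: sigma_finite_measure.emeasure_pair_measure_Times[OF sf] lborel.emeasure_pair_measure_Times)
qed

text \<open>Continuity from above on a set of finite measure. The intersection consists of the exact
  ties; it is null because, for fixed x and y, the point z is confined to a circle.\<close>

lemma near_ties_tendsto_0:
  assumes B: "B \<in> sets borel" "bounded B"
  shows "(\<lambda>m. Sigma_Algebra.measure lborel3 (near_ties B (8 / real (Suc m)))) \<longlonglongrightarrow> 0"
proof -
  have sf: "sigma_finite_measure (lborel \<Otimes>\<^sub>M lborel :: ((real^2) \<times> (real^2)) measure)"
    unfolding lborel_prod ..
  have fin: "emeasure lborel3 (near_ties B \<epsilon>) \<noteq> \<infinity>" for \<epsilon>
  proof -
    have "emeasure lborel3 (near_ties B \<epsilon>) \<le> emeasure lborel3 (B \<times> B \<times> B)"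
      using B(1) by (intro emeasure_mono) (auto simp: near_ties_def)
    also have "\<dots> < \<infinity>"
      using emeasure_bounded_finite[OF B(2)] B(1) by (simp add: emeasure_lborel3_Times ennreal_mult_less_top)
    finally show ?thesis by simp
  qed
  have Int: "(\<Inter>m. near_ties B (8 / real (Suc m))) = near_ties B 0"
  proof (intro equalityI subsetI)
    fix w assume w: "w \<in> (\<Inter>m. near_ties B (8 / real (Suc m)))"
    obtain x y z where xyz: "w = (x, y, z)" by (metis prod_cases3)
    have "\<bar>dist x y - dist x z\<bar> \<le> 0"
    proof (rule field_le_epsilon)
      fix e :: real assume "e > 0"
      then obtain m where "1 / real (Suc m) < e / 8" using nat_approx_posE[of "e / 8"] by auto
      moreover have "\<bar>dist x y - dist x z\<bar> \<le> 8 / real (Suc m)" using w by (auto simp: xyz near_ties_def)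
      ultimately show "\<bar>dist x y - dist x z\<bar> \<le> 0 + e" by simp
    qed
    then show "w \<in> near_ties B 0" using w by (auto simp: xyz near_ties_def)
  next
    fix w assume "w \<in> near_ties B 0"
    then show "w \<in> (\<Inter>m. near_ties B (8 / real (Suc m)))" by (auto simp: near_ties_def)
  qed
  have null: "emeasure lborel3 (near_ties B 0) = 0"
  proof -
    have "emeasure lborel {z. (x, y, z) \<in> near_ties B 0} = 0" for x y
    proof -
      have "sphere x (dist x y) \<in> null_sets lebesgue"
        using negligible_sphere[of x "dist x y"] by (simp add: negligible_iff_null_sets)
      then have "emeasure lborel (sphere x (dist x y)) = 0"
        by (simp add: null_sets_completion_iff null_sets_def)
      moreover have "emeasure lborel {z. (x, y, z) \<in> near_ties B 0} \<le> emeasure lborel (sphere x (dist x y))"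
        by (intro emeasure_mono) (auto simp: near_ties_def sphere_def)
      ultimately show ?thesis by simp
    qed
    note z0 = this
    have "emeasure (lborel \<Otimes>\<^sub>M lborel) (Pair x -` near_ties B 0) = 0" for x
    proof -
      have "Pair x -` near_ties B 0 \<in> sets (lborel \<Otimes>\<^sub>M lborel)"
        using sets_near_ties[OF B(1)] by (rule sets_Pair1)
      then have "emeasure (lborel \<Otimes>\<^sub>M lborel) (Pair x -` near_ties B 0) =
          (\<integral>\<^sup>+y. emeasure lborel (Pair y -` (Pair x -` near_ties B 0)) \<partial>lborel)"
        by (rule lborel.emeasure_pair_measure_alt)
      also have "\<dots> = (\<integral>\<^sup>+y. 0 \<partial>(lborel :: (real^2) measure))"
        by (intro nn_integral_cong) (use z0[of x] in \<open>simp add: vimage_def\<close>)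
      finally show ?thesis by simp
    qed
    then show ?thesis
      by (subst sigma_finite_measure.emeasure_pair_measure_alt[OF sf sets_near_ties[OF B(1)]]) simp
  qed
  have "(\<lambda>m. Sigma_Algebra.measure lborel3 (near_ties B (8 / real (Suc m)))) \<longlonglongrightarrow>
      Sigma_Algebra.measure lborel3 (\<Inter>m. near_ties B (8 / real (Suc m)))"
  proof (rule Lim_measure_decseq)
    show "decseq (\<lambda>m. near_ties B (8 / real (Suc m)))"
    proof (rule antimonoI)
      fix m n :: nat assume "m \<le> n"
      then have "8 / real (Suc n) \<le> 8 / real (Suc m)" by (simp add: frac_le)
      then show "near_ties B (8 / real (Suc n)) \<subseteq> near_ties B (8 / real (Suc m))"
        by (auto simp: near_ties_def)
    qed
    show "range (\<lambda>m. near_ties B (8 / real (Suc m))) \<subseteq> sets lborel3"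
      using sets_near_ties[OF B(1)] by blast
  qed (rule fin)
  also have "Sigma_Algebra.measure lborel3 (\<Inter>m. near_ties B (8 / real (Suc m))) = 0"
    unfolding Int using null by (simp add: Sigma_Algebra.measure_def)
  finally show ?thesis .
qed

text \<open>\<open>r\<close> is the reciprocal of the mesh. Rounding down makes the cells half-open,
  so they partition \<open>B\<close> exactly.\<close>

definition cell :: "(real^2) set \<Rightarrow> real \<Rightarrow> int \<times> int \<Rightarrow> (real^2) set" where
  "cell B r p = {x \<in> B. (\<lfloor>r * vec_nth x 1\<rfloor>, \<lfloor>r * vec_nth x 2\<rfloor>) = p}"

lemma sets_cell [measurable]:
  assumes [measurable]: "B \<in> sets borel"
  shows "cell B r p \<in> sets borel"
proof -
  have "cell B r p = {x \<in> space borel. x \<in> B \<and> \<lfloor>r * vec_nth x 1\<rfloor> = fst p \<and> \<lfloor>r * vec_nth x 2\<rfloor> = snd p}"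
    by (auto simp: cell_def)
  also have "\<dots> \<in> sets borel" by measurable
  finally show ?thesis .
qed

lemma cell_subset_cbox:
  assumes "r > 0"
  shows "cell B r p \<subseteq> cbox (\<chi> i. if i = 1 then of_int (fst p) / r else of_int (snd p) / r)
     (\<chi> i. if i = 1 then of_int (fst p + 1) / r else of_int (snd p + 1) / r)"
proof
  fix x assume x: "x \<in> cell B r p"
  have "of_int \<lfloor>r * vec_nth x i\<rfloor> / r \<le> vec_nth x i" "vec_nth x i \<le> of_int (\<lfloor>r * vec_nth x i\<rfloor> + 1) / r" for i
    using assms of_int_floor_le[of "r * vec_nth x i"] real_of_int_floor_add_one_ge[of "r * vec_nth x i"]
    by (simp_all add: field_simps)
  then show "x \<in> cbox (\<chi> i. if i = 1 then of_int (fst p) / r else of_int (snd p) / r)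
     (\<chi> i. if i = 1 then of_int (fst p + 1) / r else of_int (snd p + 1) / r)"
    using x by (auto simp: cell_def mem_box_cart forall_2)
qed

lemma measure_cell_le:
  assumes "r > 0" "B \<in> sets borel"
  shows "Sigma_Algebra.measure lborel (cell B r p) \<le> 1 / r\<^sup>2"
proof -
  let ?Q = "cbox (\<chi> i. if i = 1 then of_int (fst p) / r else of_int (snd p) / r)
     (\<chi> i. if i = 1 then of_int (fst p + 1) / r else of_int (snd p + 1) / r) :: (real^2) set"
  have "Sigma_Algebra.measure lborel (cell B r p) \<le> Sigma_Algebra.measure lborel ?Q"
    using cell_subset_cbox[OF assms(1)] assms by (intro measure_mono_fmeasurable) auto
  also have "\<dots> = 1 / r\<^sup>2"
    using assms(1) by (subst content_cbox_cart)
      (auto simp: interval_ne_empty_cart UNIV_2 power2_eq_square divide_right_mono add_divide_distrib)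
  finally show ?thesis .
qed

lemma dist_cell_le:
  assumes "r > 0" "x \<in> cell B r p" "y \<in> cell B r p"
  shows "dist x y \<le> 2 / r"
proof -
  have "\<bar>vec_nth x i - vec_nth y i\<bar> \<le> 1 / r" for i
  proof -
    have "\<lfloor>r * vec_nth x i\<rfloor> = \<lfloor>r * vec_nth y i\<rfloor>"
      using assms(2,3) exhaust_2[of i] by (auto simp: cell_def)
    then have "\<bar>r * vec_nth x i - r * vec_nth y i\<bar> \<le> 1" by linarith
    then have "r * \<bar>vec_nth x i - vec_nth y i\<bar> \<le> 1"
      using assms(1) by (simp add: right_diff_distrib[symmetric] abs_mult)
    then show ?thesis using assms(1) by (simp add: field_simps)
  qed
  then have "(\<Sum>i\<in>UNIV. \<bar>vec_nth (x - y) i\<bar>) \<le> (\<Sum>i\<in>(UNIV :: 2 set). 1 / r)" by (intro sum_mono) simp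
  then show ?thesis using norm_le_l1_cart[of "x - y"] by (simp add: dist_norm)
qed

lemma finite_cells:
  assumes "bounded B"
  shows "finite ((\<lambda>x :: real^2. (\<lfloor>r * vec_nth x 1\<rfloor>, \<lfloor>r * vec_nth x 2\<rfloor>)) ` B)"
proof -
  obtain b where b: "\<And>x. x \<in> B \<Longrightarrow> norm x \<le> b" using assms by (auto simp: bounded_iff)
  have "\<bar>r * vec_nth x i\<bar> \<le> \<bar>r\<bar> * b" if "x \<in> B" for x i
    using b[OF that] component_le_norm_cart[of x i] by (auto simp: abs_mult intro!: mult_left_mono)
  then have "\<lfloor>r * vec_nth x i\<rfloor> \<in> {\<lfloor>- (\<bar>r\<bar> * b)\<rfloor>..\<lfloor>\<bar>r\<bar> * b\<rfloor>}" if "x \<in> B" for x i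
    using that by (auto intro!: floor_mono simp: abs_le_iff) (smt (verit) floor_mono)
  then have "(\<lambda>x. (\<lfloor>r * vec_nth x 1\<rfloor>, \<lfloor>r * vec_nth x 2\<rfloor>)) ` B \<subseteq>
      {\<lfloor>- (\<bar>r\<bar> * b)\<rfloor>..\<lfloor>\<bar>r\<bar> * b\<rfloor>} \<times> {\<lfloor>- (\<bar>r\<bar> * b)\<rfloor>..\<lfloor>\<bar>r\<bar> * b\<rfloor>}" by blast
  then show ?thesis by (rule finite_subset) simp
qed

text \<open>Moving within a cell costs at most \<open>2 / r\<close> (the l1 bound on its diameter).
  The point \<open>x\<close> enters both distances and the other two points one each, which adds up
  to \<open>8 / r\<close>.\<close>

lemma cell_triple_subset_near_ties:
  assumes "r > 0" "x \<in> cell B r p" "y \<in> cell B r q" "z \<in> cell B r q'" "dist x y = dist x z"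
  shows "cell B r p \<times> cell B r q \<times> cell B r q' \<subseteq> near_ties B (8 / r)"
proof (rule subsetI)
  fix w assume "w \<in> cell B r p \<times> cell B r q \<times> cell B r q'"
  then obtain x' y' z' where w: "w = (x', y', z')" "x' \<in> cell B r p" "y' \<in> cell B r q" "z' \<in> cell B r q'" by blast
  have d: "dist x x' \<le> 2 / r" "dist y y' \<le> 2 / r" "dist z z' \<le> 2 / r"
    using assms w by (auto intro: dist_cell_le)
  have "\<bar>dist x' y' - dist x y\<bar> \<le> dist x x' + dist y y'" "\<bar>dist x' z' - dist x z\<bar> \<le> dist x x' + dist z z'"
    by metric+
  then have "\<bar>dist x' y' - dist x' z'\<bar> \<le> 2 * dist x x' + dist y y' + dist z z'" using assms(5) by linarith
  also have "\<dots> \<le> 8 / r" using d by simp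
  finally show "w \<in> near_ties B (8 / r)" using w by (auto simp: near_ties_def cell_def)
qed

lemma sum_measure_le:
  assumes "finite I" "disjoint_family_on A I" "\<And>i. i \<in> I \<Longrightarrow> A i \<in> sets M" "\<And>i. i \<in> I \<Longrightarrow> A i \<subseteq> S"
    "S \<in> sets M" "emeasure M S < \<infinity>"
  shows "(\<Sum>i\<in>I. Sigma_Algebra.measure M (A i)) \<le> Sigma_Algebra.measure M S"
proof -
  have "emeasure M (A i) \<noteq> \<infinity>" if "i \<in> I" for i
    using emeasure_mono[OF assms(4)[OF that] assms(5)] assms(6) by (auto simp: top_unique)
  then have "(\<Sum>i\<in>I. Sigma_Algebra.measure M (A i)) = Sigma_Algebra.measure M (\<Union>i\<in>I. A i)"
    using assms by (intro measure_finite_Union[symmetric]) auto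
  also have "\<dots> \<le> Sigma_Algebra.measure M S"
    using assms by (intro measure_mono_fmeasurable) (auto simp: fmeasurable_def)
  finally show ?thesis .
qed

lemma card_ge_2:
  assumes "finite S" "i \<in> S" "j \<in> S" "i \<noteq> j"
  shows "2 \<le> card S"
  using card_mono[of S "{i, j}"] assms by simp

text \<open>
  The labelling of a Poisson process is arbitrary, so nothing is known about the joint law of the
  points \<^term>\<open>X i\<close> given \<^term>\<open>N\<close>. The hypotheses and the proof therefore only use counts: on a grid of mesh \<open>1 / r\<close>, a tie
  forces two points into one cell, or three points into distinct cells whose product lies within
  \<open>8 / r\<close> of the null set of exact ties.
\<close>

lemma (in prob_space) AE_tie_free:
  assumes B: "B \<in> sets borel" "bounded B" and C: "C2 \<ge> 0" "C3 \<ge> 0"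
    and in_B: "AE \<omega> in M. \<forall>i<N \<omega>. X i \<omega> \<in> B"
    and meas: "\<And>A k. A \<in> sets borel \<Longrightarrow> A \<subseteq> B \<Longrightarrow> {\<omega> \<in> space M. k \<le> point_count N X A \<omega>} \<in> sets M"
    and two: "\<And>A. A \<in> sets borel \<Longrightarrow> A \<subseteq> B \<Longrightarrow>
      prob {\<omega> \<in> space M. 2 \<le> point_count N X A \<omega>} \<le> C2 * (Sigma_Algebra.measure lborel A)\<^sup>2"
    and three: "\<And>A1 A2 A3. A1 \<in> sets borel \<Longrightarrow> A2 \<in> sets borel \<Longrightarrow> A3 \<in> sets borel \<Longrightarrow>
      A1 \<subseteq> B \<Longrightarrow> A2 \<subseteq> B \<Longrightarrow> A3 \<subseteq> B \<Longrightarrow> A1 \<inter> A2 = {} \<Longrightarrow> A1 \<inter> A3 = {} \<Longrightarrow> A2 \<inter> A3 = {} \<Longrightarrow>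
      prob {\<omega> \<in> space M. 1 \<le> point_count N X A1 \<omega> \<and> 1 \<le> point_count N X A2 \<omega> \<and> 1 \<le> point_count N X A3 \<omega>}
        \<le> C3 * (Sigma_Algebra.measure lborel A1 * Sigma_Algebra.measure lborel A2 * Sigma_Algebra.measure lborel A3)"
  shows "AE \<omega> in M. tie_free (configuration N X \<omega>)"
proof -
  define T where "T m = Sigma_Algebra.measure lborel3 (near_ties B (8 / real (Suc m)))" for m
  define r where "r m = real (Suc m)" for m
  have r: "r m > 0" for m by (simp add: r_def)
  define \<kappa> where "\<kappa> m x = (\<lfloor>r m * vec_nth x 1\<rfloor>, \<lfloor>r m * vec_nth x 2\<rfloor>)" for m and x :: "real^2"
  define P where "P m = \<kappa> m ` B" for m
  have finP: "finite (P m)" for m using finite_cells[OF B(2), of "r m"] by (simp add: P_def \<kappa>_def)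
  define c where "c m p = cell B (r m) p" for m p
  have c_in: "x \<in> c m (\<kappa> m x)" "\<kappa> m x \<in> P m" if "x \<in> B" for x m using that by (auto simp: c_def cell_def \<kappa>_def P_def)
  have c_sets [measurable]: "c m p \<in> sets borel" for m p unfolding c_def by (rule sets_cell[OF B(1)])
  have c_B: "c m p \<subseteq> B" for m p by (auto simp: c_def cell_def)
  have c_disj: "c m p \<inter> c m q = {}" if "p \<noteq> q" for m p q using that by (auto simp: c_def cell_def)
  define Q where "Q m = {(p, q, q'). (p, q, q') \<in> P m \<times> P m \<times> P m \<and> p \<noteq> q \<and> p \<noteq> q' \<and> q \<noteq> q' \<and>
     c m p \<times> c m q \<times> c m q' \<subseteq> near_ties B (8 / r m)}" for m
  have finQ: "finite (Q m)" for m
    by (rule finite_subset[of _ "P m \<times> P m \<times> P m"]) (use finP in \<open>auto simp: Q_def\<close>)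
  define E2 where "E2 m p = {\<omega> \<in> space M. 2 \<le> point_count N X (c m p) \<omega>}" for m p
  define E3 where "E3 m = (\<lambda>(p, q, q'). {\<omega> \<in> space M. 1 \<le> point_count N X (c m p) \<omega> \<and> 1 \<le> point_count N X (c m q) \<omega> \<and>
    1 \<le> point_count N X (c m q') \<omega>})" for m
  define F where "F m = (\<Union>p\<in>P m. E2 m p) \<union> (\<Union>t\<in>Q m. E3 m t)" for m
  have E2_sets: "E2 m p \<in> sets M" for m p unfolding E2_def by (rule meas[OF c_sets c_B])
  have E3_sets: "E3 m t \<in> sets M" for m t
  proof -
    obtain p q q' where t: "t = (p, q, q')" by (metis prod_cases3)
    have "E3 m t = {\<omega> \<in> space M. 1 \<le> point_count N X (c m p) \<omega>} \<inter> {\<omega> \<in> space M. 1 \<le> point_count N X (c m q) \<omega>} \<inter>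
        {\<omega> \<in> space M. 1 \<le> point_count N X (c m q') \<omega>}" by (auto simp: E3_def t)
    then show ?thesis using meas[OF c_sets c_B] by auto
  qed
  have F_sets: "F m \<in> sets M" for m
    unfolding F_def using finP finQ E2_sets E3_sets by (intro sets.Un sets.finite_UN) auto
  define b where "b = Sigma_Algebra.measure lborel B"
  have Bfin: "emeasure lborel B < \<infinity>" using emeasure_bounded_finite[OF B(2)] by simp
  \<comment> \<open>One factor of each squared cell area is bounded by the area
    \<open>1 / (r m)\<^sup>2\<close>, and the others sum to at most \<open>b\<close>. The triple
    products are disjoint subsets of \<open>near_ties\<close>, so their volumes sum to at most
    \<open>T m\<close>.\<close>
  have F_le: "prob (F m) \<le> C2 * (b / (r m)\<^sup>2) + C3 * T m" for m
  proof -
    have "prob (\<Union>p\<in>P m. E2 m p) \<le> (\<Sum>p\<in>P m. prob (E2 m p))"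
      using finP E2_sets by (intro finite_measure_subadditive_finite) auto
    also have "\<dots> \<le> (\<Sum>p\<in>P m. C2 * ((1 / (r m)\<^sup>2) * Sigma_Algebra.measure lborel (c m p)))"
    proof (rule sum_mono)
      fix p
      have "prob (E2 m p) \<le> C2 * (Sigma_Algebra.measure lborel (c m p))\<^sup>2"
        unfolding E2_def by (rule two[OF c_sets c_B])
      also have "\<dots> \<le> C2 * ((1 / (r m)\<^sup>2) * Sigma_Algebra.measure lborel (c m p))"
        unfolding c_def power2_eq_square[of "Sigma_Algebra.measure lborel (cell B (r m) p)"]
        by (intro mult_left_mono mult_right_mono measure_cell_le r B C measure_nonneg)
      finally show "prob (E2 m p) \<le> C2 * ((1 / (r m)\<^sup>2) * Sigma_Algebra.measure lborel (c m p))" .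
    qed
    also have "\<dots> = C2 * ((1 / (r m)\<^sup>2) * (\<Sum>p\<in>P m. Sigma_Algebra.measure lborel (c m p)))"
      by (simp add: sum_distrib_left)
    also have "\<dots> \<le> C2 * ((1 / (r m)\<^sup>2) * b)"
      unfolding b_def
      by (intro mult_left_mono sum_measure_le finP c_B Bfin) (use C B(1) c_disj in \<open>auto simp: disjoint_family_on_def\<close>)
    finally have 1: "prob (\<Union>p\<in>P m. E2 m p) \<le> C2 * (b / (r m)\<^sup>2)" by simp
    define cc where "cc = (\<lambda>(p, q, q'). c m p \<times> c m q \<times> c m q')"
    have cc_sets: "cc t \<in> sets lborel3" for t by (auto simp: cc_def split: prod.split)
    have "prob (\<Union>t\<in>Q m. E3 m t) \<le> (\<Sum>t\<in>Q m. prob (E3 m t))"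
      using finQ E3_sets by (intro finite_measure_subadditive_finite) auto
    also have "\<dots> \<le> (\<Sum>t\<in>Q m. C3 * Sigma_Algebra.measure lborel3 (cc t))"
    proof (rule sum_mono)
      fix t assume "t \<in> Q m"
      then obtain p q q' where t: "t = (p, q, q')" "p \<noteq> q" "p \<noteq> q'" "q \<noteq> q'" unfolding Q_def by blast
      have fin: "emeasure lborel (c m p) < \<infinity>" for p
        using emeasure_mono[OF c_B, of lborel m p] B(1) Bfin by (auto intro: order.strict_trans1)
      have "Sigma_Algebra.measure lborel3 (cc t) = Sigma_Algebra.measure lborel (c m p) *
          Sigma_Algebra.measure lborel (c m q) * Sigma_Algebra.measure lborel (c m q')"
        unfolding Sigma_Algebra.measure_def t cc_def using fin
        by (simp add: emeasure_lborel3_Times enn2real_mult)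
      then show "prob (E3 m t) \<le> C3 * Sigma_Algebra.measure lborel3 (cc t)"
        using three[OF c_sets c_sets c_sets c_B c_B c_B c_disj[OF t(2)] c_disj[OF t(3)] c_disj[OF t(4)], of m]
        by (simp add: E3_def t)
    qed
    also have "\<dots> = C3 * (\<Sum>t\<in>Q m. Sigma_Algebra.measure lborel3 (cc t))" by (simp add: sum_distrib_left)
    also have "\<dots> \<le> C3 * T m"
      unfolding T_def
    proof (intro mult_left_mono sum_measure_le finQ cc_sets C sets_near_ties B)
      show "disjoint_family_on cc (Q m)"
        using c_disj by (fastforce simp: disjoint_family_on_def cc_def)
      show "cc t \<subseteq> near_ties B (8 / real (Suc m))" if "t \<in> Q m" for t
        using that by (auto simp: Q_def cc_def r_def)
      have "emeasure lborel3 (near_ties B (8 / real (Suc m))) \<le> emeasure lborel3 (B \<times> B \<times> B)"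
        using B(1) by (intro emeasure_mono) (auto simp: near_ties_def)
      also have "\<dots> < \<infinity>" using Bfin B(1) by (simp add: emeasure_lborel3_Times ennreal_mult_less_top)
      finally show "emeasure lborel3 (near_ties B (8 / real (Suc m))) < \<infinity>" .
    qed
    finally have 2: "prob (\<Union>t\<in>Q m. E3 m t) \<le> C3 * T m" .
    have "prob (F m) \<le> prob (\<Union>p\<in>P m. E2 m p) + prob (\<Union>t\<in>Q m. E3 m t)"
      unfolding F_def using finP finQ E2_sets E3_sets by (intro measure_Un_le sets.finite_UN) auto
    then show ?thesis using 1 2 by simp
  qed
  have "(\<lambda>m. C2 * (b / (r m)\<^sup>2) + C3 * T m) \<longlonglongrightarrow> C2 * 0 + C3 * 0"
  proof (intro tendsto_add tendsto_mult tendsto_const)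
    show "T \<longlonglongrightarrow> 0" unfolding T_def by (rule near_ties_tendsto_0[OF B])
    have "(\<lambda>m. b * (inverse (real (Suc m)))\<^sup>2) \<longlonglongrightarrow> b * 0\<^sup>2"
      by (intro tendsto_intros LIMSEQ_inverse_real_of_nat)
    then show "(\<lambda>m. b / (r m)\<^sup>2) \<longlonglongrightarrow> 0" by (simp add: r_def divide_inverse power_inverse)
  qed
  then have lim: "(\<lambda>m. C2 * (b / (r m)\<^sup>2) + C3 * T m) \<longlonglongrightarrow> 0" by simp
  \<comment> \<open>Every configuration in \<open>B\<close> with a tie lies in all
    \<open>F m\<close>. Their intersection is measurable and bounded by each \<open>F m\<close>,
    hence null; neither monotonicity of \<open>F\<close> nor measurability of the tie event is
    involved.\<close>
  have Int_sets: "(\<Inter>m. F m) \<in> sets M" using F_sets by auto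
  have "prob (\<Inter>m. F m) \<le> C2 * (b / (r m)\<^sup>2) + C3 * T m" for m
    by (rule order.trans[OF finite_measure_mono[OF _ F_sets] F_le]) auto
  then have "prob (\<Inter>m. F m) \<le> 0" using lim by (intro LIMSEQ_le_const) auto
  then have "(\<Inter>m. F m) \<in> null_sets M"
    using Int_sets by (simp add: null_sets_def emeasure_eq_measure measure_le_0_iff)
  then have "AE \<omega> in M. \<omega> \<notin> (\<Inter>m. F m)" by (rule AE_not_in)
  then show ?thesis using in_B AE_space
  proof eventually_elim
    case (elim \<omega>)
    show "tie_free (configuration N X \<omega>)"
    proof (rule ccontr)
      assume "\<not> tie_free (configuration N X \<omega>)"
      then obtain i j l where ijl: "i < N \<omega>" "j < N \<omega>" "l < N \<omega>" "i \<noteq> j" "i \<noteq> l" "j \<noteq> l"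
        "dist (X i \<omega>) (X j \<omega>) = dist (X i \<omega>) (X l \<omega>)"
        by (auto simp: tie_free_def configuration_def)
      have "\<omega> \<in> F m" for m
      proof -
        let ?k = "\<lambda>i. \<kappa> m (X i \<omega>)"
        have inB: "X i \<omega> \<in> B" "X j \<omega> \<in> B" "X l \<omega> \<in> B" using elim(2) ijl by auto
        have same: "\<omega> \<in> F m" if "u < N \<omega>" "v < N \<omega>" "u \<noteq> v" "X u \<omega> \<in> B" "X v \<omega> \<in> B" "?k u = ?k v" for u v
        proof -
          have "2 \<le> card {i. i < N \<omega> \<and> X i \<omega> \<in> c m (?k u)}"
            by (rule card_ge_2[of _ u v]) (use that(1-3,6) c_in(1)[OF that(4), of m] c_in(1)[OF that(5), of m] in simp_all)
          then have "\<omega> \<in> E2 m (?k u)" using elim(3) by (simp add: E2_def point_count_def)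
          then show ?thesis using c_in(2)[OF that(4)] by (auto simp: F_def)
        qed
        show "\<omega> \<in> F m"
        proof (cases "?k i = ?k j \<or> ?k i = ?k l \<or> ?k j = ?k l")
          case True then show ?thesis using same[of i j] same[of i l] same[of j l] ijl inB by blast
        next
          case False
          have "c m (?k i) \<times> c m (?k j) \<times> c m (?k l) \<subseteq> near_ties B (8 / r m)"
            unfolding c_def by (rule cell_triple_subset_near_ties[OF r _ _ _ ijl(7)])
              (use c_in(1)[OF inB(1), of m] c_in(1)[OF inB(2), of m] c_in(1)[OF inB(3), of m] in \<open>simp_all add: c_def\<close>)
          then have Q: "(?k i, ?k j, ?k l) \<in> Q m" using False c_in(2) inB unfolding Q_def by blast
          have "1 \<le> point_count N X (c m (?k u)) \<omega>" if "u < N \<omega>" "X u \<omega> \<in> B" for u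
          proof -
            have "u \<in> {i. i < N \<omega> \<and> X i \<omega> \<in> c m (?k u)}" using that c_in(1)[OF that(2)] by simp
            then have "card {i. i < N \<omega> \<and> X i \<omega> \<in> c m (?k u)} > 0" by (subst card_gt_0_iff) auto
            then show ?thesis by (simp add: point_count_def)
          qed
          then have "\<omega> \<in> E3 m (?k i, ?k j, ?k l)" using elim(3) ijl inB by (simp add: E3_def)
          then show ?thesis using Q by (auto simp: F_def)
        qed
      qed
      then show False using elim(1) by blast
    qed
  qed
qed

section \<open>Count estimates for the Poisson and the binomial process\<close>

lemma (in prob_space) poisson_process_point_count:
  assumes "poisson_process M lam B N X" and A: "A \<in> sets borel" "A \<subseteq> B"
  shows "point_count N X A \<in> measurable M (count_space UNIV)"
    and "prob {\<omega> \<in> space M. point_count N X A \<omega> = k} =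
      (lam * Sigma_Algebra.measure lborel A) ^ k / fact k * exp (- (lam * Sigma_Algebra.measure lborel A))"
proof -
  \<comment> \<open>Measurability of counts is contained in the independence clause, here taken for
    a family with a single member.\<close>
  have "indep_vars (\<lambda>_. count_space UNIV) (\<lambda>j. point_count N X ((\<lambda>_. A) j)) {..<1 :: nat}"
    using assms(1)[unfolded poisson_process_def, THEN conjunct2, THEN conjunct2, THEN conjunct2, THEN conjunct2,
      rule_format, of 1 "\<lambda>_. A"] A by (simp add: disjoint_family_on_def)
  then show "point_count N X A \<in> measurable M (count_space UNIV)" by (auto simp: indep_vars_def)
  show "prob {\<omega> \<in> space M. point_count N X A \<omega> = k} =
      (lam * Sigma_Algebra.measure lborel A) ^ k / fact k * exp (- (lam * Sigma_Algebra.measure lborel A))"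
    using assms(1) A unfolding poisson_process_def by blast
qed

text \<open>For a count of mean x, at least one point has probability at most x, and at least two
  have probability 1 - (1 + x) exp (- x) \<le> 1 - (1 + x) (1 - x) = x^2. With x =
  \<open>lam\<close> times the area this gives the constants \<open>lam\<^sup>2\<close> and, by
  independence, \<open>lam ^ 3\<close>.\<close>

lemma (in prob_space) poisson_process_AE_tie_free:
  assumes pp: "poisson_process M lam B N X" and lam: "lam > 0" and B: "compact B"
  shows "AE \<omega> in M. tie_free (configuration N X \<omega>)"
proof (rule AE_tie_free[where B=B and ?C2.0="lam\<^sup>2" and ?C3.0="lam ^ 3"])
  show "B \<in> sets borel" "bounded B" using B by (auto simp: compact_imp_closed compact_imp_bounded borel_closed)
  show "AE \<omega> in M. \<forall>i<N \<omega>. X i \<omega> \<in> B" using pp by (simp add: poisson_process_def)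
  show meas: "{\<omega> \<in> space M. k \<le> point_count N X A \<omega>} \<in> sets M" if "A \<in> sets borel" "A \<subseteq> B" for A k
    using poisson_process_point_count(1)[OF pp that] by measurable
  have zero: "1 - exp (- x) \<le> x" for x :: real using exp_ge_add_one_self[of "- x"] by simp
  have ge_1: "prob {\<omega> \<in> space M. 1 \<le> point_count N X A \<omega>} \<le> lam * Sigma_Algebra.measure lborel A"
    if A: "A \<in> sets borel" "A \<subseteq> B" for A
  proof -
    have "{\<omega> \<in> space M. 1 \<le> point_count N X A \<omega>} = space M - {\<omega> \<in> space M. point_count N X A \<omega> = 0}" by auto
    moreover have "{\<omega> \<in> space M. point_count N X A \<omega> = 0} \<in> sets M"
      using poisson_process_point_count(1)[OF pp that] by measurable
    ultimately have "prob {\<omega> \<in> space M. 1 \<le> point_count N X A \<omega>} = 1 - prob {\<omega> \<in> space M. point_count N X A \<omega> = 0}"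
      by (simp add: prob_compl)
    then show ?thesis using poisson_process_point_count(2)[OF pp that, of 0] zero by simp
  qed
  show "prob {\<omega> \<in> space M. 2 \<le> point_count N X A \<omega>} \<le> lam\<^sup>2 * (Sigma_Algebra.measure lborel A)\<^sup>2"
    if A: "A \<in> sets borel" "A \<subseteq> B" for A
  proof -
    define x where "x = lam * Sigma_Algebra.measure lborel A"
    have x: "x \<ge> 0" using lam by (simp add: x_def)
    have eq: "{\<omega> \<in> space M. point_count N X A \<omega> = k} \<in> sets M" for k
      using poisson_process_point_count(1)[OF pp that] by measurable
    have "{\<omega> \<in> space M. 2 \<le> point_count N X A \<omega>} =
        space M - ({\<omega> \<in> space M. point_count N X A \<omega> = 0} \<union> {\<omega> \<in> space M. point_count N X A \<omega> = 1})" by auto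
    then have "prob {\<omega> \<in> space M. 2 \<le> point_count N X A \<omega>} =
        1 - (prob {\<omega> \<in> space M. point_count N X A \<omega> = 0} + prob {\<omega> \<in> space M. point_count N X A \<omega> = 1})"
      using eq by (subst finite_measure_Union[symmetric]) (auto simp: prob_compl)
    also have "\<dots> = 1 - (1 + x) * exp (- x)"
      using poisson_process_point_count(2)[OF pp that, of 0] poisson_process_point_count(2)[OF pp that, of 1]
      by (simp add: x_def algebra_simps)
    also have "\<dots> \<le> 1 - (1 + x) * (1 - x)"
      using exp_ge_add_one_self[of "- x"] x by (intro diff_left_mono mult_left_mono) auto
    also have "\<dots> = lam\<^sup>2 * (Sigma_Algebra.measure lborel A)\<^sup>2" by (simp add: x_def algebra_simps power2_eq_square)
    finally show ?thesis .
  qed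
  fix A1 A2 A3 :: "(real^2) set"
  assume A: "A1 \<in> sets borel" "A2 \<in> sets borel" "A3 \<in> sets borel" "A1 \<subseteq> B" "A2 \<subseteq> B" "A3 \<subseteq> B"
    and disj: "A1 \<inter> A2 = {}" "A1 \<inter> A3 = {}" "A2 \<inter> A3 = {}"
  define A where "A j = (if j = 0 then A1 else if j = 1 then A2 else A3)" for j :: nat
  have "indep_vars (\<lambda>_. count_space UNIV) (\<lambda>j. point_count N X (A j)) {..<3}"
  proof -
    have "\<forall>j<3. A j \<in> sets borel \<and> A j \<subseteq> B" using A by (auto simp: A_def)
    moreover have "disjoint_family_on A {..<3}" using disj by (auto simp: A_def disjoint_family_on_def)
    ultimately show ?thesis using pp unfolding poisson_process_def by blast
  qed
  from indep_varsD[OF this _ _ order.refl, of "\<lambda>_. {1..}"]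
  have ind: "prob (\<Inter>j\<in>{..<3}. point_count N X (A j) -` {1..} \<inter> space M) =
      (\<Prod>j<3. prob (point_count N X (A j) -` {1..} \<inter> space M))" by (auto simp: lessThan_empty_iff)
  have vim: "point_count N X A' -` {1..} \<inter> space M = {\<omega> \<in> space M. 1 \<le> point_count N X A' \<omega>}" for A' by auto
  have "{..<3} = {0, 1, 2 :: nat}" by auto
  then have "{\<omega> \<in> space M. 1 \<le> point_count N X A1 \<omega> \<and> 1 \<le> point_count N X A2 \<omega> \<and> 1 \<le> point_count N X A3 \<omega>} =
      (\<Inter>j\<in>{..<3}. point_count N X (A j) -` {1..} \<inter> space M)" by (auto simp: A_def)
  then have "prob {\<omega> \<in> space M. 1 \<le> point_count N X A1 \<omega> \<and> 1 \<le> point_count N X A2 \<omega> \<and> 1 \<le> point_count N X A3 \<omega>} =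
      (\<Prod>j<3. prob {\<omega> \<in> space M. 1 \<le> point_count N X (A j) \<omega>})" using ind by (simp only: vim)
  also have "\<dots> \<le> (\<Prod>j<3. lam * Sigma_Algebra.measure lborel (A j))"
    by (intro prod_mono conjI measure_nonneg ge_1) (use A in \<open>auto simp: A_def\<close>)
  also have "\<dots> = lam ^ 3 * (Sigma_Algebra.measure lborel A1 * Sigma_Algebra.measure lborel A2 * Sigma_Algebra.measure lborel A3)"
    by (simp add: A_def numeral_3_eq_3)
  finally show "prob {\<omega> \<in> space M. 1 \<le> point_count N X A1 \<omega> \<and> 1 \<le> point_count N X A2 \<omega> \<and> 1 \<le> point_count N X A3 \<omega>} \<le>
      lam ^ 3 * (Sigma_Algebra.measure lborel A1 * Sigma_Algebra.measure lborel A2 * Sigma_Algebra.measure lborel A3)" .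
qed (use lam in auto)

text \<open>Almost surely all points lie in \<open>B\<close>, so \<open>N\<close> agrees with the
  count of \<open>B\<close>, whose law is prescribed.\<close>

lemma (in prob_space) poisson_process_total:
  assumes pp: "poisson_process M lam B N X" and B: "B \<in> sets borel"
  shows "N \<in> measurable M (count_space UNIV)"
    and "prob {\<omega> \<in> space M. N \<omega> = k} =
      (lam * Sigma_Algebra.measure lborel B) ^ k / fact k * exp (- (lam * Sigma_Algebra.measure lborel B))"
proof -
  show N: "N \<in> measurable M (count_space UNIV)" using pp by (simp add: poisson_process_def)
  note [measurable] = N poisson_process_point_count(1)[OF pp B order.refl]
  have "AE \<omega> in M. \<forall>i<N \<omega>. X i \<omega> \<in> B" using pp by (simp add: poisson_process_def)
  then have "AE \<omega> in M. N \<omega> = point_count N X B \<omega>"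
  proof eventually_elim
    case (elim \<omega>)
    then have "{i. i < N \<omega> \<and> X i \<omega> \<in> B} = {..<N \<omega>}" by auto
    then show ?case by (simp add: point_count_def)
  qed
  then have "prob {\<omega> \<in> space M. N \<omega> = k} = prob {\<omega> \<in> space M. point_count N X B \<omega> = k}"
    by (intro measure_eq_AE) (auto elim!: eventually_mono)
  then show "prob {\<omega> \<in> space M. N \<omega> = k} =
      (lam * Sigma_Algebra.measure lborel B) ^ k / fact k * exp (- (lam * Sigma_Algebra.measure lborel B))"
    using poisson_process_point_count(2)[OF pp B order.refl] by simp
qed

text \<open>Union bound over ordered pairs and triples of distinct labels: there are at most n^2 and
  n^3 of them, and each point falls into \<open>A\<close> with probability equal to its area divided
  by \<open>b\<close>.\<close>

lemma (in prob_space) binomial_process_AE_tie_free: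
  assumes bp: "binomial_process M n B N X" and B: "compact B" "Sigma_Algebra.measure lborel B > 0"
  shows "AE \<omega> in M. tie_free (configuration N X \<omega>)"
proof -
  define b where "b = Sigma_Algebra.measure lborel B"
  have b: "b > 0" using B by (simp add: b_def)
  have Bs: "B \<in> sets borel" "bounded B" using B by (auto simp: compact_imp_closed compact_imp_bounded borel_closed)
  have Bfin: "emeasure lborel B < \<infinity>" using emeasure_bounded_finite[OF Bs(2)] by simp
  then have eB: "emeasure lborel B = ennreal b" by (simp add: b_def emeasure_eq_ennreal_measure less_top[symmetric])
  have N: "\<And>\<omega>. \<omega> \<in> space M \<Longrightarrow> N \<omega> = n" and ind: "indep_vars (\<lambda>_. borel) X {..<n}"
    and dis: "\<And>i. i < n \<Longrightarrow> distr M borel (X i) = uniform_measure lborel B"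
    using bp unfolding binomial_process_def by auto
  have Xm [measurable]: "X i \<in> borel_measurable M" if "i < n" for i using ind that by (auto simp: indep_vars_def)
  have X_prob: "prob (X i -` A \<inter> space M) = Sigma_Algebra.measure lborel A / b"
    if "i < n" "A \<in> sets borel" "A \<subseteq> B" for i A
  proof -
    have "prob (X i -` A \<inter> space M) = Sigma_Algebra.measure (distr M borel (X i)) A"
      using that Xm by (subst measure_distr) auto
    also have "\<dots> = Sigma_Algebra.measure lborel (B \<inter> A) / b"
      unfolding dis[OF that(1)] b_def using Bs that eB b by (subst measure_uniform_measure) auto
    also have "B \<inter> A = A" using that by auto
    finally show ?thesis .
  qed
  have pc: "point_count N X A \<omega> = card {i. i < n \<and> X i \<omega> \<in> A}" if "\<omega> \<in> space M" for A \<omega>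
    using N[OF that] by (simp add: point_count_def)
  show ?thesis
  proof (rule AE_tie_free[where B=B and ?C2.0="real n ^ 2 / b ^ 2" and ?C3.0="real n ^ 3 / b ^ 3"])
    show "AE \<omega> in M. \<forall>i<N \<omega>. X i \<omega> \<in> B"
    proof -
      have "AE \<omega> in M. X i \<omega> \<in> B" if "i < n" for i
      proof -
        have "AE x in distr M borel (X i). x \<in> B"
          unfolding dis[OF that] using Bs by (intro AE_uniform_measureI) auto
        then show ?thesis using Xm[OF that] Bs by (subst (asm) AE_distr_iff) auto
      qed
      then have "AE \<omega> in M. \<forall>i\<in>{..<n}. X i \<omega> \<in> B" by (intro AE_finite_allI) auto
      then show ?thesis using AE_space by eventually_elim (use N in auto)
    qed
    fix A :: "(real^2) set" assume A: "A \<in> sets borel" "A \<subseteq> B"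
    note [measurable] = A(1)
    show "{\<omega> \<in> space M. k \<le> point_count N X A \<omega>} \<in> sets M" for k
    proof -
      \<comment> \<open>As a sum of indicators the count is visibly measurable, and only
        \<open>X i\<close> with \<open>i < n\<close> occur in it.\<close>
      have "{\<omega> \<in> space M. k \<le> point_count N X A \<omega>} =
          {\<omega> \<in> space M. real k \<le> (\<Sum>i<n. indicator A (X i \<omega>))}"
      proof (intro Collect_cong conj_cong refl)
        fix \<omega> assume w: "\<omega> \<in> space M"
        have "(\<Sum>i<n. indicator A (X i \<omega>)) = (\<Sum>i\<in>{i. i < n \<and> X i \<omega> \<in> A}. 1 :: real)"
          by (rule sum.mono_neutral_cong_right) (auto simp: indicator_def)
        then show "k \<le> point_count N X A \<omega> \<longleftrightarrow> real k \<le> (\<Sum>i<n. indicator A (X i \<omega>))"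
          by (simp add: pc[OF w])
      qed
      also have "\<dots> \<in> sets M"
      proof -
        have "(\<lambda>\<omega>. \<Sum>i<n. indicator A (X i \<omega>) :: real) \<in> borel_measurable M"
          by (intro borel_measurable_sum measurable_compose[OF Xm borel_measurable_indicator]) (use A in auto)
        then show ?thesis by measurable
      qed
      finally show ?thesis .
    qed
    show "prob {\<omega> \<in> space M. 2 \<le> point_count N X A \<omega>} \<le> real n ^ 2 / b ^ 2 * (Sigma_Algebra.measure lborel A)\<^sup>2"
    proof -
      define I where "I = {(i, j). i < n \<and> j < n \<and> i \<noteq> j}"
      define E where "E = (\<lambda>(i, j). (X i -` A \<inter> space M) \<inter> (X j -` A \<inter> space M))"
      have I: "I \<subseteq> {..<n} \<times> {..<n}" by (auto simp: I_def)
      then have finI: "finite I" by (rule finite_subset) simp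
      have E: "E t \<in> sets M" "prob (E t) = (Sigma_Algebra.measure lborel A / b)\<^sup>2" if tI: "t \<in> I" for t
      proof -
        obtain i j where t: "t = (i, j)" "i < n" "j < n" "i \<noteq> j" using tI unfolding I_def by blast
        show "E t \<in> sets M" unfolding E_def t(1) using measurable_sets[OF Xm[OF t(2)] A(1)] measurable_sets[OF Xm[OF t(3)] A(1)] by auto
        have "prob (E t) = prob (\<Inter>u\<in>{i, j}. X u -` A \<inter> space M)" by (simp add: E_def t)
        also have "\<dots> = (\<Prod>u\<in>{i, j}. prob (X u -` A \<inter> space M))"
          by (rule indep_varsD[OF ind]) (use t A in auto)
        also have "\<dots> = (Sigma_Algebra.measure lborel A / b)\<^sup>2" using t A by (simp add: X_prob power2_eq_square)
        finally show "prob (E t) = (Sigma_Algebra.measure lborel A / b)\<^sup>2" .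
      qed
      have "{\<omega> \<in> space M. 2 \<le> point_count N X A \<omega>} \<subseteq> (\<Union>t\<in>I. E t)"
      proof
        fix \<omega> assume "\<omega> \<in> {\<omega> \<in> space M. 2 \<le> point_count N X A \<omega>}"
        then have w: "\<omega> \<in> space M" "2 \<le> card {i. i < n \<and> X i \<omega> \<in> A}" by (auto simp: pc)
        then obtain S where "S \<subseteq> {i. i < n \<and> X i \<omega> \<in> A}" "card S = 2" by (meson obtain_subset_with_card_n)
        then obtain i j where "i \<noteq> j" "i < n" "j < n" "X i \<omega> \<in> A" "X j \<omega> \<in> A" by (auto simp: card_2_iff)
        then have "(i, j) \<in> I" "\<omega> \<in> E (i, j)" using w by (auto simp: I_def E_def)
        then show "\<omega> \<in> (\<Union>t\<in>I. E t)" by blast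
      qed
      then have "prob {\<omega> \<in> space M. 2 \<le> point_count N X A \<omega>} \<le> prob (\<Union>t\<in>I. E t)"
        using finI E by (intro finite_measure_mono sets.finite_UN) auto
      also have "\<dots> \<le> (\<Sum>t\<in>I. prob (E t))"
        using finI E by (intro finite_measure_subadditive_finite) auto
      also have "\<dots> = real (card I) * (Sigma_Algebra.measure lborel A / b)\<^sup>2" using E by simp
      also have "\<dots> \<le> real (n * n) * (Sigma_Algebra.measure lborel A / b)\<^sup>2"
        using card_mono[OF _ I] by (intro mult_right_mono of_nat_mono) auto
      also have "\<dots> = real n ^ 2 / b ^ 2 * (Sigma_Algebra.measure lborel A)\<^sup>2" by (simp add: power2_eq_square)
      finally show ?thesis .
    qed
  next
    fix A1 A2 A3 :: "(real^2) set"
    assume A: "A1 \<in> sets borel" "A2 \<in> sets borel" "A3 \<in> sets borel" "A1 \<subseteq> B" "A2 \<subseteq> B" "A3 \<subseteq> B"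
      and disj: "A1 \<inter> A2 = {}" "A1 \<inter> A3 = {}" "A2 \<inter> A3 = {}"
    let ?m = "\<lambda>A. Sigma_Algebra.measure lborel A"
    define I where "I = {(i, j, l). i < n \<and> j < n \<and> l < n \<and> i \<noteq> j \<and> i \<noteq> l \<and> j \<noteq> l}"
    define E where "E = (\<lambda>(i, j, l). (X i -` A1 \<inter> space M) \<inter> ((X j -` A2 \<inter> space M) \<inter> (X l -` A3 \<inter> space M)))"
    have I: "I \<subseteq> {..<n} \<times> {..<n} \<times> {..<n}" by (auto simp: I_def)
    then have finI: "finite I" by (rule finite_subset) simp
    have E: "E t \<in> sets M" "prob (E t) = (?m A1 / b) * (?m A2 / b) * (?m A3 / b)" if tI: "t \<in> I" for t
    proof -
      obtain i j l where t: "t = (i, j, l)" "i < n" "j < n" "l < n" "i \<noteq> j" "i \<noteq> l" "j \<noteq> l"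
        using tI unfolding I_def by blast
      show "E t \<in> sets M" unfolding E_def t(1)
        using measurable_sets[OF Xm[OF t(2)] A(1)] measurable_sets[OF Xm[OF t(3)] A(2)] measurable_sets[OF Xm[OF t(4)] A(3)] by auto
      define A' where "A' u = (if u = i then A1 else if u = j then A2 else A3)" for u
      have A': "A' i = A1" "A' j = A2" "A' l = A3" using t by (auto simp: A'_def)
      have "prob (E t) = prob (\<Inter>u\<in>{i, j, l}. X u -` A' u \<inter> space M)" by (simp add: E_def t A')
      also have "\<dots> = (\<Prod>u\<in>{i, j, l}. prob (X u -` A' u \<inter> space M))"
        by (rule indep_varsD[OF ind]) (use t A A' in auto)
      also have "\<dots> = (?m A1 / b) * (?m A2 / b) * (?m A3 / b)" using t A by (simp add: X_prob A')
      finally show "prob (E t) = (?m A1 / b) * (?m A2 / b) * (?m A3 / b)" .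
    qed
    have "{\<omega> \<in> space M. 1 \<le> point_count N X A1 \<omega> \<and> 1 \<le> point_count N X A2 \<omega> \<and> 1 \<le> point_count N X A3 \<omega>} \<subseteq> (\<Union>t\<in>I. E t)"
    proof
      fix \<omega> assume "\<omega> \<in> {\<omega> \<in> space M. 1 \<le> point_count N X A1 \<omega> \<and> 1 \<le> point_count N X A2 \<omega> \<and> 1 \<le> point_count N X A3 \<omega>}"
      then have w: "\<omega> \<in> space M" and ge: "1 \<le> point_count N X A1 \<omega>"
        "1 \<le> point_count N X A2 \<omega>" "1 \<le> point_count N X A3 \<omega>"
        by blast+
      from ge[unfolded pc[OF w]]
      have "{i. i < n \<and> X i \<omega> \<in> A1} \<noteq> {}" "{i. i < n \<and> X i \<omega> \<in> A2} \<noteq> {}" "{i. i < n \<and> X i \<omega> \<in> A3} \<noteq> {}"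
        by (metis card.empty not_one_le_zero)+
      then obtain i j l where ijl: "i < n" "X i \<omega> \<in> A1" "j < n" "X j \<omega> \<in> A2" "l < n" "X l \<omega> \<in> A3" by blast
      then have "i \<noteq> j" "i \<noteq> l" "j \<noteq> l" using disj by auto
      then have "(i, j, l) \<in> I" "\<omega> \<in> E (i, j, l)" using w ijl by (auto simp: I_def E_def)
      then show "\<omega> \<in> (\<Union>t\<in>I. E t)" by blast
    qed
    then have "prob {\<omega> \<in> space M. 1 \<le> point_count N X A1 \<omega> \<and> 1 \<le> point_count N X A2 \<omega> \<and> 1 \<le> point_count N X A3 \<omega>} \<le> prob (\<Union>t\<in>I. E t)"
      using finI E by (intro finite_measure_mono sets.finite_UN) auto
    also have "\<dots> \<le> (\<Sum>t\<in>I. prob (E t))"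
      using finI E by (intro finite_measure_subadditive_finite) auto
    also have "\<dots> = real (card I) * ((?m A1 / b) * (?m A2 / b) * (?m A3 / b))" using E by simp
    also have "\<dots> \<le> real (n * (n * n)) * ((?m A1 / b) * (?m A2 / b) * (?m A3 / b))"
      using card_mono[OF _ I] b by (intro mult_right_mono of_nat_mono) auto
    also have "\<dots> = real n ^ 3 / b ^ 3 * (?m A1 * ?m A2 * ?m A3)" by (simp add: power3_eq_cube)
    finally show "prob {\<omega> \<in> space M. 1 \<le> point_count N X A1 \<omega> \<and> 1 \<le> point_count N X A2 \<omega> \<and> 1 \<le> point_count N X A3 \<omega>} \<le>
      real n ^ 3 / b ^ 3 * (?m A1 * ?m A2 * ?m A3)" .
  qed (use Bs b in auto)
qed

section \<open>The error exponent\<close>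

theorem lemma1:
  fixes M :: "'w measure"
    and lam \<sigma>0 \<sigma>1 :: real
    and g :: "real \<Rightarrow> real"
    and B :: "nat \<Rightarrow> (real^2) set"
    and N :: "nat \<Rightarrow> 'w \<Rightarrow> nat"
    and X :: "nat \<Rightarrow> nat \<Rightarrow> 'w \<Rightarrow> real^2"
    and Y :: "nat \<Rightarrow> nat \<Rightarrow> 'w \<Rightarrow> real"
    and \<Sigma>1 :: "(real^2) list \<Rightarrow> real mat"
    and D :: "'w \<Rightarrow> real"
  assumes "prob_space M"
    and "lam > 0" "\<sigma>0 > 0" "\<sigma>1 > 0"
    and regions: "(\<forall>n\<ge>1. centered_square (real n / lam) (B n)) \<or>
                  (\<forall>n\<ge>1. centered_disc (real n / lam) (B n))"
    and points: "(\<forall>n\<ge>1. binomial_process M n (B n) (N n) (X n)) \<or>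
                 (\<forall>n\<ge>1. poisson_process M lam (B n) (N n) (X n))"
    and marks: "\<forall>n\<ge>1. iid_normal_marks M \<sigma>0 (N n) (X n) (Y n)"
    and H1: "\<forall>n\<ge>1. AE \<omega> in M. H1_covariance g \<sigma>1
               (configuration (N n) (X n) \<omega>) (\<Sigma>1 (configuration (N n) (X n) \<omega>))"
    and error_exponent:
      "AE \<omega> in M. (\<lambda>n. 1 / real n *
           ln (mvn_density (H0_covariance \<sigma>0 (configuration (N n) (X n) \<omega>)) (sample (N n) (Y n) \<omega>)
             / mvn_density (\<Sigma>1 (configuration (N n) (X n) \<omega>)) (sample (N n) (Y n) \<omega>)))
         \<longlonglongrightarrow> D \<omega>"
  shows "AE \<omega> in M. \<exists>L.
    (\<lambda>n. 1 / (2 * real n) *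
       ((\<Sum>i<N n \<omega>. (1 / \<sigma>1\<^sup>2 - 1 / \<sigma>0\<^sup>2) * (Y n i \<omega>)\<^sup>2) +
        (\<Sum>(i, j)\<in>{(i, j)\<in>nn_edges (configuration (N n) (X n) \<omega>). i < j}.
           let R = dist (X n i \<omega>) (X n j \<omega>) in
             ln (1 - (g R)\<^sup>2)
             + (g R)\<^sup>2 / (1 - (g R)\<^sup>2) * (((Y n i \<omega>)\<^sup>2 + (Y n j \<omega>)\<^sup>2) / \<sigma>1\<^sup>2)
             - 2 * g R / (1 - (g R)\<^sup>2) * (Y n i \<omega> * Y n j \<omega> / \<sigma>1\<^sup>2))))
      \<longlonglongrightarrow> L \<and>
    D \<omega> = ln (\<sigma>1 / \<sigma>0) + L"
proof -
  interpret prob_space M by fact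
  have region: "compact (B n) \<and> Sigma_Algebra.measure lborel (B n) = real n / lam" if "n \<ge> 1" for n
    using regions that \<open>lam > 0\<close> centered_square_area[of "real n / lam" "B n"] centered_disc_area[of "real n / lam" "B n"]
    by auto
  have ties: "AE \<omega> in M. tie_free (configuration (N n) (X n) \<omega>)" if "n \<ge> 1" for n
    using points
  proof
    assume "\<forall>n\<ge>1. binomial_process M n (B n) (N n) (X n)"
    then show ?thesis
      using region[OF that] \<open>lam > 0\<close> that by (intro binomial_process_AE_tie_free[of n "B n"]) auto
  next
    assume "\<forall>n\<ge>1. poisson_process M lam (B n) (N n) (X n)"
    then show ?thesis
      using region[OF that] \<open>lam > 0\<close> that by (intro poisson_process_AE_tie_free[of lam "B n"]) auto
  qed
  have ratio: "AE \<omega> in M. (\<lambda>n. real (N n \<omega>) / real n) \<longlonglongrightarrow> 1"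
    using points
  proof
    assume b: "\<forall>n\<ge>1. binomial_process M n (B n) (N n) (X n)"
    have "(\<lambda>n. real (N n \<omega>) / real n) \<longlonglongrightarrow> 1" if "\<omega> \<in> space M" for \<omega>
    proof (rule tendsto_eventually)
      show "\<forall>\<^sub>F n in sequentially. real (N n \<omega>) / real n = 1"
        using eventually_ge_at_top[of 1]
        by eventually_elim (use b that in \<open>auto simp: binomial_process_def\<close>)
    qed
    then show ?thesis by (rule AE_I2)
  next
    assume p: "\<forall>n\<ge>1. poisson_process M lam (B n) (N n) (X n)"
    show ?thesis
    proof (rule poisson_AE_ratio_tendsto)
      fix n :: nat assume n: "n \<ge> 1"
      have B: "B n \<in> sets borel" using region[OF n] by (auto simp: compact_imp_closed borel_closed)
      have pp: "poisson_process M lam (B n) (N n) (X n)" using p n by blast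
      show "N n \<in> measurable M (count_space UNIV)" by (rule poisson_process_total(1)[OF pp B])
      show "prob {\<omega> \<in> space M. N n \<omega> = k} = real n ^ k / fact k * exp (- real n)" for k
        using poisson_process_total(2)[OF pp B, of k] region[OF n] \<open>lam > 0\<close> by simp
    qed
  qed
  \<comment> \<open>Countably many null sets are discarded at once, so that the rest of the argument
    concerns one fixed outcome and all \<open>n\<close>.\<close>
  have "AE \<omega> in M. \<forall>n. n \<ge> 1 \<longrightarrow> tie_free (configuration (N n) (X n) \<omega>) \<and>
      H1_covariance g \<sigma>1 (configuration (N n) (X n) \<omega>) (\<Sigma>1 (configuration (N n) (X n) \<omega>))"
    unfolding AE_all_countable
  proof
    fix n
    show "AE \<omega> in M. n \<ge> 1 \<longrightarrow> tie_free (configuration (N n) (X n) \<omega>) \<and>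
      H1_covariance g \<sigma>1 (configuration (N n) (X n) \<omega>) (\<Sigma>1 (configuration (N n) (X n) \<omega>))"
    proof (cases "n \<ge> 1")
      case True
      from ties[OF True] H1[rule_format, OF True] show ?thesis by eventually_elim simp
    qed simp
  qed
  then show ?thesis using ratio error_exponent
  proof eventually_elim
    case (elim \<omega>)
    define llr where "llr n = ln (mvn_density (H0_covariance \<sigma>0 (configuration (N n) (X n) \<omega>)) (sample (N n) (Y n) \<omega>)
             / mvn_density (\<Sigma>1 (configuration (N n) (X n) \<omega>)) (sample (N n) (Y n) \<omega>))" for n
    define W where "W n = (\<Sum>i<N n \<omega>. (1 / \<sigma>1\<^sup>2 - 1 / \<sigma>0\<^sup>2) * (Y n i \<omega>)\<^sup>2) +
        (\<Sum>(i, j)\<in>{(i, j)\<in>nn_edges (configuration (N n) (X n) \<omega>). i < j}.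
           let R = dist (X n i \<omega>) (X n j \<omega>) in
             ln (1 - (g R)\<^sup>2)
             + (g R)\<^sup>2 / (1 - (g R)\<^sup>2) * (((Y n i \<omega>)\<^sup>2 + (Y n j \<omega>)\<^sup>2) / \<sigma>1\<^sup>2)
             - 2 * g R / (1 - (g R)\<^sup>2) * (Y n i \<omega> * Y n j \<omega> / \<sigma>1\<^sup>2))" for n
    have llr: "llr n = real (N n \<omega>) * ln (\<sigma>1 / \<sigma>0) + 1 / 2 * W n" if n: "n \<ge> 1" for n
    proof -
      define xs where "xs = configuration (N n) (X n) \<omega>"
      have nth: "xs ! i = X n i \<omega>" if "i < N n \<omega>" for i
        using that by (simp add: xs_def configuration_def)
      have len: "length xs = N n \<omega>" by (simp add: xs_def configuration_def)
      have "tie_free xs" "H1_covariance g \<sigma>1 xs (\<Sigma>1 xs)" using elim(1) n by (simp_all add: xs_def)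
      from log_likelihood_ratio[OF this \<open>\<sigma>0 > 0\<close> \<open>\<sigma>1 > 0\<close>, of "\<lambda>i. Y n i \<omega>"]
      have "llr n = real (N n \<omega>) * ln (\<sigma>1 / \<sigma>0) +
        1 / 2 * ((\<Sum>i<N n \<omega>. (1 / \<sigma>1\<^sup>2 - 1 / \<sigma>0\<^sup>2) * (Y n i \<omega>)\<^sup>2) +
          (\<Sum>(i, j)\<in>{(i, j)\<in>nn_edges xs. i < j}.
            let R = dist (xs ! i) (xs ! j) in
             ln (1 - (g R)\<^sup>2)
             + (g R)\<^sup>2 / (1 - (g R)\<^sup>2) * (((Y n i \<omega>)\<^sup>2 + (Y n j \<omega>)\<^sup>2) / \<sigma>1\<^sup>2)
             - 2 * g R / (1 - (g R)\<^sup>2) * (Y n i \<omega> * Y n j \<omega> / \<sigma>1\<^sup>2)))"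
        unfolding llr_def sample_def xs_def[symmetric] len .
      also have "(\<Sum>(i, j)\<in>{(i, j)\<in>nn_edges xs. i < j}.
            let R = dist (xs ! i) (xs ! j) in
             ln (1 - (g R)\<^sup>2)
             + (g R)\<^sup>2 / (1 - (g R)\<^sup>2) * (((Y n i \<omega>)\<^sup>2 + (Y n j \<omega>)\<^sup>2) / \<sigma>1\<^sup>2)
             - 2 * g R / (1 - (g R)\<^sup>2) * (Y n i \<omega> * Y n j \<omega> / \<sigma>1\<^sup>2)) =
        (\<Sum>(i, j)\<in>{(i, j)\<in>nn_edges xs. i < j}.
            let R = dist (X n i \<omega>) (X n j \<omega>) in
             ln (1 - (g R)\<^sup>2)
             + (g R)\<^sup>2 / (1 - (g R)\<^sup>2) * (((Y n i \<omega>)\<^sup>2 + (Y n j \<omega>)\<^sup>2) / \<sigma>1\<^sup>2)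
             - 2 * g R / (1 - (g R)\<^sup>2) * (Y n i \<omega> * Y n j \<omega> / \<sigma>1\<^sup>2))"
        by (rule sum.cong) (auto simp: nn_edges_def len nth)
      finally show ?thesis by (simp only: W_def xs_def)
    qed
    \<comment> \<open>The normalised bracket differs from the normalised log-likelihood ratio by N /
      n times log (s1 / s0), a convergent sequence. So it converges too, and its limit is the
      witness for \<open>L\<close>.\<close>
    have "(\<lambda>n. 1 / real n * llr n - real (N n \<omega>) / real n * ln (\<sigma>1 / \<sigma>0)) \<longlonglongrightarrow> D \<omega> - 1 * ln (\<sigma>1 / \<sigma>0)"
      by (intro tendsto_intros elim(2) elim(3)[folded llr_def])
    moreover have "\<forall>\<^sub>F n in sequentially. 1 / real n * llr n - real (N n \<omega>) / real n * ln (\<sigma>1 / \<sigma>0) = 1 / (2 * real n) * W n"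
      using eventually_ge_at_top[of 1] by eventually_elim (simp add: llr add_divide_distrib)
    ultimately have "(\<lambda>n. 1 / (2 * real n) * W n) \<longlonglongrightarrow> D \<omega> - 1 * ln (\<sigma>1 / \<sigma>0)"
      by (rule Lim_transform_eventually)
    then show ?case unfolding W_def by (intro exI[of _ "D \<omega> - 1 * ln (\<sigma>1 / \<sigma>0)"]) auto
  qed
qed

end
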